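(* Let $K>0$, $\varepsilon>0$, and let $\xi$ be a complex-valued $\mathcal{F}_0$-measurable random variable with $\mathbb{P}(|\xi|\le1)=1$. The stochastic differential equation $$dh=K(1-h^2)\,dt+\sqrt2\,i\,\varepsilon\,h\circ dW,\qquad h(0)=\xi,$$ has a unique $(\mathcal{F}_t)_{t\ge0}$-adapted solution $h\in C([0,T],\mathbb{C})$ almost surely, for any $T>0$. Furthermore, $$\mathbb{P}\Big(\sup_{t\ge0}|h(t)|\le1\Big)=1.$$ More precisely: (i) If $|\xi|=1$ a.s., then a.s. $|h(t)|=1$ for all $t\ge0$. (ii) If $|\xi|<1$ a.s., then a.s. $|h(t)|<1$ for all $t\ge0$.
   Context: $(\Omega,\mathcal{F},\mathbb{P})$ is a probability space with a standard complete filtration $(\mathcal{F}_t)_{t\ge0}$, $W$ is a one-dimensional real Brownian motion associated to $(\mathcal{F}_t)$, and $\circ$ denotes the Stratonovich product. *)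

theory Defs
  imports "HOL-Probability.Probability"
begin

section \<open>Filtrations and Brownian motion\<close>

text \<open>
  Processes and filtrations are indexed by real times, of which only those \<open>t \<ge> 0\<close> matter.
  The library's \<^const>\<open>filtration\<close> and \<^const>\<open>stopping_time\<close> range over a whole index type and
  are therefore applied to the extension of \<open>F\<close> that is constant on negative times.
\<close>

locale usual_filtration = prob_space M + complete_measure M
  for M :: "'a measure" +
  fixes F :: "real \<Rightarrow> 'a measure"
  assumes filtration: "filtration (space M) (\<lambda>t. F (max 0 t))"
    and subalgebra: "\<And>t. 0 \<le> t \<Longrightarrow> subalgebra M (F t)"
    and null_sets: "null_sets M \<subseteq> sets (F 0)"
    and right_continuous: "\<And>t. 0 \<le> t \<Longrightarrow> (\<Inter>s\<in>{t<..}. sets (F s)) = sets (F t)"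

definition adapted :: "(real \<Rightarrow> 'a measure) \<Rightarrow> (real \<Rightarrow> 'a \<Rightarrow> 'b::topological_space) \<Rightarrow> bool" where
  "adapted F X \<longleftrightarrow> (\<forall>t\<ge>0. X t \<in> borel_measurable (F t))"

definition ae_continuous :: "'a measure \<Rightarrow> (real \<Rightarrow> 'a \<Rightarrow> 'b::topological_space) \<Rightarrow> bool" where
  "ae_continuous M X \<longleftrightarrow> (AE \<omega> in M. continuous_on {0..} (\<lambda>t. X t \<omega>))"

definition brownian_motion ::
  "'a measure \<Rightarrow> (real \<Rightarrow> 'a measure) \<Rightarrow> (real \<Rightarrow> 'a \<Rightarrow> real) \<Rightarrow> bool" where
  "brownian_motion M F W \<longleftrightarrow>
     adapted F W \<and> ae_continuous M W \<and> (AE \<omega> in M. W 0 \<omega> = 0) \<and>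
     (\<forall>s t. 0 \<le> s \<and> s < t \<longrightarrow>
        distributed M lborel (\<lambda>\<omega>. W t \<omega> - W s \<omega>) (normal_density 0 (sqrt (t - s))) \<and>
        prob_space.indep_set M (sets (F s))
          (sets (vimage_algebra (space M) (\<lambda>\<omega>. W t \<omega> - W s \<omega>) borel)))"


section \<open>Continuous semimartingales\<close>

definition martingale :: "'a measure \<Rightarrow> (real \<Rightarrow> 'a measure) \<Rightarrow> (real \<Rightarrow> 'a \<Rightarrow> real) \<Rightarrow> bool" where
  "martingale M F X \<longleftrightarrow>
     adapted F X \<and> (\<forall>t\<ge>0. integrable M (X t)) \<and>
     (\<forall>s t. 0 \<le> s \<and> s \<le> t \<longrightarrow> (AE \<omega> in M. real_cond_exp M (F s) (X t) \<omega> = X s \<omega>))"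

text \<open>
  Localizing times may be taken finite: otherwise replace \<open>\<tau> n\<close> by \<open>min (\<tau> n) n\<close>.
\<close>

definition continuous_local_martingale ::
  "'a measure \<Rightarrow> (real \<Rightarrow> 'a measure) \<Rightarrow> (real \<Rightarrow> 'a \<Rightarrow> real) \<Rightarrow> bool" where
  "continuous_local_martingale M F X \<longleftrightarrow>
     adapted F X \<and> ae_continuous M X \<and>
     (\<exists>\<tau> :: nat \<Rightarrow> 'a \<Rightarrow> real.
        (\<forall>n. stopping_time (\<lambda>t. F (max 0 t)) (\<tau> n) \<and> (\<forall>\<omega>\<in>space M. 0 \<le> \<tau> n \<omega>)) \<and>
        (AE \<omega> in M. incseq (\<lambda>n. \<tau> n \<omega>) \<and> filterlim (\<lambda>n. \<tau> n \<omega>) at_top sequentially) \<and>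
        (\<forall>n. martingale M F (\<lambda>t \<omega>. X (min t (\<tau> n \<omega>)) \<omega> - X 0 \<omega>)))"

text \<open>The points \<open>p 0 \<le> p 1 \<le> \<dots> \<le> p n\<close> divide \<open>[0, t]\<close> into \<open>n\<close> subintervals.\<close>

definition subdivision :: "real \<Rightarrow> nat \<Rightarrow> (nat \<Rightarrow> real) \<Rightarrow> bool" where
  "subdivision t n p \<longleftrightarrow> p 0 = 0 \<and> p n = t \<and> (\<forall>i<n. p i \<le> p (Suc i))"

definition locally_bounded_variation :: "(real \<Rightarrow> real) \<Rightarrow> bool" where
  "locally_bounded_variation f \<longleftrightarrow>
     (\<forall>t\<ge>0. \<exists>B. \<forall>n p. subdivision t n p \<longrightarrow> (\<Sum>i<n. \<bar>f (p (Suc i)) - f (p i)\<bar>) \<le> B)"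

definition continuous_semimartingale ::
  "'a measure \<Rightarrow> (real \<Rightarrow> 'a measure) \<Rightarrow> (real \<Rightarrow> 'a \<Rightarrow> real) \<Rightarrow> bool" where
  "continuous_semimartingale M F X \<longleftrightarrow>
     adapted F X \<and>
     (\<exists>L A. continuous_local_martingale M F L \<and>
        adapted F A \<and> ae_continuous M A \<and>
        (AE \<omega> in M. locally_bounded_variation (\<lambda>t. A t \<omega>)) \<and>
        (AE \<omega> in M. \<forall>t\<ge>0. X t \<omega> = L t \<omega> + A t \<omega>))"

definition complex_continuous_semimartingale ::
  "'a measure \<Rightarrow> (real \<Rightarrow> 'a measure) \<Rightarrow> (real \<Rightarrow> 'a \<Rightarrow> complex) \<Rightarrow> bool" where
  "complex_continuous_semimartingale M F X \<longleftrightarrow>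
     continuous_semimartingale M F (\<lambda>t \<omega>. Re (X t \<omega>)) \<and>
     continuous_semimartingale M F (\<lambda>t \<omega>. Im (X t \<omega>))"


section \<open>Stratonovich integrals and equations\<close>

definition stratonovich_sum ::
  "(real \<Rightarrow> 'a \<Rightarrow> complex) \<Rightarrow> (real \<Rightarrow> 'a \<Rightarrow> real) \<Rightarrow> nat \<Rightarrow> (nat \<Rightarrow> real) \<Rightarrow> 'a \<Rightarrow> complex" where
  "stratonovich_sum X W n p \<omega> =
     (\<Sum>i<n. (X (p i) \<omega> + X (p (Suc i)) \<omega>) / 2 * of_real (W (p (Suc i)) \<omega> - W (p i) \<omega>))"

text \<open>
  The random variable \<open>J\<close> is the integral of \<open>X \<circ> dW\<close> over \<open>[0, t]\<close>: the limit in probability of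
  the symmetrized Riemann sums as the mesh tends to \<open>0\<close>. It is used only for continuous
  semimartingales \<open>X\<close>, where it agrees with the Ito integral plus half the covariation of
  \<open>X\<close> and \<open>W\<close>.
\<close>

definition has_stratonovich_integral ::
  "'a measure \<Rightarrow> (real \<Rightarrow> 'a \<Rightarrow> complex) \<Rightarrow> (real \<Rightarrow> 'a \<Rightarrow> real) \<Rightarrow> real \<Rightarrow> ('a \<Rightarrow> complex) \<Rightarrow> bool"
  where
  "has_stratonovich_integral M X W t J \<longleftrightarrow>
     J \<in> borel_measurable M \<and>
     (\<forall>\<eta>>0. \<forall>e>0. \<exists>\<delta>>0. \<forall>n p.
        subdivision t n p \<and> (\<forall>i<n. p (Suc i) - p i < \<delta>) \<longrightarrow>
        \<P>(\<omega> in M. cmod (stratonovich_sum X W n p \<omega> - J \<omega>) > \<eta>) < e)"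

text \<open>
  Solutions on \<open>[0, T]\<close> of \<open>dh = b(h) dt + \<sigma>(h) \<circ> dW\<close>, \<open>h(0) = \<xi>\<close>. Semimartingales are defined on
  \<open>[0, \<infinity>)\<close>, hence the process stopped at \<open>T\<close>.
\<close>

definition stratonovich_solution ::
  "'a measure \<Rightarrow> (real \<Rightarrow> 'a measure) \<Rightarrow> (real \<Rightarrow> 'a \<Rightarrow> real) \<Rightarrow> (complex \<Rightarrow> complex) \<Rightarrow>
   (complex \<Rightarrow> complex) \<Rightarrow> ('a \<Rightarrow> complex) \<Rightarrow> real \<Rightarrow> (real \<Rightarrow> 'a \<Rightarrow> complex) \<Rightarrow> bool" where
  "stratonovich_solution M F W b \<sigma> \<xi> T h \<longleftrightarrow>
     (\<forall>t\<in>{0..T}. h t \<in> borel_measurable (F t)) \<and>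
     (AE \<omega> in M. continuous_on {0..T} (\<lambda>t. h t \<omega>)) \<and>
     complex_continuous_semimartingale M F (\<lambda>t. h (min t T)) \<and>
     (AE \<omega> in M. h 0 \<omega> = \<xi> \<omega>) \<and>
     (\<exists>J. (\<forall>t\<in>{0..T}. has_stratonovich_integral M (\<lambda>s \<omega>. \<sigma> (h s \<omega>)) W t (J t)) \<and>
        (AE \<omega> in M. \<forall>t\<in>{0..T}.
           h t \<omega> = \<xi> \<omega> + integral {0..t} (\<lambda>s. b (h s \<omega>)) + J t \<omega>))"

end

theory Submission
  imports Defs
begin

text \<open>
  The noise is linear, so the equation reduces to an ordinary differential equation along each
  Brownian path (Doss--Sussmann). With \<open>a = \<surd>2 \<epsilon>\<close> and \<open>h = exp (i a W) u\<close>, Stratonovich calculus turns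
  it into \<open>u' = K exp (-i a W) (1 - h\<^sup>2)\<close>. Along this flow \<open>1 - |u|\<^sup>2\<close> solves a scalar linear equation,
  so it keeps its sign, which gives the invariance of the circle and of the open disc.

  That \<open>h\<close> solves the equation is checked on Riemann sums: the trapezoidal rule for the exponential has
  cubic error, and cubic sums of Brownian increments vanish. Its martingale part is identified
  through the characteristic function of the Gaussian increments.

  Conversely, \<open>exp (-i a W) h\<close> must be shown to satisfy the differential equation for an arbitrary
  solution \<open>h\<close>. The integral over a coarse interval is the limit of refined sums, and refining a
  trapezoidal sum changes it by discrete Levy areas \<open>\<Sum> \<delta>h dW - \<Sum> \<delta>W dh\<close>, where \<open>\<delta>\<close> is the oscillation
  within the coarse interval. Since \<open>W\<close>, local martingales and processes of bounded
  variation are good integrators, these areas vanish with the coarse mesh.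
\<close>

section \<open>Partitions and Riemann sums\<close>

text \<open>The integral in the equation is a limit in probability of trapezoidal sums, one limit
  for each time, so the product rule for \<open>exp (-i a W) h'\<close> has to be recovered from the
  sums themselves. Three obstacles shape the estimates. The field 1 - z^2 is not globally Lipschitz;
  it is divided by a positive factor that equals 1 on the closed disc, which keeps the equation for
  1 - |u|^2 linear and so does not disturb the invariance. Next, a coarse trapezoid can be compared
  with the integral only after a refinement whose fineness is not controlled by the coarse mesh; the
  bounds for the areas must therefore combine the coarse oscillation with quantities that do not
  depend on the refinement. Finally, a localized martingale is only known to be integrable, so its
  increments need not have second moments. Truncating it at a level yields square integrable
  martingale differences and a compensator whose L^1 norm is bounded by that of the final value,
  again uniformly in the refinement.\<close>

definition partition_seq :: "real \<Rightarrow> real \<Rightarrow> (nat \<Rightarrow> nat) \<Rightarrow> (nat \<Rightarrow> nat \<Rightarrow> real) \<Rightarrow> bool" where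
  "partition_seq \<alpha> \<beta> N p \<longleftrightarrow>
     (\<forall>m. p m 0 = \<alpha> \<and> p m (N m) = \<beta> \<and> (\<forall>i<N m. p m i \<le> p m (Suc i))) \<and>
     (\<forall>\<delta>>0. \<forall>\<^sub>F m in sequentially. \<forall>i<N m. p m (Suc i) - p m i < \<delta>)"

text \<open>For \<open>n = 0\<close> the quotient is 0 and every point is \<open>\<alpha>\<close>;
  \<open>grid_Suc\<close> and \<open>grid_mem\<close> remain true in that case.\<close>

definition grid :: "real \<Rightarrow> real \<Rightarrow> nat \<Rightarrow> nat \<Rightarrow> real" where
  "grid \<alpha> \<beta> n i = \<alpha> + (\<beta> - \<alpha>) * real i / real n"

lemma grid_0 [simp]: "grid \<alpha> \<beta> n 0 = \<alpha>"
  by (simp add: grid_def)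

lemma grid_self: "n > 0 \<Longrightarrow> grid \<alpha> \<beta> n n = \<beta>"
  by (simp add: grid_def)

lemma grid_Suc: "grid \<alpha> \<beta> n (Suc i) = grid \<alpha> \<beta> n i + (\<beta> - \<alpha>) / real n"
  by (cases "n = 0") (simp_all add: grid_def field_simps)

lemma grid_mono: "\<alpha> \<le> \<beta> \<Longrightarrow> i \<le> j \<Longrightarrow> grid \<alpha> \<beta> n i \<le> grid \<alpha> \<beta> n j"
  unfolding grid_def by (intro add_left_mono divide_right_mono mult_left_mono) auto

lemma grid_mem: "\<alpha> \<le> \<beta> \<Longrightarrow> i \<le> n \<Longrightarrow> grid \<alpha> \<beta> n i \<in> {\<alpha>..\<beta>}"
  using grid_mono[of \<alpha> \<beta> 0 i n] grid_mono[of \<alpha> \<beta> i n n] grid_self[of n \<alpha> \<beta>]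
  by (cases "n = 0") auto

lemma partition_seq_grid:
  assumes "\<alpha> \<le> \<beta>"
  shows "partition_seq \<alpha> \<beta> Suc (\<lambda>m. grid \<alpha> \<beta> (Suc m))"
  unfolding partition_seq_def
proof (intro conjI allI impI)
  fix \<delta> :: real assume "\<delta> > 0"
  have "(\<lambda>m. (\<beta> - \<alpha>) / real (Suc m)) \<longlonglongrightarrow> 0"
    by (rule LIMSEQ_Suc[OF lim_const_over_n])
  from order_tendstoD(2)[OF this \<open>\<delta> > 0\<close>]
  show "\<forall>\<^sub>F m in sequentially. \<forall>i<Suc m. grid \<alpha> \<beta> (Suc m) (Suc i) - grid \<alpha> \<beta> (Suc m) i < \<delta>"
    by eventually_elim (simp add: grid_Suc)
qed (use assms in \<open>auto intro: grid_self grid_mono\<close>)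

lemma partition_mono:
  fixes p :: "nat \<Rightarrow> real"
  assumes "\<forall>i<n. p i \<le> p (Suc i)" "i \<le> j" "j \<le> n"
  shows "p i \<le> p j"
  using assms(2,3)
proof (induction j rule: dec_induct)
  case (step k)
  then have "p i \<le> p k" "p k \<le> p (Suc k)" using assms(1) by auto
  then show ?case by simp
qed simp

lemma partition_seq_mem:
  assumes "partition_seq \<alpha> \<beta> N p" "i < N m" "s \<in> {p m i..p m (Suc i)}"
  shows "s \<in> {\<alpha>..\<beta>}"
proof -
  have a: "\<forall>i<N m. p m i \<le> p m (Suc i)" and b: "p m 0 = \<alpha>" "p m (N m) = \<beta>"
    using assms(1) by (auto simp: partition_seq_def)
  have "p m 0 \<le> p m i" "p m (Suc i) \<le> p m (N m)"
    using assms(2) by (auto intro!: partition_mono[OF a])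
  then show ?thesis using b assms(3) by auto
qed

lemma partition_seq_le: "partition_seq \<alpha> \<beta> N p \<Longrightarrow> \<alpha> \<le> \<beta>"
  unfolding partition_seq_def using partition_mono[of "N 0" "p 0" 0 "N 0"] by auto

text \<open>Uniform continuity on the compact interval. Any two points of a cell are compared,
  because later sums sample at the left end, at the right end and at both.\<close>

lemma partition_seq_osc:
  fixes \<phi> :: "real \<Rightarrow> 'b::metric_space"
  assumes p: "partition_seq \<alpha> \<beta> N p" and c: "continuous_on {\<alpha>..\<beta>} \<phi>" and "\<epsilon> > 0"
  shows "\<forall>\<^sub>F m in sequentially. \<forall>i<N m. \<forall>s\<in>{p m i..p m (Suc i)}. \<forall>r\<in>{p m i..p m (Suc i)}.
           dist (\<phi> r) (\<phi> s) < \<epsilon>"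
proof -
  have "uniformly_continuous_on {\<alpha>..\<beta>} \<phi>"
    using c by (intro compact_uniformly_continuous) auto
  then obtain \<delta> where "\<delta> > 0"
    and \<delta>: "\<And>x y. x \<in> {\<alpha>..\<beta>} \<Longrightarrow> y \<in> {\<alpha>..\<beta>} \<Longrightarrow> dist x y < \<delta> \<Longrightarrow> dist (\<phi> x) (\<phi> y) < \<epsilon>"
    unfolding uniformly_continuous_on_def using \<open>\<epsilon> > 0\<close> by (metis dist_commute)
  have "\<forall>\<^sub>F m in sequentially. \<forall>i<N m. p m (Suc i) - p m i < \<delta>"
    using p \<open>\<delta> > 0\<close> by (auto simp: partition_seq_def)
  then show ?thesis
  proof eventually_elim
    case (elim m)
    show ?case
    proof (intro allI impI ballI)
      fix i s r assume i: "i < N m" and s: "s \<in> {p m i..p m (Suc i)}" and r: "r \<in> {p m i..p m (Suc i)}"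
      have "dist r s < \<delta>" using elim[rule_format, OF i] s r by (auto simp: dist_real_def)
      then show "dist (\<phi> r) (\<phi> s) < \<epsilon>"
        using partition_seq_mem[OF p i] s r by (intro \<delta>) auto
    qed
  qed
qed

lemma integral_partition:
  fixes f :: "real \<Rightarrow> 'b::euclidean_space"
  assumes "\<forall>i<n. p i \<le> p (Suc i)" "f integrable_on {p 0..p n}"
  shows "integral {p 0..p n} f = (\<Sum>i<n. integral {p i..p (Suc i)} f)"
  using assms
proof (induction n)
  case (Suc n)
  have le: "p 0 \<le> p n" "p n \<le> p (Suc n)" using Suc.prems(1) partition_mono[of "Suc n" p 0 n] by auto
  have "integral {p 0..p n} f + integral {p n..p (Suc n)} f = integral {p 0..p (Suc n)} f"
    using le Suc.prems by (intro Henstock_Kurzweil_Integration.integral_combine) auto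
  moreover have "f integrable_on {p 0..p n}"
    using Suc.prems(2) by (rule integrable_on_subinterval) (use le in auto)
  ultimately show ?case using Suc by simp
qed simp

text \<open>Only the weight is sampled; \<open>f\<close> is integrated exactly over each cell. The
  error is the integral of \<open>(c m i - \<phi> s) * f s\<close>, at most the weight error times a
  bound for \<open>f\<close> times the length. This covers weights taken at an end point as well as
  means over both ends.\<close>

lemma weighted_riemann_tendsto:
  fixes f \<phi> :: "real \<Rightarrow> complex" and c :: "nat \<Rightarrow> nat \<Rightarrow> complex"
  assumes p: "partition_seq \<alpha> \<beta> N p"
    and f: "continuous_on {\<alpha>..\<beta>} f" and \<phi>: "continuous_on {\<alpha>..\<beta>} \<phi>"
    and c: "\<And>\<epsilon>. \<epsilon> > 0 \<Longrightarrow> \<forall>\<^sub>F m in sequentially. \<forall>i<N m. \<forall>s\<in>{p m i..p m (Suc i)}. cmod (c m i - \<phi> s) \<le> \<epsilon>"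
  shows "(\<lambda>m. \<Sum>i<N m. c m i * integral {p m i..p m (Suc i)} f) \<longlonglongrightarrow> integral {\<alpha>..\<beta>} (\<lambda>s. \<phi> s * f s)"
proof (rule tendstoI)
  fix e :: real assume "e > 0"
  have \<alpha>\<beta>: "\<alpha> \<le> \<beta>" using partition_seq_le[OF p] .
  have "compact (f ` {\<alpha>..\<beta>})" by (intro compact_continuous_image f) auto
  then obtain B where B: "\<And>s. s \<in> {\<alpha>..\<beta>} \<Longrightarrow> cmod (f s) \<le> B" "B \<ge> 0"
    by (metis (no_types, opaque_lifting) abs_ge_zero abs_le_iff bounded_iff compact_imp_bounded dual_order.trans image_eqI linorder_linear)
  \<comment> \<open>The summands 1 keep the denominator positive when \<open>B = 0\<close> or
    \<open>\<alpha> = \<beta>\<close>; the factor 2 leaves room for the strict inequality.\<close>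
  define \<eta> where "\<eta> = e / (2 * (B + 1) * (\<beta> - \<alpha> + 1))"
  have "\<eta> > 0" using \<open>e > 0\<close> B \<alpha>\<beta> by (auto simp: \<eta>_def intro!: divide_pos_pos mult_pos_pos)
  from c[OF this] show "\<forall>\<^sub>F m in sequentially. dist (\<Sum>i<N m. c m i * integral {p m i..p m (Suc i)} f)
      (integral {\<alpha>..\<beta>} (\<lambda>s. \<phi> s * f s)) < e"
  proof eventually_elim
    case (elim m)
    have pm: "p m 0 = \<alpha>" "p m (N m) = \<beta>" "\<forall>i<N m. p m i \<le> p m (Suc i)"
      using p by (auto simp: partition_seq_def)
    have sub: "{p m i..p m (Suc i)} \<subseteq> {\<alpha>..\<beta>}" if "i < N m" for i
      using partition_seq_mem[OF p that] by auto
    have int: "g integrable_on {p m i..p m (Suc i)}"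
      if "i < N m" "continuous_on {\<alpha>..\<beta>} g" for i and g :: "real \<Rightarrow> complex"
      by (rule integrable_continuous_real, rule continuous_on_subset[OF that(2) sub[OF that(1)]])
    have \<phi>f: "continuous_on {\<alpha>..\<beta>} (\<lambda>s. \<phi> s * f s)" by (intro continuous_intros f \<phi>)
    have "integral {\<alpha>..\<beta>} (\<lambda>s. \<phi> s * f s) = (\<Sum>i<N m. integral {p m i..p m (Suc i)} (\<lambda>s. \<phi> s * f s))"
      using integral_partition[of "N m" "p m" "\<lambda>s. \<phi> s * f s"] pm integrable_continuous_real[OF \<phi>f] by simp
    moreover have "c m i * integral {p m i..p m (Suc i)} f - integral {p m i..p m (Suc i)} (\<lambda>s. \<phi> s * f s)
        = integral {p m i..p m (Suc i)} (\<lambda>s. (c m i - \<phi> s) * f s)" if "i < N m" for i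
    proof -
      have "continuous_on {\<alpha>..\<beta>} (\<lambda>s. c m i * f s)" by (intro continuous_intros f)
      from integral_diff[OF int[OF that this] int[OF that \<phi>f]]
      show ?thesis by (simp only: left_diff_distrib integral_mult_right)
    qed
    ultimately have "dist (\<Sum>i<N m. c m i * integral {p m i..p m (Suc i)} f) (integral {\<alpha>..\<beta>} (\<lambda>s. \<phi> s * f s))
       = cmod (\<Sum>i<N m. integral {p m i..p m (Suc i)} (\<lambda>s. (c m i - \<phi> s) * f s))"
      by (simp add: dist_norm sum_subtractf[symmetric])
    also have "\<dots> \<le> (\<Sum>i<N m. (\<eta> * B) * (p m (Suc i) - p m i))"
    proof (rule sum_norm_le)
      fix i assume i: "i \<in> {..<N m}"
      show "cmod (integral {p m i..p m (Suc i)} (\<lambda>s. (c m i - \<phi> s) * f s)) \<le> \<eta> * B * (p m (Suc i) - p m i)"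
      proof (rule integral_bound)
        show "continuous_on {p m i..p m (Suc i)} (\<lambda>s. (c m i - \<phi> s) * f s)"
          using sub[of i] i by (intro continuous_intros continuous_on_subset[OF f] continuous_on_subset[OF \<phi>]) auto
        fix s assume s: "s \<in> {p m i..p m (Suc i)}"
        show "norm ((c m i - \<phi> s) * f s) \<le> \<eta> * B"
          unfolding norm_mult using elim i s B sub[of i] \<open>\<eta> > 0\<close> by (intro mult_mono) auto
      qed (use pm i in auto)
    qed
    also have "\<dots> = \<eta> * B * (\<beta> - \<alpha>)"
      unfolding sum_distrib_left[symmetric] using sum_lessThan_telescope[of "p m" "N m"] pm by simp
    also have "\<dots> \<le> \<eta> * (B + 1) * (\<beta> - \<alpha> + 1)"
      using \<open>\<eta> > 0\<close> B \<alpha>\<beta> by (intro mult_mono) auto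
    also have "\<dots> = e / 2"
    proof -
      have "B + 1 \<noteq> 0" "\<beta> - \<alpha> + 1 \<noteq> 0" using B(2) \<alpha>\<beta> by auto
      then show ?thesis by (simp add: \<eta>_def divide_simps)
    qed
    finally show ?case using \<open>e > 0\<close> by simp
  qed
qed

text \<open>The weighted sums with integrand 1 and \<open>f\<close> itself as weight. It exhibits an
  integral as a limit of finite sums of values, from which measurability of integrals of processes
  will follow.\<close>

lemma left_riemann_tendsto:
  fixes f :: "real \<Rightarrow> complex"
  assumes "\<alpha> \<le> \<beta>" and f: "continuous_on {\<alpha>..\<beta>} f"
  shows "(\<lambda>m. \<Sum>i<Suc m. f (grid \<alpha> \<beta> (Suc m) i) * of_real ((\<beta> - \<alpha>) / real (Suc m))) \<longlonglongrightarrow> integral {\<alpha>..\<beta>} f"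
proof -
  have p: "partition_seq \<alpha> \<beta> Suc (\<lambda>m. grid \<alpha> \<beta> (Suc m))"
    by (rule partition_seq_grid) fact
  have "(\<lambda>m. \<Sum>i<Suc m. f (grid \<alpha> \<beta> (Suc m) i) *
      integral {grid \<alpha> \<beta> (Suc m) i..grid \<alpha> \<beta> (Suc m) (Suc i)} (\<lambda>_. 1)) \<longlonglongrightarrow> integral {\<alpha>..\<beta>} (\<lambda>s. f s * 1)"
  proof (rule weighted_riemann_tendsto[OF p _ f])
    fix \<epsilon> :: real assume "\<epsilon> > 0"
    show "\<forall>\<^sub>F m in sequentially. \<forall>i<Suc m. \<forall>s\<in>{grid \<alpha> \<beta> (Suc m) i..grid \<alpha> \<beta> (Suc m) (Suc i)}.
        cmod (f (grid \<alpha> \<beta> (Suc m) i) - f s) \<le> \<epsilon>"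
      using partition_seq_osc[OF p f \<open>\<epsilon> > 0\<close>]
      by eventually_elim (use grid_mono[OF assms(1), of _ "Suc _"] in \<open>auto simp: dist_norm less_imp_le\<close>)
  qed auto
  moreover have "integral {grid \<alpha> \<beta> (Suc m) i..grid \<alpha> \<beta> (Suc m) (Suc i)} (\<lambda>_. 1)
      = complex_of_real ((\<beta> - \<alpha>) / real (Suc m))" for m i
    using grid_mono[OF assms(1), of i "Suc i" "Suc m"]
    by (simp add: scaleR_conv_of_real del: of_nat_Suc) (simp add: grid_Suc del: of_nat_Suc)
  ultimately show ?thesis by (simp only: mult_1_right)
qed

section \<open>Pathwise differential equations\<close>

lemma has_derivative_of_integral_equation:
  fixes u f :: "real \<Rightarrow> complex"
  assumes "continuous_on {0..T} f" and u: "\<And>t. t \<in> {0..T} \<Longrightarrow> u t = u0 + integral {0..t} f" and "t \<in> {0..T}"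
  shows "(u has_vector_derivative f t) (at t within {0..T})"
proof -
  have "((\<lambda>t. u0 + integral {0..t} f) has_vector_derivative (0 + f t)) (at t within {0..T})"
    by (intro has_vector_derivative_add has_vector_derivative_const integral_has_vector_derivative assms)
  then have "((\<lambda>t. u0 + integral {0..t} f) has_vector_derivative f t) (at t within {0..T})" by simp
  then show ?thesis
    by (rule has_vector_derivative_transform_within[where d=1, OF _ _ assms(3)]) (use u in auto)
qed

text \<open>Integrating factor: \<open>z * E\<close> has derivative 0. It is applied over the reals
  to 1 - |u|^2 and over the complex numbers to the difference of two solutions.\<close>

lemma linear_ode_solution:
  fixes z c :: "real \<Rightarrow> 'b::{banach,real_normed_field}"
  assumes c: "continuous_on {0..T} c"
    and z: "\<And>t. t \<in> {0..T} \<Longrightarrow> (z has_vector_derivative c t * z t) (at t within {0..T})"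
    and t: "t \<in> {0..T}"
  shows "z t = z 0 * exp (integral {0..t} c)"
proof -
  define E where "E = (\<lambda>t. exp (- integral {0..t} c))"
  have E: "(E has_vector_derivative - c s * E s) (at s within {0..T})" if "s \<in> {0..T}" for s
  proof -
    have "((\<lambda>t. - integral {0..t} c) has_vector_derivative - c s) (at s within {0..T})"
      by (intro has_vector_derivative_minus integral_has_vector_derivative c that)
    moreover have "(exp has_field_derivative E s)
        (at (- integral {0..s} c) within (\<lambda>t. - integral {0..t} c) ` {0..T})"
      unfolding E_def by (rule DERIV_subset[OF DERIV_exp]) simp
    ultimately show ?thesis
      using field_vector_diff_chain_within[of "\<lambda>t. - integral {0..t} c" "- c s" s "{0..T}" exp "E s"]
      by (simp add: o_def E_def)
  qed
  have "((\<lambda>t. z t * E t) has_vector_derivative 0) (at s within {0..T})" if "s \<in> {0..T}" for s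
    using has_vector_derivative_mult[OF z[OF that] E[OF that]] by (simp add: algebra_simps)
  then obtain k where "\<And>s. s \<in> {0..T} \<Longrightarrow> z s * E s = k"
    using has_vector_derivative_zero_constant[of "{0..T}" "\<lambda>t. z t * E t"] by auto
  then have "z t * E t = z 0 * E 0" using t by auto
  then show ?thesis by (simp add: E_def exp_minus field_simps)
qed

section \<open>Picard iteration for a bounded Lipschitz field\<close>

fun picard :: "(real \<Rightarrow> complex \<Rightarrow> complex) \<Rightarrow> complex \<Rightarrow> nat \<Rightarrow> real \<Rightarrow> complex" where
  "picard f x0 0 t = x0"
| "picard f x0 (Suc n) t = x0 + integral {0..t} (\<lambda>s. f s (picard f x0 n s))"

text \<open>\<open>cont\<close> asks for continuity along continuous paths, which is the form that
  the integrals use. The constants in \<open>lip\<close> and \<open>bnd\<close> do not depend on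
  time, so a single estimate covers all of [0, \<infinity>).\<close>

context
  fixes f :: "real \<Rightarrow> complex \<Rightarrow> complex" and x0 :: complex and L B :: real
  assumes cont: "\<And>y T. continuous_on {0..T} y \<Longrightarrow> continuous_on {0..T} (\<lambda>s. f s (y s))"
    and lip: "\<And>s x y. s \<ge> 0 \<Longrightarrow> cmod (f s x - f s y) \<le> L * cmod (x - y)"
    and bnd: "\<And>s x. s \<ge> 0 \<Longrightarrow> cmod (f s x) \<le> B"
    and L: "L > 0"
begin

lemma picard_continuous: "continuous_on {0..T} (picard f x0 n)"
proof (induction n)
  case (Suc n)
  show ?case
    unfolding picard.simps
    by (intro continuous_intros indefinite_integral_continuous_1 integrable_continuous_real cont Suc)
qed (simp add: continuous_on_const)

text \<open>The weight \<open>exp (2 * L * t)\<close> makes an iteration a contraction by 1/2: the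
  integral of \<open>L * exp (2 * L * s)\<close> over [0, t] is less than half of
  \<open>exp (2 * L * t)\<close>. The decay in \<open>n\<close> is thus geometric on every bounded
  interval.\<close>

lemma picard_step:
  assumes "t \<ge> 0"
  shows "cmod (picard f x0 (Suc n) t - picard f x0 n t) \<le> (B / L) * exp (2 * L * t) / 2 ^ n"
  using assms
proof (induction n arbitrary: t)
  case 0
  have B: "B \<ge> 0" using bnd[of 0 0] norm_ge_zero order_trans by blast
  have "cmod (integral {0..t} (\<lambda>s. f s x0)) \<le> B * (t - 0)"
    using 0 by (intro integral_bound cont continuous_on_const bnd) auto
  \<comment> \<open>The first step is at most \<open>B * t\<close>, and the weight dominates it
    because exp x \<ge> 1 + x.\<close>
  also have "\<dots> \<le> B * (exp (2 * L * t) / L)"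
  proof (intro mult_left_mono B)
    have "t * L \<le> 1 + 2 * L * t" using L 0 by simp
    also have "\<dots> \<le> exp (2 * L * t)" by (rule exp_ge_add_one_self)
    finally show "t - 0 \<le> exp (2 * L * t) / L" using L by (simp add: field_simps)
  qed
  finally show ?case by simp
next
  case (Suc n)
  have B: "B \<ge> 0" using bnd[of 0 0] norm_ge_zero order_trans by blast
  let ?g = "\<lambda>s. B * exp (2 * L * s) / 2 ^ n"
  have der: "((\<lambda>s. B * exp (2 * L * s) / (2 * L) / 2 ^ n) has_vector_derivative ?g s) (at s within {0..t})" for s
    using L by (auto intro!: derivative_eq_intros simp: has_real_derivative_iff_has_vector_derivative[symmetric])
  have g: "(?g has_integral B * exp (2 * L * t) / (2 * L) / 2 ^ n - B * exp (2 * L * 0) / (2 * L) / 2 ^ n) {0..t}"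
    using Suc.prems der by (intro fundamental_theorem_of_calculus) auto
  have i: "(\<lambda>s. f s (picard f x0 k s)) integrable_on {0..t}" for k
    by (intro integrable_continuous_real cont picard_continuous)
  have "picard f x0 (Suc (Suc n)) t - picard f x0 (Suc n) t
     = integral {0..t} (\<lambda>s. f s (picard f x0 (Suc n) s) - f s (picard f x0 n s))"
    using integral_diff[OF i i, of "Suc n" n] by simp
  also have "cmod \<dots> \<le> integral {0..t} ?g"
  proof (intro integral_norm_bound_integral)
    show "?g integrable_on {0..t}" using g by blast
    fix s assume s: "s \<in> {0..t}"
    have "cmod (f s (picard f x0 (Suc n) s) - f s (picard f x0 n s)) \<le> L * cmod (picard f x0 (Suc n) s - picard f x0 n s)"
      using s by (intro lip) auto
    also have "\<dots> \<le> L * ((B / L) * exp (2 * L * s) / 2 ^ n)"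
      using s L by (intro mult_left_mono Suc.IH) auto
    finally show "cmod (f s (picard f x0 (Suc n) s) - f s (picard f x0 n s)) \<le> ?g s" using L by simp
  qed (intro integrable_diff i)
  also have "\<dots> \<le> B * exp (2 * L * t) / (2 * L) / 2 ^ n"
    using integral_unique[OF g] B L by simp
  finally show ?case by (simp add: field_simps)
qed

text \<open>The steps are dominated by a geometric series, so the iterates converge uniformly on
  bounded intervals, and the Lipschitz bound carries the limit through the integral. The pointwise
  \<open>lim\<close> gives one function for all \<open>T\<close>.\<close>

lemma picard_limit:
  shows "\<And>t. t \<ge> 0 \<Longrightarrow> (\<lambda>n. picard f x0 n t) \<longlonglongrightarrow> lim (\<lambda>n. picard f x0 n t)"
    and "continuous_on {0..T} (\<lambda>t. lim (\<lambda>n. picard f x0 n t))"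
    and "\<And>t. t \<ge> 0 \<Longrightarrow> lim (\<lambda>n. picard f x0 n t) = x0 + integral {0..t} (\<lambda>s. f s (lim (\<lambda>n. picard f x0 n s)))"
proof -
  have ul: "uniform_limit {0..T} (picard f x0) (\<lambda>t. lim (\<lambda>n. picard f x0 n t)) sequentially" for T
  proof -
    define C where "C = (B / L) * exp (2 * L * T)"
    have B: "B \<ge> 0" using bnd[of 0 0] norm_ge_zero order_trans by blast
    have "uniformly_convergent_on {0..T} (\<lambda>n t. \<Sum>i<n. picard f x0 (Suc i) t - picard f x0 i t)"
    proof (rule Weierstrass_m_test')
      fix n t assume t: "t \<in> {0..T}"
      have "cmod (picard f x0 (Suc n) t - picard f x0 n t) \<le> (B / L) * exp (2 * L * t) / 2 ^ n"
        using t by (intro picard_step) auto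
      also have "\<dots> \<le> C / 2 ^ n"
        unfolding C_def using t L B by (intro divide_right_mono mult_left_mono) auto
      finally show "cmod (picard f x0 (Suc n) t - picard f x0 n t) \<le> C * (1/2) ^ n"
        by (simp add: power_one_over)
    qed (intro summable_mult summable_geometric; simp)
    then have "uniformly_convergent_on {0..T} (\<lambda>n t. picard f x0 n t - x0)"
      using sum_lessThan_telescope[of "\<lambda>i. picard f x0 i _"] by (simp del: picard.simps(2))
    then obtain l where "uniform_limit {0..T} (\<lambda>n t. picard f x0 n t - x0) l sequentially"
      by (auto simp: uniformly_convergent_on_def)
    from uniform_limit_add[OF this uniform_limit_const[where c = "\<lambda>_. x0"]]
    have "uniformly_convergent_on {0..T} (picard f x0)"
      by (auto simp: uniformly_convergent_on_def)
    then show ?thesis by (simp add: uniformly_convergent_uniform_limit_iff)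
  qed
  show 1: "(\<lambda>n. picard f x0 n t) \<longlonglongrightarrow> lim (\<lambda>n. picard f x0 n t)" if "t \<ge> 0" for t
    using tendsto_uniform_limitI[OF ul[of t]] that by auto
  show 2: "continuous_on {0..T} (\<lambda>t. lim (\<lambda>n. picard f x0 n t))" for T
    by (rule uniform_limit_theorem[OF _ ul]) (auto intro!: always_eventually picard_continuous)
  fix t :: real assume t: "t \<ge> 0"
  let ?u = "\<lambda>s. lim (\<lambda>n. picard f x0 n s)"
  have "uniform_limit {0..t} (\<lambda>n s. f s (picard f x0 n s)) (\<lambda>s. f s (?u s)) sequentially"
  proof (rule uniform_limitI)
    fix e :: real assume "e > 0"
    then have "e / L > 0" using L by simp
    from uniform_limitD[OF ul[of t] this]
    show "\<forall>\<^sub>F n in sequentially. \<forall>s\<in>{0..t}. dist (f s (picard f x0 n s)) (f s (?u s)) < e"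
    proof eventually_elim
      case (elim n)
      show ?case
      proof
        fix s assume s: "s \<in> {0..t}"
        have "dist (f s (picard f x0 n s)) (f s (?u s)) \<le> L * dist (picard f x0 n s) (?u s)"
          using s by (auto simp: dist_norm intro: lip)
        also have "\<dots> < L * (e / L)" using elim s L by (intro mult_strict_left_mono) auto
        finally show "dist (f s (picard f x0 n s)) (f s (?u s)) < e" using L by simp
      qed
    qed
  qed
  from uniform_limit_integral[OF this cont[OF picard_continuous]]
  obtain I J where I: "\<And>n. ((\<lambda>s. f s (picard f x0 n s)) has_integral I n) {0..t}"
      and J: "((\<lambda>s. f s (?u s)) has_integral J) {0..t}" and "I \<longlonglongrightarrow> J"
    by auto
  then have "(\<lambda>n. integral {0..t} (\<lambda>s. f s (picard f x0 n s))) \<longlonglongrightarrow> integral {0..t} (\<lambda>s. f s (?u s))"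
    unfolding integral_unique[OF I] integral_unique[OF J] by simp
  then have "(\<lambda>n. picard f x0 (Suc n) t) \<longlonglongrightarrow> x0 + integral {0..t} (\<lambda>s. f s (?u s))"
    unfolding picard.simps by (intro tendsto_intros)
  moreover have "(\<lambda>n. picard f x0 (Suc n) t) \<longlonglongrightarrow> ?u t"
    using 1[OF t] by (rule LIMSEQ_Suc)
  ultimately show "?u t = x0 + integral {0..t} (\<lambda>s. f s (?u s))"
    using LIMSEQ_unique by blast
qed

end

text \<open>A globally Lipschitz and bounded substitute for 1 - z^2. The divisor is positive and
  equals 1 on the closed disc, so dividing by it changes neither the field there nor the direction
  of the field elsewhere.\<close>

definition disc_field :: "complex \<Rightarrow> complex" where
  "disc_field z = (1 - z\<^sup>2) / of_real ((max 1 (cmod z))\<^sup>2)"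

lemma disc_field_disc: "cmod z \<le> 1 \<Longrightarrow> disc_field z = 1 - z\<^sup>2"
  by (simp add: disc_field_def max_def)

lemma norm_disc_field_le: "cmod (disc_field z) \<le> 2"
proof -
  have "cmod (1 - z\<^sup>2) \<le> 1 + (cmod z)\<^sup>2"
    using norm_triangle_ineq4[of 1 "z\<^sup>2"] by (simp add: norm_power)
  also have "\<dots> \<le> 2 * (max 1 (cmod z))\<^sup>2"
  proof -
    have "1 \<le> (max 1 (cmod z))\<^sup>2" "(cmod z)\<^sup>2 \<le> (max 1 (cmod z))\<^sup>2"
      by (auto intro: one_le_power power_mono)
    then show ?thesis by linarith
  qed
  finally show ?thesis
    unfolding disc_field_def by (simp add: norm_divide norm_power divide_le_eq del: of_real_power)
qed

text \<open>With \<open>\<rho> = 1 / max 1 |z|\<close> the field is the difference of the squares of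
  \<open>\<rho>\<close> and \<open>\<rho> z\<close>. Both are bounded by 1, the first is 1-Lipschitz
  and the second 2-Lipschitz, and squaring doubles the constants on the unit disc: 2 + 4 =
  6.\<close>

lemma disc_field_lipschitz: "cmod (disc_field x - disc_field y) \<le> 6 * cmod (x - y)"
proof -
  define \<rho> where "\<rho> z = 1 / max 1 (cmod z)" for z
  have \<rho>: "0 < \<rho> z" "\<rho> z \<le> 1" "\<rho> z * cmod z \<le> 1" for z
    by (auto simp: \<rho>_def divide_simps)
  have eq: "disc_field z = (of_real (\<rho> z))\<^sup>2 - (of_real (\<rho> z) * z)\<^sup>2" for z
    by (simp add: disc_field_def \<rho>_def power_mult_distrib power_divide diff_divide_distrib)
  have d: "\<bar>\<rho> x - \<rho> y\<bar> = \<bar>max 1 (cmod y) - max 1 (cmod x)\<bar> * \<rho> x * \<rho> y"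
  proof -
    have "\<rho> x - \<rho> y = (max 1 (cmod y) - max 1 (cmod x)) * (\<rho> x * \<rho> y)"
      by (simp add: \<rho>_def field_simps)
    then show ?thesis using \<rho>(1)[of x] \<rho>(1)[of y] by (simp add: abs_mult)
  qed
  have m: "\<bar>max 1 (cmod y) - max 1 (cmod x)\<bar> \<le> cmod (x - y)"
    using norm_triangle_ineq2[of x y] norm_triangle_ineq2[of y x] norm_minus_commute[of x y] by (auto simp: max_def)
  have 1: "\<bar>\<rho> x - \<rho> y\<bar> \<le> cmod (x - y)"
  proof -
    have "\<bar>max 1 (cmod y) - max 1 (cmod x)\<bar> * \<rho> x * \<rho> y \<le> cmod (x - y) * 1 * 1"
      using \<rho> m by (intro mult_mono) (auto simp: less_imp_le)
    then show ?thesis using d by simp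
  qed
  \<comment> \<open>The factor \<open>\<rho> y\<close> in the difference absorbs
    \<open>cmod y\<close>, since \<open>\<rho> y * cmod y \<le> 1\<close>; the bound therefore does
    not grow with \<open>y\<close>.\<close>
  have 2: "\<bar>\<rho> x - \<rho> y\<bar> * cmod y \<le> cmod (x - y)"
  proof -
    have "\<bar>max 1 (cmod y) - max 1 (cmod x)\<bar> * \<rho> x * (\<rho> y * cmod y) \<le> cmod (x - y) * 1 * 1"
      using \<rho> m by (intro mult_mono) (auto simp: less_imp_le)
    then show ?thesis using d by (simp add: mult.assoc)
  qed
  have sq: "cmod (p\<^sup>2 - q\<^sup>2) \<le> 2 * cmod (p - q)" if "cmod p \<le> 1" "cmod q \<le> 1" for p q :: complex
  proof -
    have "p\<^sup>2 - q\<^sup>2 = (p + q) * (p - q)" by (simp add: power2_eq_square algebra_simps)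
    then have "cmod (p\<^sup>2 - q\<^sup>2) = cmod (p + q) * cmod (p - q)" by (simp add: norm_mult)
    also have "\<dots> \<le> 2 * cmod (p - q)"
      using that norm_triangle_ineq[of p q] by (intro mult_right_mono) auto
    finally show ?thesis .
  qed
  have A: "cmod ((of_real (\<rho> x))\<^sup>2 - (of_real (\<rho> y))\<^sup>2) \<le> 2 * cmod (x - y)"
  proof -
    have "cmod (of_real (\<rho> x) - of_real (\<rho> y)) = \<bar>\<rho> x - \<rho> y\<bar>"
      by (metis norm_of_real of_real_diff)
    then show ?thesis
      using sq[of "of_real (\<rho> x)" "of_real (\<rho> y)"] \<rho> 1 by (smt (verit) norm_of_real)
  qed
  have "of_real (\<rho> x) * x - of_real (\<rho> y) * y = of_real (\<rho> x) * (x - y) + of_real (\<rho> x - \<rho> y) * y"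
    by (simp add: algebra_simps)
  then have "cmod (of_real (\<rho> x) * x - of_real (\<rho> y) * y) \<le> \<rho> x * cmod (x - y) + \<bar>\<rho> x - \<rho> y\<bar> * cmod y"
    using norm_triangle_ineq[of "of_real (\<rho> x) * (x - y)" "of_real (\<rho> x - \<rho> y) * y"] \<rho>(1)[of x]
    by (simp add: norm_mult del: of_real_diff)
  also have "\<dots> \<le> 2 * cmod (x - y)"
    using 2 mult_right_mono[OF \<rho>(2)[of x], of "cmod (x - y)"] by simp
  finally have "cmod ((of_real (\<rho> x) * x)\<^sup>2 - (of_real (\<rho> y) * y)\<^sup>2) \<le> 4 * cmod (x - y)"
    using sq[of "of_real (\<rho> x) * x" "of_real (\<rho> y) * y"] \<rho> by (simp add: norm_mult less_imp_le)
  moreover have "disc_field x - disc_field y = ((of_real (\<rho> x))\<^sup>2 - (of_real (\<rho> y))\<^sup>2)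
      - ((of_real (\<rho> x) * x)\<^sup>2 - (of_real (\<rho> y) * y)\<^sup>2)"
    by (simp add: eq)
  ultimately show ?thesis
    using A norm_triangle_ineq4[of "(of_real (\<rho> x))\<^sup>2 - (of_real (\<rho> y))\<^sup>2 :: complex"
        "(of_real (\<rho> x) * x)\<^sup>2 - (of_real (\<rho> y) * y)\<^sup>2"] by simp
qed

lemma continuous_on_disc_field [continuous_intros]:
  assumes "continuous_on S f" shows "continuous_on S (\<lambda>s. disc_field (f s))"
proof -
  have "continuous_on UNIV disc_field"
    by (rule lipschitz_on_continuous_on[of 6])
      (use disc_field_lipschitz in \<open>auto simp: lipschitz_on_def dist_norm\<close>)
  then show ?thesis by (rule continuous_on_compose2[OF _ assms]) auto
qed

section \<open>The rotated equation along one unimodular path\<close>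

definition rot_field :: "(real \<Rightarrow> complex) \<Rightarrow> real \<Rightarrow> real \<Rightarrow> complex \<Rightarrow> complex" where
  "rot_field e K s z = of_real K * cnj (e s) * disc_field (e s * z)"

text \<open>A limit of iterates rather than a chosen solution, so that it will be measurable when
  the path and the starting point are random.\<close>

definition rot_solution :: "(real \<Rightarrow> complex) \<Rightarrow> real \<Rightarrow> complex \<Rightarrow> real \<Rightarrow> complex" where
  "rot_solution e K x0 t = lim (\<lambda>n. picard (rot_field e K) x0 n t)"

context
  fixes e :: "real \<Rightarrow> complex" and K :: real and x0 :: complex
  assumes e: "continuous_on {0..} e" and norm_e: "\<And>s. cmod (e s) = 1"
    and K: "K > 0" and x0: "cmod x0 \<le> 1"
begin

lemma cont_e: "continuous_on {0..T} e"
  using e by (rule continuous_on_subset) auto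

lemma rot_field_continuous: "continuous_on {0..T} y \<Longrightarrow> continuous_on {0..T} (\<lambda>s. rot_field e K s (y s))"
  unfolding rot_field_def by (intro continuous_intros cont_e)

lemma norm_rot_field_le: "cmod (rot_field e K s z) \<le> 2 * K"
  using K norm_disc_field_le[of "e s * z"] by (simp add: rot_field_def norm_mult norm_e)

lemma rot_field_lipschitz: "cmod (rot_field e K s x - rot_field e K s y) \<le> (6 * K) * cmod (x - y)"
proof -
  have "rot_field e K s x - rot_field e K s y = of_real K * cnj (e s) * (disc_field (e s * x) - disc_field (e s * y))"
    by (simp add: rot_field_def algebra_simps)
  then have "cmod (rot_field e K s x - rot_field e K s y) = K * cmod (disc_field (e s * x) - disc_field (e s * y))"
    using K by (simp add: norm_mult norm_e)
  also have "\<dots> \<le> K * (6 * cmod (e s * x - e s * y))"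
    using K by (intro mult_left_mono disc_field_lipschitz) auto
  also have "cmod (e s * x - e s * y) = cmod (x - y)"
    by (simp add: right_diff_distrib[symmetric] norm_mult norm_e)
  finally show ?thesis by (simp add: mult_ac)
qed

lemmas rot_picard = picard_limit[where f = "rot_field e K" and L = "6 * K" and B = "2 * K" and ?x0.0 = x0, folded rot_solution_def,
    OF rot_field_continuous rot_field_lipschitz norm_rot_field_le]

lemma Re_of_real_mult: "Re (of_real r * z) = r * Re z"
  by simp

text \<open>Put h = e u. The derivative of |u|^2 is 2 K Re (cnj h (1 - h^2)) divided by the
  truncation factor, and cnj h h^2 = |u|^2 h turns the real part into Re h (1 - |u|^2). Hence w = 1
  - |u|^2 satisfies w' = c w; the truncation enters only the coefficient \<open>c\<close>, and
  \<open>E\<close> is the exponential of the integral of \<open>c\<close>.\<close>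

lemma rot_solution_modulus:
  assumes t: "t \<ge> 0"
  obtains E where "E > 0" "1 - (cmod (rot_solution e K x0 t))\<^sup>2 = (1 - (cmod x0)\<^sup>2) * E"
proof -
  let ?u = "rot_solution e K x0"
  have u: "continuous_on {0..t} ?u" using rot_picard(2) K by simp
  have eq: "?u s = x0 + integral {0..s} (\<lambda>s. rot_field e K s (?u s))" if "s \<in> {0..t}" for s
    using rot_picard(3)[of s] K that by simp
  have der: "(?u has_vector_derivative rot_field e K s (?u s)) (at s within {0..t})" if "s \<in> {0..t}" for s
    using rot_field_continuous[OF u] eq that by (rule has_derivative_of_integral_equation)
  define c where "c s = - 2 * K * Re (e s * ?u s) / (max 1 (cmod (?u s)))\<^sup>2" for s
  have c: "continuous_on {0..t} c"
    unfolding c_def by (intro continuous_intros u cont_e) auto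
  define w where "w s = 1 - (cmod (?u s))\<^sup>2" for s
  have w: "(w has_vector_derivative c s * w s) (at s within {0..t})" if s: "s \<in> {0..t}" for s
  proof -
    let ?d = "rot_field e K s (?u s)" and ?h = "e s * ?u s"
    have re: "((\<lambda>s. Re (?u s)) has_vector_derivative Re ?d) (at s within {0..t})"
      and im: "((\<lambda>s. Im (?u s)) has_vector_derivative Im ?d) (at s within {0..t})"
      using bounded_linear.has_vector_derivative[OF bounded_linear_Re der[OF s]]
        bounded_linear.has_vector_derivative[OF bounded_linear_Im der[OF s]] .
    have "(w has_vector_derivative 0 - ((Re (?u s) * Re ?d + Re ?d * Re (?u s)) + (Im (?u s) * Im ?d + Im ?d * Im (?u s))))
        (at s within {0..t})"
      unfolding w_def cmod_power2 unfolding power2_eq_square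
      by (intro has_vector_derivative_diff has_vector_derivative_const has_vector_derivative_add
          has_vector_derivative_mult re im)
    moreover have "0 - ((Re (?u s) * Re ?d + Re ?d * Re (?u s)) + (Im (?u s) * Im ?d + Im ?d * Im (?u s)))
        = - 2 * Re (cnj (?u s) * ?d)" by simp
    moreover have "Re (cnj (?u s) * ?d) = K * Re (cnj ?h * (1 - ?h\<^sup>2)) / (max 1 (cmod (?u s)))\<^sup>2"
    proof -
      have "cnj (?u s) * ?d = of_real (K / (max 1 (cmod (?u s)))\<^sup>2) * (cnj ?h * (1 - ?h\<^sup>2))"
        by (simp add: rot_field_def disc_field_def norm_mult norm_e)
      then show ?thesis by (simp only: Re_of_real_mult) simp
    qed
    moreover have "cnj ?h * (1 - ?h\<^sup>2) = cnj ?h - of_real ((cmod (?u s))\<^sup>2) * ?h"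
    proof -
      have "cnj ?h * ?h = of_real ((cmod ?h)\<^sup>2)"
        using complex_norm_square[of ?h] by (simp only: mult.commute)
      then have "cnj ?h * ?h\<^sup>2 = of_real ((cmod (?u s))\<^sup>2) * ?h"
        by (simp add: power2_eq_square mult.assoc[symmetric] norm_mult norm_e)
      then show ?thesis by (simp only: right_diff_distrib mult_1_right)
    qed
    then have "Re (cnj ?h * (1 - ?h\<^sup>2)) = Re ?h * w s"
      by (simp only: minus_complex.simps complex_cnj Re_of_real_mult w_def) (simp add: algebra_simps)
    ultimately have "(w has_vector_derivative - 2 * (K * (Re ?h * w s) / (max 1 (cmod (?u s)))\<^sup>2)) (at s within {0..t})"
      by (simp only:)
    moreover have "- 2 * (K * (Re ?h * w s) / (max 1 (cmod (?u s)))\<^sup>2) = c s * w s"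
      unfolding c_def by (simp only: times_divide_eq_left times_divide_eq_right mult.assoc)
    ultimately show ?thesis by (simp only:)
  qed
  have "w t = w 0 * exp (integral {0..t} c)"
    using linear_ode_solution[OF c w, of t] t by auto
  moreover have "?u 0 = x0" using eq[of 0] t by simp
  ultimately show ?thesis using that[of "exp (integral {0..t} c)"] by (simp add: w_def)
qed

lemma norm_rot_solution:
  assumes "t \<ge> 0"
  shows "cmod (rot_solution e K x0 t) \<le> 1"
    and "cmod x0 = 1 \<Longrightarrow> cmod (rot_solution e K x0 t) = 1"
    and "cmod x0 < 1 \<Longrightarrow> cmod (rot_solution e K x0 t) < 1"
proof -
  obtain E where E: "E > 0" "1 - (cmod (rot_solution e K x0 t))\<^sup>2 = (1 - (cmod x0)\<^sup>2) * E"
    using rot_solution_modulus[OF assms] .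
  have "(cmod x0)\<^sup>2 \<le> 1" using x0 by (simp add: power_le_one_iff)
  then have "0 \<le> (1 - (cmod x0)\<^sup>2) * E" using E(1) by simp
  then have "(cmod (rot_solution e K x0 t))\<^sup>2 \<le> 1" using E(2) by linarith
  then show "cmod (rot_solution e K x0 t) \<le> 1" by (simp add: power_le_one_iff)
  { assume "cmod x0 = 1"
    then have "(cmod (rot_solution e K x0 t))\<^sup>2 = 1" using E by simp
    then show "cmod (rot_solution e K x0 t) = 1" by (simp add: power2_eq_1_iff) (smt (verit) norm_ge_zero) }
  { assume "cmod x0 < 1"
    then have "(cmod x0)\<^sup>2 < 1" by (simp add: power_less_one_iff abs_square_less_1)
    then have "0 < (1 - (cmod x0)\<^sup>2) * E" using E(1) by simp
    then have "(cmod (rot_solution e K x0 t))\<^sup>2 < 1" using E(2) by linarith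
    then show "cmod (rot_solution e K x0 t) < 1" by (simp add: abs_square_less_1) }
qed

text \<open>The solution never leaves the closed disc, so the truncation is inactive and the
  original field appears.\<close>

lemma rot_solution_eq:
  assumes "t \<ge> 0"
  shows "rot_solution e K x0 t = x0 + integral {0..t} (\<lambda>s. of_real K * cnj (e s) * (1 - (e s * rot_solution e K x0 s)\<^sup>2))"
proof -
  have "rot_solution e K x0 t = x0 + integral {0..t} (\<lambda>s. rot_field e K s (rot_solution e K x0 s))"
    using rot_picard(3)[of t] K assms by simp
  also have "integral {0..t} (\<lambda>s. rot_field e K s (rot_solution e K x0 s))
      = integral {0..t} (\<lambda>s. of_real K * cnj (e s) * (1 - (e s * rot_solution e K x0 s)\<^sup>2))"
    by (intro Henstock_Kurzweil_Integration.integral_cong)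
      (simp add: rot_field_def disc_field_disc norm_mult norm_e norm_rot_solution)
  finally show ?thesis .
qed

lemma rot_solution_continuous: "continuous_on {0..T} (rot_solution e K x0)"
  using rot_picard(2) K by simp

text \<open>The field is quadratic: the difference of two solutions satisfies a linear equation
  whose coefficient contains \<open>u + v\<close>, and it vanishes at time 0. The moduli of
  \<open>u\<close> and \<open>v\<close> are not restricted, as is necessary for comparison with an
  arbitrary solution of the equation.\<close>

lemma rot_equation_unique:
  assumes u: "continuous_on {0..T} u" and v: "continuous_on {0..T} v"
    and ueq: "\<And>t. t \<in> {0..T} \<Longrightarrow> u t = y + integral {0..t} (\<lambda>s. of_real K * cnj (e s) * (1 - (e s * u s)\<^sup>2))"
    and veq: "\<And>t. t \<in> {0..T} \<Longrightarrow> v t = y + integral {0..t} (\<lambda>s. of_real K * cnj (e s) * (1 - (e s * v s)\<^sup>2))"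
    and t: "t \<in> {0..T}"
  shows "u t = v t"
proof -
  define c where "c s = - (of_real K * cnj (e s) * (e s)\<^sup>2 * (u s + v s))" for s
  have c: "continuous_on {0..T} c" unfolding c_def by (intro continuous_intros u v cont_e)
  have "((\<lambda>s. u s - v s) has_vector_derivative c s * (u s - v s)) (at s within {0..T})" if s: "s \<in> {0..T}" for s
  proof -
    have "((\<lambda>s. u s - v s) has_vector_derivative (of_real K * cnj (e s) * (1 - (e s * u s)\<^sup>2))
        - (of_real K * cnj (e s) * (1 - (e s * v s)\<^sup>2))) (at s within {0..T})"
      by (intro has_vector_derivative_diff has_derivative_of_integral_equation[OF _ ueq s]
          has_derivative_of_integral_equation[OF _ veq s] continuous_intros u v cont_e)
    then show ?thesis by (simp add: c_def power2_eq_square algebra_simps)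
  qed
  from linear_ode_solution[OF c this t] have "u t - v t = (u 0 - v 0) * exp (integral {0..t} c)" .
  moreover have "u 0 = y" "v 0 = y" using ueq[of 0] veq[of 0] t by auto
  ultimately show ?thesis by simp
qed

end

section \<open>Trapezoidal sums\<close>

text \<open>Let \<open>r1\<close> and \<open>r2\<close> be the Taylor remainders after the linear
  and the quadratic term. All terms up to order two cancel in the trapezoidal rule, which leaves
  \<open>r2 - \<i> * x * r1 / 2\<close>, at most (1/6 + 1/4) |x|^3.\<close>

lemma cis_trapezoid:
  "cmod (cis x - 1 - \<i> * of_real x * ((1 + cis x) / 2)) \<le> \<bar>x\<bar> ^ 3"
proof -
  define r1 where "r1 = cis x - (1 + \<i> * x)"
  define r2 where "r2 = cis x - (1 + \<i> * x + (\<i> * x)\<^sup>2 / 2)"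
  have r1: "cmod r1 \<le> \<bar>x\<bar>\<^sup>2 / 2"
    using iexp_approx1[of x 1] by (simp add: r1_def cis_conv_exp numeral_2_eq_2)
  have r2: "cmod r2 \<le> \<bar>x\<bar> ^ 3 / 6"
    using iexp_approx1[of x 2] by (simp add: r2_def cis_conv_exp numeral_2_eq_2 numeral_3_eq_3)
  have "cis x - 1 - \<i> * of_real x * ((1 + cis x) / 2) = r2 - \<i> * of_real x * r1 / 2"
    by (simp add: r1_def r2_def power2_eq_square field_simps)
  then have "cmod (cis x - 1 - \<i> * of_real x * ((1 + cis x) / 2)) \<le> cmod r2 + \<bar>x\<bar> * cmod r1 / 2"
    using norm_triangle_ineq4[of r2 "\<i> * of_real x * r1 / 2"] by (simp add: norm_mult)
  also have "\<bar>x\<bar> * cmod r1 / 2 \<le> \<bar>x\<bar> * (\<bar>x\<bar>\<^sup>2 / 2) / 2"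
    using r1 by (intro divide_right_mono mult_left_mono) auto
  finally have "cmod (cis x - 1 - \<i> * of_real x * ((1 + cis x) / 2)) \<le> \<bar>x\<bar> ^ 3 / 6 + \<bar>x\<bar> ^ 3 / 4"
    using r2 by (simp add: power2_eq_square power3_eq_cube)
  also have "\<dots> \<le> \<bar>x\<bar> ^ 3" by simp
  finally show ?thesis .
qed

text \<open>Refining a trapezoidal sum changes it by a discrete Levy area.\<close>

lemma trapezoid_levy_area:
  fixes x y :: "nat \<Rightarrow> complex"
  shows "(\<Sum>l<k. (x l + x (Suc l)) / 2 * (y (Suc l) - y l)) - (x 0 + x k) / 2 * (y k - y 0)
    = ((\<Sum>l<k. (x l - x 0) * (y (Suc l) - y l)) - (\<Sum>l<k. (y l - y 0) * (x (Suc l) - x l))) / 2"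
proof (induction k)
  case (Suc k)
  define A B C where "A = (\<Sum>l<k. (x l + x (Suc l)) / 2 * (y (Suc l) - y l))"
    and "B = (\<Sum>l<k. (x l - x 0) * (y (Suc l) - y l))" and "C = (\<Sum>l<k. (y l - y 0) * (x (Suc l) - x l))"
  show ?case
    using Suc unfolding sum.lessThan_Suc A_def[symmetric] B_def[symmetric] C_def[symmetric]
    by (simp add: field_simps) algebra
qed simp

section \<open>Convergence in probability\<close>

lemma min_one_add: "z \<le> x + y \<Longrightarrow> 0 \<le> x \<Longrightarrow> 0 \<le> y \<Longrightarrow> min 1 z \<le> min 1 x + min 1 y" for x y z :: real
  by (auto simp: min_def)

context prob_space
begin

text \<open>Convergence to 0 in probability, in the metric E (min 1 |X|). In this form sums follow
  from subadditivity and almost sure limits from dominated convergence.\<close>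

definition prob_null :: "(nat \<Rightarrow> 'a \<Rightarrow> complex) \<Rightarrow> bool" where
  "prob_null X \<longleftrightarrow> (\<forall>n. X n \<in> borel_measurable M) \<and>
     (\<lambda>n. expectation (\<lambda>\<omega>. min 1 (cmod (X n \<omega>)))) \<longlonglongrightarrow> 0"

lemma integrable_min1: "X \<in> borel_measurable M \<Longrightarrow> integrable M (\<lambda>\<omega>. min 1 (cmod (X \<omega>)))"
  by (rule integrable_const_bound[where B=1]) auto

lemma integrable_indicator_event: "S \<in> sets M \<Longrightarrow> integrable M (indicat_real S)"
  by (rule integrable_const_bound[where B=1]) auto

lemma expectation_min1_nonneg: "0 \<le> expectation (\<lambda>\<omega>. min 1 (cmod (X \<omega>)))"
  by (rule integral_nonneg_AE) auto

lemma prob_null_measurable: "prob_null X \<Longrightarrow> X n \<in> borel_measurable M"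
  by (simp add: prob_null_def)

lemma prob_nullI:
  assumes "\<And>n. X n \<in> borel_measurable M"
    and "\<And>e. e > 0 \<Longrightarrow> \<forall>\<^sub>F n in sequentially. expectation (\<lambda>\<omega>. min 1 (cmod (X n \<omega>))) \<le> e"
  shows "prob_null X"
  unfolding prob_null_def
proof (intro conjI allI assms(1) tendstoI)
  fix e :: real assume "e > 0"
  then have "e / 2 > 0" by simp
  from assms(2)[OF this]
  show "\<forall>\<^sub>F n in sequentially. dist (expectation (\<lambda>\<omega>. min 1 (cmod (X n \<omega>)))) 0 < e"
    by eventually_elim (use \<open>e > 0\<close> expectation_min1_nonneg in \<open>auto simp: dist_real_def\<close>)
qed

lemma prob_null_mono:
  assumes X: "prob_null X" and Y: "\<And>n. Y n \<in> borel_measurable M" and "C > 0"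
    and le: "\<And>n. AE \<omega> in M. cmod (Y n \<omega>) \<le> C * cmod (X n \<omega>)"
  shows "prob_null Y"
  unfolding prob_null_def
proof (intro conjI allI Y)
  show "(\<lambda>n. expectation (\<lambda>\<omega>. min 1 (cmod (Y n \<omega>)))) \<longlonglongrightarrow> 0"
  proof (rule tendsto_sandwich[OF _ _ tendsto_const])
    \<comment> \<open>For \<open>C < 1\<close> the factor \<open>C\<close> would be wrong: at large
      x, min 1 (C x) = 1 exceeds C min 1 x = C. Hence \<open>max 1 C\<close>.\<close>
    show "(\<lambda>n. max 1 C * expectation (\<lambda>\<omega>. min 1 (cmod (X n \<omega>)))) \<longlonglongrightarrow> 0"
      using X tendsto_mult_right_zero unfolding prob_null_def by blast
    show "\<forall>\<^sub>F n in sequentially. expectation (\<lambda>\<omega>. min 1 (cmod (Y n \<omega>)))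
        \<le> max 1 C * expectation (\<lambda>\<omega>. min 1 (cmod (X n \<omega>)))"
    proof (intro always_eventually allI)
      fix n
      have "expectation (\<lambda>\<omega>. min 1 (cmod (Y n \<omega>))) \<le> expectation (\<lambda>\<omega>. max 1 C * min 1 (cmod (X n \<omega>)))"
      proof (rule integral_mono_AE)
        show "AE \<omega> in M. min 1 (cmod (Y n \<omega>)) \<le> max 1 C * min 1 (cmod (X n \<omega>))"
          using le[of n]
        proof eventually_elim
          case (elim \<omega>)
          have "C * cmod (X n \<omega>) \<le> max 1 C * cmod (X n \<omega>)" by (intro mult_right_mono) auto
          then show ?case using elim by (auto simp: min_def)
        qed
      qed (auto intro!: integrable_min1 Y prob_null_measurable[OF X])
      then show "expectation (\<lambda>\<omega>. min 1 (cmod (Y n \<omega>))) \<le> max 1 C * expectation (\<lambda>\<omega>. min 1 (cmod (X n \<omega>)))"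
        by simp
    qed
  qed (auto intro!: always_eventually expectation_min1_nonneg)
qed

lemma prob_null_cong_AE:
  assumes "prob_null X" "\<And>n. Y n \<in> borel_measurable M" "\<And>n. AE \<omega> in M. Y n \<omega> = X n \<omega>"
  shows "prob_null Y"
proof (rule prob_null_mono[OF assms(1,2), of 1])
  show "AE \<omega> in M. cmod (Y n \<omega>) \<le> 1 * cmod (X n \<omega>)" for n
    using assms(3)[of n] by eventually_elim simp
qed simp

lemma prob_null_add:
  assumes X: "prob_null X" and Y: "prob_null Y"
  shows "prob_null (\<lambda>n \<omega>. X n \<omega> + Y n \<omega>)"
  unfolding prob_null_def
proof (intro conjI allI)
  note [measurable] = prob_null_measurable[OF X] prob_null_measurable[OF Y]
  show "(\<lambda>\<omega>. X n \<omega> + Y n \<omega>) \<in> borel_measurable M" for n by measurable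
  show "(\<lambda>n. expectation (\<lambda>\<omega>. min 1 (cmod (X n \<omega> + Y n \<omega>)))) \<longlonglongrightarrow> 0"
  proof (rule tendsto_sandwich[OF _ _ tendsto_const])
    show "(\<lambda>n. expectation (\<lambda>\<omega>. min 1 (cmod (X n \<omega>))) + expectation (\<lambda>\<omega>. min 1 (cmod (Y n \<omega>)))) \<longlonglongrightarrow> 0"
      using X Y tendsto_add_zero unfolding prob_null_def by blast
    show "\<forall>\<^sub>F n in sequentially. expectation (\<lambda>\<omega>. min 1 (cmod (X n \<omega> + Y n \<omega>)))
        \<le> expectation (\<lambda>\<omega>. min 1 (cmod (X n \<omega>))) + expectation (\<lambda>\<omega>. min 1 (cmod (Y n \<omega>)))"
    proof (intro always_eventually allI)
      fix n
      have "min 1 (cmod (X n \<omega> + Y n \<omega>)) \<le> min 1 (cmod (X n \<omega>)) + min 1 (cmod (Y n \<omega>))" for \<omega>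
        by (intro min_one_add norm_triangle_ineq norm_ge_zero)
      then have "expectation (\<lambda>\<omega>. min 1 (cmod (X n \<omega> + Y n \<omega>)))
          \<le> expectation (\<lambda>\<omega>. min 1 (cmod (X n \<omega>)) + min 1 (cmod (Y n \<omega>)))"
        by (intro integral_mono) (auto intro!: integrable_min1)
      then show "expectation (\<lambda>\<omega>. min 1 (cmod (X n \<omega> + Y n \<omega>)))
          \<le> expectation (\<lambda>\<omega>. min 1 (cmod (X n \<omega>))) + expectation (\<lambda>\<omega>. min 1 (cmod (Y n \<omega>)))"
        by (simp add: integrable_min1)
    qed
  qed (auto intro!: always_eventually expectation_min1_nonneg)
qed

lemma prob_null_zero: "prob_null (\<lambda>n \<omega>. 0)"
  by (simp add: prob_null_def)

lemma prob_null_sum: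
  assumes "finite S" "\<And>i. i \<in> S \<Longrightarrow> prob_null (X i)"
  shows "prob_null (\<lambda>n \<omega>. \<Sum>i\<in>S. X i n \<omega>)"
  using assms by (induction S rule: finite_induct) (auto intro: prob_null_add prob_null_zero)

lemma prob_null_AE:
  assumes X[measurable]: "\<And>n. X n \<in> borel_measurable M" and lim: "AE \<omega> in M. (\<lambda>n. X n \<omega>) \<longlonglongrightarrow> 0"
  shows "prob_null X"
  unfolding prob_null_def
proof (intro conjI allI X)
  have "(\<lambda>n. expectation (\<lambda>\<omega>. min 1 (cmod (X n \<omega>)))) \<longlonglongrightarrow> expectation (\<lambda>\<omega>. 0)"
  proof (rule integral_dominated_convergence[where w = "\<lambda>_. 1"])
    show "AE \<omega> in M. (\<lambda>n. min 1 (cmod (X n \<omega>))) \<longlonglongrightarrow> 0"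
      using lim
    proof eventually_elim
      case (elim \<omega>)
      from tendsto_min[OF tendsto_const tendsto_norm[OF elim], of 1] show ?case by simp
    qed
  qed auto
  then show "(\<lambda>n. expectation (\<lambda>\<omega>. min 1 (cmod (X n \<omega>)))) \<longlonglongrightarrow> 0" by simp
qed

text \<open>Localization and truncation in one principle: off an event of small probability,
  \<open>X\<close> is eventually equal to some \<open>Z\<close> of small size. Both \<open>Z\<close>
  and \<open>S\<close> may depend on \<open>e\<close>, and the index from which they agree may
  depend on the path.\<close>

lemma prob_null_approx:
  assumes X[measurable]: "\<And>n. X n \<in> borel_measurable M"
    and ap: "\<And>e. e > 0 \<Longrightarrow> \<exists>Z S. (\<forall>n. Z n \<in> borel_measurable M) \<and> S \<in> sets M \<and> prob (space M - S) \<le> e \<and>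
      (AE \<omega> in M. \<omega> \<in> S \<longrightarrow> (\<forall>\<^sub>F n in sequentially. X n \<omega> = Z n \<omega>)) \<and>
      (\<forall>\<^sub>F n in sequentially. expectation (\<lambda>\<omega>. min 1 (cmod (Z n \<omega>))) \<le> e)"
  shows "prob_null X"
proof (rule prob_nullI[OF X])
  fix e :: real assume "e > 0"
  then have "e / 3 > 0" by simp
  from ap[OF this] obtain Z S where Z[measurable]: "\<And>n. Z n \<in> borel_measurable M"
    and S[measurable]: "S \<in> sets M" and pS: "prob (space M - S) \<le> e / 3"
    and ev: "AE \<omega> in M. \<omega> \<in> S \<longrightarrow> (\<forall>\<^sub>F n in sequentially. X n \<omega> = Z n \<omega>)"
    and EZ: "\<forall>\<^sub>F n in sequentially. expectation (\<lambda>\<omega>. min 1 (cmod (Z n \<omega>))) \<le> e / 3"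
    by blast
  \<comment> \<open>On \<open>S\<close> the difference is eventually 0, so \<open>Y\<close> tends to
    0 almost everywhere. \<open>Y\<close>, \<open>Z\<close> and the complement of \<open>S\<close>
    each account for a third of \<open>e\<close>.\<close>
  define Y where "Y n \<omega> = indicator S \<omega> * (X n \<omega> - Z n \<omega>)" for n \<omega>
  have [measurable]: "Y n \<in> borel_measurable M" for n unfolding Y_def by measurable
  have "prob_null Y"
  proof (rule prob_null_AE)
    show "AE \<omega> in M. (\<lambda>n. Y n \<omega>) \<longlonglongrightarrow> 0"
      using ev
    proof eventually_elim
      case (elim \<omega>)
      show ?case
      proof (cases "\<omega> \<in> S")
        case True
        with elim have "\<forall>\<^sub>F n in sequentially. X n \<omega> = Z n \<omega>" by simp
        then have "\<forall>\<^sub>F n in sequentially. Y n \<omega> = 0" by eventually_elim (simp add: Y_def)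
        then show ?thesis by (rule tendsto_eventually)
      qed (simp add: Y_def)
    qed
  qed measurable
  then have "\<forall>\<^sub>F n in sequentially. expectation (\<lambda>\<omega>. min 1 (cmod (Y n \<omega>))) < e / 3"
    using \<open>e / 3 > 0\<close> order_tendstoD(2) unfolding prob_null_def by blast
  with EZ show "\<forall>\<^sub>F n in sequentially. expectation (\<lambda>\<omega>. min 1 (cmod (X n \<omega>))) \<le> e"
  proof eventually_elim
    case (elim n)
    have "min 1 (cmod (X n \<omega>)) \<le> min 1 (cmod (Y n \<omega>)) + min 1 (cmod (Z n \<omega>)) + indicator (space M - S) \<omega>"
      if "\<omega> \<in> space M" for \<omega>
    proof -
      have "cmod (X n \<omega>) \<le> cmod (X n \<omega> - Z n \<omega>) + cmod (Z n \<omega>)"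
        using norm_triangle_ineq[of "X n \<omega> - Z n \<omega>" "Z n \<omega>"] by simp
      from min_one_add[OF this] show ?thesis
        using that by (cases "\<omega> \<in> S") (simp_all add: Y_def add_increasing)
    qed
    then have "expectation (\<lambda>\<omega>. min 1 (cmod (X n \<omega>)))
        \<le> expectation (\<lambda>\<omega>. min 1 (cmod (Y n \<omega>)) + min 1 (cmod (Z n \<omega>)) + indicator (space M - S) \<omega>)"
      by (intro integral_mono Bochner_Integration.integrable_add integrable_min1 integrable_indicator_event) auto
    also have "\<dots> = expectation (\<lambda>\<omega>. min 1 (cmod (Y n \<omega>))) + expectation (\<lambda>\<omega>. min 1 (cmod (Z n \<omega>)))
        + prob (space M - S)"
      by (subst Bochner_Integration.integral_add | auto intro!: integrable_min1 integrable_indicator_event)+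
    finally show ?case using elim pS by simp
  qed
qed

lemma prob_le_expectation_min1:
  assumes X[measurable]: "X \<in> borel_measurable M" and "\<eta> > 0"
  shows "\<P>(\<omega> in M. cmod (X \<omega>) > \<eta>) \<le> expectation (\<lambda>\<omega>. min 1 (cmod (X \<omega>))) / min 1 \<eta>"
proof -
  have "min 1 \<eta> * \<P>(\<omega> in M. cmod (X \<omega>) > \<eta>) = expectation (\<lambda>\<omega>. min 1 \<eta> * indicator {\<omega>\<in>space M. cmod (X \<omega>) > \<eta>} \<omega>)"
    by simp
  also have "\<dots> \<le> expectation (\<lambda>\<omega>. min 1 (cmod (X \<omega>)))"
    by (intro integral_mono integrable_min1 integrable_mult_right integrable_indicator_event) (auto simp: min_def split: split_indicator)
  finally show ?thesis using \<open>\<eta> > 0\<close> by (simp add: field_simps)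
qed

lemma prob_null_of_prob:
  assumes X[measurable]: "\<And>n. X n \<in> borel_measurable M"
    and p: "\<And>\<eta> e. \<eta> > 0 \<Longrightarrow> e > 0 \<Longrightarrow> \<forall>\<^sub>F n in sequentially. \<P>(\<omega> in M. cmod (X n \<omega>) > \<eta>) < e"
  shows "prob_null X"
proof (rule prob_nullI[OF X])
  fix e :: real assume "e > 0"
  then have "e / 2 > 0" by simp
  from p[OF this this] show "\<forall>\<^sub>F n in sequentially. expectation (\<lambda>\<omega>. min 1 (cmod (X n \<omega>))) \<le> e"
  proof eventually_elim
    case (elim n)
    have "expectation (\<lambda>\<omega>. min 1 (cmod (X n \<omega>)))
        \<le> expectation (\<lambda>\<omega>. e / 2 + indicator {\<omega>\<in>space M. cmod (X n \<omega>) > e / 2} \<omega>)"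
      using \<open>e > 0\<close> by (intro integral_mono integrable_min1 X Bochner_Integration.integrable_add integrable_indicator_event) (auto simp: min_def split: split_indicator)
    also have "\<dots> = e / 2 + \<P>(\<omega> in M. cmod (X n \<omega>) > e / 2)"
      by (subst Bochner_Integration.integral_add) (auto simp: prob_space intro!: integrable_indicator_event)
    finally show ?case using elim by simp
  qed
qed

text \<open>Convergence in L^1 of the truncated moduli gives an almost surely convergent
  subsequence, along which the truncation at 1 is eventually inactive.\<close>

lemma prob_null_subseq:
  assumes "prob_null X"
  obtains r where "strict_mono r" "AE \<omega> in M. (\<lambda>n. X (r n) \<omega>) \<longlonglongrightarrow> 0"
proof -
  have "\<exists>r::nat\<Rightarrow>nat. strict_mono r \<and> (AE \<omega> in M. (\<lambda>n. min 1 (cmod (X (r n) \<omega>))) \<longlonglongrightarrow> 0)"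
  proof (rule tendsto_L1_AE_subseq)
    show "integrable M (\<lambda>\<omega>. min 1 (cmod (X n \<omega>)))" for n
      by (intro integrable_min1 prob_null_measurable assms)
    show "(\<lambda>n. expectation (\<lambda>\<omega>. norm (min 1 (cmod (X n \<omega>))))) \<longlonglongrightarrow> 0"
      using assms by (simp add: prob_null_def)
  qed
  then obtain r where r: "strict_mono r" "AE \<omega> in M. (\<lambda>n. min 1 (cmod (X (r n) \<omega>))) \<longlonglongrightarrow> 0" by blast
  from r(2) have "AE \<omega> in M. (\<lambda>n. X (r n) \<omega>) \<longlonglongrightarrow> 0"
  proof eventually_elim
    case (elim \<omega>)
    have "(\<lambda>n. cmod (X (r n) \<omega>)) \<longlonglongrightarrow> 0"
    proof (rule Lim_transform_eventually[OF elim])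
      have "\<forall>\<^sub>F n in sequentially. min 1 (cmod (X (r n) \<omega>)) < 1"
        using order_tendstoD(2)[OF elim, of 1] by simp
      then show "\<forall>\<^sub>F n in sequentially. min 1 (cmod (X (r n) \<omega>)) = cmod (X (r n) \<omega>)"
        by eventually_elim (auto simp: min_def split: if_splits)
    qed
    then show ?case by (rule tendsto_norm_zero_cancel)
  qed
  with r(1) that show ?thesis by blast
qed

text \<open>Later \<open>m\<close> numbers the coarse grids and the second index their refinements;
  \<open>\<kappa> m\<close> is a refinement fine enough for the grid \<open>m\<close>.\<close>

lemma prob_null_diagonal:
  assumes "\<And>m. prob_null (X m)"
  obtains \<kappa> where "\<And>m. \<kappa> m > 0" "prob_null (\<lambda>m. X m (\<kappa> m))"
proof -
  have "\<exists>k>0. expectation (\<lambda>\<omega>. min 1 (cmod (X m k \<omega>))) < inverse (real (Suc m))" for m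
  proof -
    have "\<forall>\<^sub>F k in sequentially. expectation (\<lambda>\<omega>. min 1 (cmod (X m k \<omega>))) < inverse (real (Suc m))"
      using assms[of m] unfolding prob_null_def by (auto elim!: order_tendstoD(2))
    then obtain k0 where "\<And>k. k \<ge> k0 \<Longrightarrow> expectation (\<lambda>\<omega>. min 1 (cmod (X m k \<omega>))) < inverse (real (Suc m))"
      unfolding eventually_sequentially by blast
    then show ?thesis by (intro exI[of _ "Suc k0"]) auto
  qed
  then obtain \<kappa> where \<kappa>: "\<And>m. \<kappa> m > 0"
      "\<And>m. expectation (\<lambda>\<omega>. min 1 (cmod (X m (\<kappa> m) \<omega>))) < inverse (real (Suc m))"
    by metis
  have "prob_null (\<lambda>m. X m (\<kappa> m))"
    unfolding prob_null_def
  proof (intro conjI allI)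
    show "X n (\<kappa> n) \<in> borel_measurable M" for n by (rule prob_null_measurable[OF assms])
    show "(\<lambda>m. expectation (\<lambda>\<omega>. min 1 (cmod (X m (\<kappa> m) \<omega>)))) \<longlonglongrightarrow> 0"
      by (rule tendsto_sandwich[OF _ _ tendsto_const LIMSEQ_inverse_real_of_nat])
        (auto intro!: always_eventually expectation_min1_nonneg less_imp_le \<kappa>(2) simp del: of_nat_Suc)
  qed
  with \<kappa>(1) that show ?thesis by blast
qed

end

section \<open>Discrete martingale transforms\<close>

lemma (in finite_measure) integrable_product_of_squares:
  fixes f g :: "'a \<Rightarrow> real"
  assumes [measurable]: "f \<in> borel_measurable M" "g \<in> borel_measurable M"
    and "integrable M (\<lambda>\<omega>. (f \<omega>)\<^sup>2)" "integrable M (\<lambda>\<omega>. (g \<omega>)\<^sup>2)"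
  shows "integrable M (\<lambda>\<omega>. f \<omega> * g \<omega>)"
proof (rule Bochner_Integration.integrable_bound[OF Bochner_Integration.integrable_add[OF assms(3,4)]])
  show "AE \<omega> in M. norm (f \<omega> * g \<omega>) \<le> norm ((f \<omega>)\<^sup>2 + (g \<omega>)\<^sup>2)"
  proof (rule AE_I2)
    fix \<omega>
    have "2 * (\<bar>f \<omega>\<bar> * \<bar>g \<omega>\<bar>) \<le> \<bar>f \<omega>\<bar>\<^sup>2 + \<bar>g \<omega>\<bar>\<^sup>2"
      using sum_squares_bound[of "\<bar>f \<omega>\<bar>" "\<bar>g \<omega>\<bar>"] by simp
    then have "\<bar>f \<omega>\<bar> * \<bar>g \<omega>\<bar> \<le> (f \<omega>)\<^sup>2 + (g \<omega>)\<^sup>2"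
      using mult_nonneg_nonneg[OF abs_ge_zero[of "f \<omega>"] abs_ge_zero[of "g \<omega>"]] by (simp only: power2_abs)
    then show "norm (f \<omega> * g \<omega>) \<le> norm ((f \<omega>)\<^sup>2 + (g \<omega>)\<^sup>2)" by (simp add: abs_mult)
  qed
qed measurable

lemma integrable_bounded_mult:
  fixes f :: "'a \<Rightarrow> real"
  assumes f: "integrable M f" and [measurable]: "g \<in> borel_measurable M"
    and g: "\<And>\<omega>. \<omega> \<in> space M \<Longrightarrow> \<bar>g \<omega>\<bar> \<le> C"
  shows "integrable M (\<lambda>\<omega>. g \<omega> * f \<omega>)"
proof (rule Bochner_Integration.integrable_bound[OF integrable_mult_right[OF f, of "\<bar>C\<bar>"]])
  note [measurable] = borel_measurable_integrable[OF f]
  show "(\<lambda>\<omega>. g \<omega> * f \<omega>) \<in> borel_measurable M" by measurable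
  show "AE \<omega> in M. norm (g \<omega> * f \<omega>) \<le> norm (\<bar>C\<bar> * f \<omega>)"
    by (rule AE_I2) (use g in \<open>force simp: abs_mult intro!: mult_right_mono\<close>)
qed

locale discrete_filtration = prob_space M for M :: "'a measure" +
  fixes G :: "nat \<Rightarrow> 'a measure"
  assumes subalg: "\<And>i. subalgebra M (G i)"
    and subalg_mono: "\<And>i j. i \<le> j \<Longrightarrow> subalgebra (G j) (G i)"
begin

lemma measurable_G: "f \<in> borel_measurable (G i) \<Longrightarrow> f \<in> borel_measurable M"
  by (rule measurable_from_subalg[OF subalg])

lemma measurable_G_mono: "f \<in> borel_measurable (G i) \<Longrightarrow> i \<le> j \<Longrightarrow> f \<in> borel_measurable (G j)"
  by (rule measurable_from_subalg[OF subalg_mono])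

sublocale sigma_finite: sigma_finite_subalgebra M "G i" for i
proof -
  interpret finite_measure_subalgebra M "G i" by unfold_locales (rule subalg)
  show "sigma_finite_subalgebra M (G i)" ..
qed

text \<open>Square integrable martingale differences: \<open>d i\<close> is the increment from
  \<open>i\<close> to \<open>Suc i\<close>, known at \<open>Suc i\<close> and centered given
  \<open>G i\<close>.\<close>

definition square_mdiff :: "nat \<Rightarrow> (nat \<Rightarrow> 'a \<Rightarrow> real) \<Rightarrow> bool" where
  "square_mdiff N d \<longleftrightarrow> (\<forall>i<N. d i \<in> borel_measurable (G (Suc i)) \<and> integrable M (\<lambda>\<omega>. (d i \<omega>)\<^sup>2) \<and>
     (AE \<omega> in M. real_cond_exp M (G i) (d i) \<omega> = 0))"

lemma expectation_mult_cond_exp_0: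
  assumes Z: "Z \<in> borel_measurable (G i)" and d: "d \<in> borel_measurable M"
    and i: "integrable M (\<lambda>\<omega>. Z \<omega> * d \<omega>)" and 0: "AE \<omega> in M. real_cond_exp M (G i) d \<omega> = 0"
  shows "expectation (\<lambda>\<omega>. Z \<omega> * d \<omega>) = 0"
proof -
  have "expectation (\<lambda>\<omega>. Z \<omega> * d \<omega>) = expectation (\<lambda>\<omega>. Z \<omega> * real_cond_exp M (G i) d \<omega>)"
    using sigma_finite.real_cond_exp_intg(2)[OF i Z d] by simp
  also have "\<dots> = expectation (\<lambda>_. 0)"
    using measurable_G[OF Z] by (intro integral_cong_AE) (use 0 in auto)
  finally show ?thesis by simp
qed

text \<open>Orthogonality of martingale differences, the discrete Ito isometry: the partial sum
  times \<open>\<gamma> n\<close> is known at \<open>n\<close>, so its product with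
  \<open>d n\<close> has mean 0.\<close>

lemma transform_square:
  fixes \<gamma> :: "nat \<Rightarrow> 'a \<Rightarrow> real"
  assumes d: "square_mdiff N d" and n: "n \<le> N"
    and \<gamma>: "\<And>i. i < N \<Longrightarrow> \<gamma> i \<in> borel_measurable (G i)"
    and C: "\<And>i \<omega>. i < N \<Longrightarrow> \<omega> \<in> space M \<Longrightarrow> \<bar>\<gamma> i \<omega>\<bar> \<le> C"
  shows "(\<lambda>\<omega>. \<Sum>i<n. \<gamma> i \<omega> * d i \<omega>) \<in> borel_measurable (G n) \<and>
    integrable M (\<lambda>\<omega>. (\<Sum>i<n. \<gamma> i \<omega> * d i \<omega>)\<^sup>2) \<and>
    expectation (\<lambda>\<omega>. (\<Sum>i<n. \<gamma> i \<omega> * d i \<omega>)\<^sup>2) = (\<Sum>i<n. expectation (\<lambda>\<omega>. (\<gamma> i \<omega>)\<^sup>2 * (d i \<omega>)\<^sup>2))"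
  using n
proof (induction n)
  case (Suc n)
  then have nN: "n < N" by simp
  let ?S = "\<lambda>\<omega>. \<Sum>i<n. \<gamma> i \<omega> * d i \<omega>"
  have S: "?S \<in> borel_measurable (G n)" and S2: "integrable M (\<lambda>\<omega>. (?S \<omega>)\<^sup>2)"
    and ES: "expectation (\<lambda>\<omega>. (?S \<omega>)\<^sup>2) = (\<Sum>i<n. expectation (\<lambda>\<omega>. (\<gamma> i \<omega>)\<^sup>2 * (d i \<omega>)\<^sup>2))"
    using Suc by auto
  have dn: "d n \<in> borel_measurable (G (Suc n))" "integrable M (\<lambda>\<omega>. (d n \<omega>)\<^sup>2)"
    "AE \<omega> in M. real_cond_exp M (G n) (d n) \<omega> = 0"
    using d nN by (auto simp: square_mdiff_def)
  note [measurable] = measurable_G[OF S] measurable_G[OF dn(1)] measurable_G[OF \<gamma>[OF nN]]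
  have m: "(\<lambda>\<omega>. ?S \<omega> + \<gamma> n \<omega> * d n \<omega>) \<in> borel_measurable (G (Suc n))"
    by (intro borel_measurable_add borel_measurable_times dn(1) measurable_G_mono[OF S] measurable_G_mono[OF \<gamma>[OF nN]]) auto
  have gd2: "integrable M (\<lambda>\<omega>. (\<gamma> n \<omega>)\<^sup>2 * (d n \<omega>)\<^sup>2)"
    by (rule integrable_bounded_mult[OF dn(2), where C = "C\<^sup>2"])
      (use C[OF nN] power_mono[OF C[OF nN], of _ 2] in auto)
  then have gd2': "integrable M (\<lambda>\<omega>. (\<gamma> n \<omega> * d n \<omega>)\<^sup>2)" by (simp add: power_mult_distrib)
  have cr: "integrable M (\<lambda>\<omega>. ?S \<omega> * (\<gamma> n \<omega> * d n \<omega>))"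
    by (rule integrable_product_of_squares[OF _ _ S2 gd2']) measurable
  then have cr': "integrable M (\<lambda>\<omega>. (?S \<omega> * \<gamma> n \<omega>) * d n \<omega>)" by (simp add: mult.assoc)
  have "expectation (\<lambda>\<omega>. (?S \<omega> * \<gamma> n \<omega>) * d n \<omega>) = 0"
    by (rule expectation_mult_cond_exp_0[OF _ _ cr' dn(3)]) (use S \<gamma>[OF nN] in auto)
  then have cr0: "expectation (\<lambda>\<omega>. ?S \<omega> * (\<gamma> n \<omega> * d n \<omega>)) = 0" by (simp add: mult.assoc)
  have eq: "(?S \<omega> + \<gamma> n \<omega> * d n \<omega>)\<^sup>2 = (?S \<omega>)\<^sup>2 + 2 * (?S \<omega> * (\<gamma> n \<omega> * d n \<omega>)) + (\<gamma> n \<omega>)\<^sup>2 * (d n \<omega>)\<^sup>2" for \<omega>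
    by (simp add: power2_sum power_mult_distrib)
  have "integrable M (\<lambda>\<omega>. (?S \<omega> + \<gamma> n \<omega> * d n \<omega>)\<^sup>2)"
    unfolding eq using S2 cr gd2 by auto
  moreover have "expectation (\<lambda>\<omega>. (?S \<omega> + \<gamma> n \<omega> * d n \<omega>)\<^sup>2)
      = (\<Sum>i<Suc n. expectation (\<lambda>\<omega>. (\<gamma> i \<omega>)\<^sup>2 * (d i \<omega>)\<^sup>2))"
    unfolding eq using S2 cr gd2 by (simp add: cr0 ES)
  ultimately show ?case using m by simp
qed simp

lemma transform_square_complex:
  fixes \<gamma> :: "nat \<Rightarrow> 'a \<Rightarrow> complex"
  assumes d: "square_mdiff N d"
    and \<gamma>: "\<And>i. i < N \<Longrightarrow> \<gamma> i \<in> borel_measurable (G i)"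
    and \<eta>: "\<And>i \<omega>. i < N \<Longrightarrow> \<omega> \<in> space M \<Longrightarrow> cmod (\<gamma> i \<omega>) \<le> \<eta>"
  shows "integrable M (\<lambda>\<omega>. (cmod (\<Sum>i<N. \<gamma> i \<omega> * of_real (d i \<omega>)))\<^sup>2)"
    and "expectation (\<lambda>\<omega>. (cmod (\<Sum>i<N. \<gamma> i \<omega> * of_real (d i \<omega>)))\<^sup>2)
      = (\<Sum>i<N. expectation (\<lambda>\<omega>. (cmod (\<gamma> i \<omega>))\<^sup>2 * (d i \<omega>)\<^sup>2))"
proof -
  have ReIm: "\<bar>Re (\<gamma> i \<omega>)\<bar> \<le> \<eta>" "\<bar>Im (\<gamma> i \<omega>)\<bar> \<le> \<eta>" if "i < N" "\<omega> \<in> space M" for i \<omega>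
    using \<eta>[OF that] abs_Re_le_cmod[of "\<gamma> i \<omega>"] abs_Im_le_cmod[of "\<gamma> i \<omega>"] by linarith+
  have R: "(\<lambda>\<omega>. Re (\<gamma> i \<omega>)) \<in> borel_measurable (G i)" "(\<lambda>\<omega>. Im (\<gamma> i \<omega>)) \<in> borel_measurable (G i)" if "i < N" for i
    using \<gamma>[OF that] by auto
  note re = transform_square[OF d order_refl, of "\<lambda>i \<omega>. Re (\<gamma> i \<omega>)", OF R(1) ReIm(1)]
  note im = transform_square[OF d order_refl, of "\<lambda>i \<omega>. Im (\<gamma> i \<omega>)", OF R(2) ReIm(2)]
  have eq: "(cmod (\<Sum>i<N. \<gamma> i \<omega> * of_real (d i \<omega>)))\<^sup>2 =
      (\<Sum>i<N. Re (\<gamma> i \<omega>) * d i \<omega>)\<^sup>2 + (\<Sum>i<N. Im (\<gamma> i \<omega>) * d i \<omega>)\<^sup>2" for \<omega>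
    by (simp add: cmod_power2)
  show "integrable M (\<lambda>\<omega>. (cmod (\<Sum>i<N. \<gamma> i \<omega> * of_real (d i \<omega>)))\<^sup>2)"
    unfolding eq using re im by auto
  have i: "integrable M (\<lambda>\<omega>. (Re (\<gamma> i \<omega>))\<^sup>2 * (d i \<omega>)\<^sup>2)" "integrable M (\<lambda>\<omega>. (Im (\<gamma> i \<omega>))\<^sup>2 * (d i \<omega>)\<^sup>2)" if "i < N" for i
  proof -
    have d2: "integrable M (\<lambda>\<omega>. (d i \<omega>)\<^sup>2)" using d that by (auto simp: square_mdiff_def)
    note [measurable] = measurable_G[OF R(1)[OF that]] measurable_G[OF R(2)[OF that]]
    show "integrable M (\<lambda>\<omega>. (Re (\<gamma> i \<omega>))\<^sup>2 * (d i \<omega>)\<^sup>2)" "integrable M (\<lambda>\<omega>. (Im (\<gamma> i \<omega>))\<^sup>2 * (d i \<omega>)\<^sup>2)"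
      by (rule integrable_bounded_mult[OF d2, where C = "\<eta>\<^sup>2"];
          use power_mono[OF ReIm(1)[OF that], of _ 2] power_mono[OF ReIm(2)[OF that], of _ 2] in simp)+
  qed
  have "expectation (\<lambda>\<omega>. (cmod (\<gamma> i \<omega>))\<^sup>2 * (d i \<omega>)\<^sup>2) =
      expectation (\<lambda>\<omega>. (Re (\<gamma> i \<omega>))\<^sup>2 * (d i \<omega>)\<^sup>2) + expectation (\<lambda>\<omega>. (Im (\<gamma> i \<omega>))\<^sup>2 * (d i \<omega>)\<^sup>2)" if "i < N" for i
    unfolding cmod_power2 distrib_right using i[OF that] by simp
  then show "expectation (\<lambda>\<omega>. (cmod (\<Sum>i<N. \<gamma> i \<omega> * of_real (d i \<omega>)))\<^sup>2)
      = (\<Sum>i<N. expectation (\<lambda>\<omega>. (cmod (\<gamma> i \<omega>))\<^sup>2 * (d i \<omega>)\<^sup>2))"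
    unfolding eq using re im by (simp add: sum.distrib)
qed

lemma square_mdiff_measurable: "square_mdiff N d \<Longrightarrow> i < N \<Longrightarrow> d i \<in> borel_measurable M"
  by (auto simp: square_mdiff_def intro: measurable_G)

text \<open>
  The weights of a trapezoidal sum are not predictable. Writing the weight of a block as its value at
  the left end plus half of its increment, the first part is a martingale transform, and the second
  is controlled by the arithmetic-geometric mean inequality.
\<close>

lemma weighted_blocks:
  fixes c g :: "nat \<Rightarrow> 'a \<Rightarrow> complex"
  assumes d: "square_mdiff (m * k) d" and B: "(\<Sum>i<m*k. expectation (\<lambda>\<omega>. (d i \<omega>)\<^sup>2)) \<le> B"
    and "k > 0" and "\<eta> > 0"
    and c: "\<And>i. i < m * k \<Longrightarrow> c i \<in> borel_measurable (G i)"
    and c\<eta>: "\<And>i \<omega>. i < m * k \<Longrightarrow> \<omega> \<in> space M \<Longrightarrow> cmod (c i \<omega>) \<le> \<eta>"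
    and g: "\<And>j. j \<le> m \<Longrightarrow> g j \<in> borel_measurable (G (j * k))"
    and g1: "\<And>j \<omega>. j \<le> m \<Longrightarrow> \<omega> \<in> space M \<Longrightarrow> cmod (g j \<omega>) \<le> 1"
    and S: "(\<Sum>j<m. expectation (\<lambda>\<omega>. (cmod (g (Suc j) \<omega> - g j \<omega>))\<^sup>2)) \<le> S"
  shows "expectation (\<lambda>\<omega>. min 1 (cmod (\<Sum>j<m. (g j \<omega> + g (Suc j) \<omega>) / 2 *
      (\<Sum>i=j*k..<j*k+k. c i \<omega> * of_real (d i \<omega>))))) \<le> \<eta> * (1 + B + S)"
proof -
  let ?A = "\<lambda>j \<omega>. \<Sum>i=j*k..<j*k+k. c i \<omega> * of_real (d i \<omega>)"
  let ?D = "\<lambda>i. expectation (\<lambda>\<omega>. (d i \<omega>)\<^sup>2)"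
  note [measurable] = square_mdiff_measurable[OF d] measurable_G[OF c] measurable_G[OF g]
  have d2: "integrable M (\<lambda>\<omega>. (d i \<omega>)\<^sup>2)" if "i < m * k" for i using d that by (auto simp: square_mdiff_def)
  have jk: "i < m * k" if "i \<in> {j*k..<j*k+k}" "j < m" for i j
  proof -
    have "j * k + k \<le> m * k" using that(2) mult_le_mono1[of "Suc j" m k] by simp
    with that(1) show ?thesis by simp
  qed
  have S0: "0 \<le> S" by (rule order_trans[OF _ S]) (auto intro!: sum_nonneg integral_nonneg_AE)
  have le_\<eta>: "(\<Sum>i<m*k. expectation (\<lambda>\<omega>. (cmod (\<gamma> i \<omega>))\<^sup>2 * (d i \<omega>)\<^sup>2)) \<le> \<eta>\<^sup>2 * B"
    if \<gamma>: "\<And>i. i < m * k \<Longrightarrow> \<gamma> i \<in> borel_measurable (G i)"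
      "\<And>i \<omega>. i < m * k \<Longrightarrow> \<omega> \<in> space M \<Longrightarrow> cmod (\<gamma> i \<omega>) \<le> \<eta>" for \<gamma> :: "nat \<Rightarrow> 'a \<Rightarrow> complex"
  proof -
    have "(\<Sum>i<m*k. expectation (\<lambda>\<omega>. (cmod (\<gamma> i \<omega>))\<^sup>2 * (d i \<omega>)\<^sup>2)) \<le> (\<Sum>i<m*k. \<eta>\<^sup>2 * ?D i)"
    proof (rule sum_mono)
      fix i assume "i \<in> {..<m*k}"
      then have i: "i < m * k" by simp
      have le: "(cmod (\<gamma> i \<omega>))\<^sup>2 \<le> \<eta>\<^sup>2" if "\<omega> \<in> space M" for \<omega>
        using \<gamma>(2)[OF i that] by (intro power_mono) auto
      note [measurable] = measurable_G[OF \<gamma>(1)[OF i]]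
      have "expectation (\<lambda>\<omega>. (cmod (\<gamma> i \<omega>))\<^sup>2 * (d i \<omega>)\<^sup>2) \<le> expectation (\<lambda>\<omega>. \<eta>\<^sup>2 * (d i \<omega>)\<^sup>2)"
        by (intro integral_mono integrable_bounded_mult[OF d2[OF i], where C = "\<eta>\<^sup>2"])
          (auto intro!: mult_right_mono d2 i simp: le)
      then show "expectation (\<lambda>\<omega>. (cmod (\<gamma> i \<omega>))\<^sup>2 * (d i \<omega>)\<^sup>2) \<le> \<eta>\<^sup>2 * ?D i" by simp
    qed
    also have "\<dots> \<le> \<eta>\<^sup>2 * B"
      unfolding sum_distrib_left[symmetric] using B by (intro mult_left_mono) auto
    finally show ?thesis .
  qed
  \<comment> \<open>The weight \<open>g j\<close> at the left end of a block is known before every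
    increment inside the block, so \<open>\<gamma>\<close> is predictable.\<close>
  define \<gamma> where "\<gamma> i \<omega> = g (i div k) \<omega> * c i \<omega>" for i \<omega>
  have divk: "i div k * k \<le> i" "i div k \<le> m" if "i < m * k" for i
    using that div_le_mono[of i "m * k" k] \<open>k > 0\<close> by auto
  have \<gamma>: "\<gamma> i \<in> borel_measurable (G i)" if "i < m * k" for i
    unfolding \<gamma>_def using measurable_G_mono[OF g[OF divk(2)[OF that]] divk(1)[OF that]] c[OF that] by auto
  have \<gamma>\<eta>: "cmod (\<gamma> i \<omega>) \<le> \<eta>" if "i < m * k" "\<omega> \<in> space M" for i \<omega>
  proof -
    have "cmod (g (i div k) \<omega>) * cmod (c i \<omega>) \<le> 1 * \<eta>"
      using that divk(2) by (intro mult_mono c\<eta> g1) auto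
    then show ?thesis by (simp add: \<gamma>_def norm_mult)
  qed
  define T where "T \<omega> = (\<Sum>i<m*k. \<gamma> i \<omega> * of_real (d i \<omega>))" for \<omega>
  note T2 = transform_square_complex[OF d \<gamma> \<gamma>\<eta>, folded T_def]
  have ET: "expectation (\<lambda>\<omega>. (cmod (T \<omega>))\<^sup>2) \<le> \<eta>\<^sup>2 * B"
    using T2(2) le_\<eta>[OF \<gamma> \<gamma>\<eta>] by simp
  have T_eq: "T \<omega> = (\<Sum>j<m. g j \<omega> * ?A j \<omega>)" for \<omega>
  proof -
    have "T \<omega> = (\<Sum>j<m. \<Sum>i=j*k..<j*k+k. \<gamma> i \<omega> * of_real (d i \<omega>))"
      unfolding T_def by (rule sum.nat_group[symmetric])
    also have "\<dots> = (\<Sum>j<m. \<Sum>i=j*k..<j*k+k. g j \<omega> * (c i \<omega> * of_real (d i \<omega>)))"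
    proof (intro sum.cong refl)
      fix i j assume "j \<in> {..<m}" "i \<in> {j*k..<j*k+k}"
      then have "i div k = j" using \<open>k > 0\<close> by (auto intro!: div_nat_eqI simp: mult.commute)
      then show "\<gamma> i \<omega> * of_real (d i \<omega>) = g j \<omega> * (c i \<omega> * of_real (d i \<omega>))" by (simp add: \<gamma>_def)
    qed
    finally show ?thesis by (simp add: sum_distrib_left)
  qed
  \<comment> \<open>Extending the weights of block \<open>j\<close> by 0 makes its sum a transform
    over the whole range, whose second moment is again given by orthogonality.\<close>
  define c' where "c' j i \<omega> = (if i div k = j then c i \<omega> else 0)" for j i \<omega>
  have c': "c' j i \<in> borel_measurable (G i)" if "i < m * k" for i j
    unfolding c'_def using c[OF that] by (cases "i div k = j") auto
  have c'\<eta>: "cmod (c' j i \<omega>) \<le> \<eta>" if "i < m * k" "\<omega> \<in> space M" for i j \<omega>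
    using c\<eta>[OF that] \<open>\<eta> > 0\<close> by (auto simp: c'_def)
  have A_eq: "?A j \<omega> = (\<Sum>i<m*k. c' j i \<omega> * of_real (d i \<omega>))" if "j < m" for j \<omega>
  proof -
    have iff: "i < m * k \<and> i div k = j \<longleftrightarrow> i \<in> {j*k..<j*k+k}" for i
    proof
      assume "i < m * k \<and> i div k = j"
      then show "i \<in> {j*k..<j*k+k}"
        using div_mult_mod_eq[of i k] mod_less_divisor[OF \<open>k > 0\<close>, of i] by auto
    next
      assume i: "i \<in> {j*k..<j*k+k}"
      then have "i div k = j" by (intro div_nat_eqI) (auto simp: mult.commute)
      with jk[OF i that] show "i < m * k \<and> i div k = j" by simp
    qed
    have "(\<Sum>i<m*k. c' j i \<omega> * of_real (d i \<omega>)) = (\<Sum>i<m*k. if i div k = j then c i \<omega> * of_real (d i \<omega>) else 0)"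
      by (intro sum.cong refl) (simp add: c'_def)
    also have "\<dots> = (\<Sum>i\<in>{i\<in>{..<m*k}. i div k = j}. c i \<omega> * of_real (d i \<omega>))"
      by (rule sum.inter_filter[symmetric]) simp
    also have "{i\<in>{..<m*k}. i div k = j} = {j*k..<j*k+k}"
      by (rule set_eqI) (simp only: iff mem_Collect_eq lessThan_iff)
    finally show ?thesis by simp
  qed
  have A2: "integrable M (\<lambda>\<omega>. (cmod (?A j \<omega>))\<^sup>2)"
      "expectation (\<lambda>\<omega>. (cmod (?A j \<omega>))\<^sup>2) = (\<Sum>i<m*k. expectation (\<lambda>\<omega>. (cmod (c' j i \<omega>))\<^sup>2 * (d i \<omega>)\<^sup>2))"
    if "j < m" for j
    unfolding A_eq[OF that] by (rule transform_square_complex[OF d c' c'\<eta>]; assumption)+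
  \<comment> \<open>Each index lies in exactly one block, so the second moments of the block sums
    add up to that of a single transform.\<close>
  have EA: "(\<Sum>j<m. expectation (\<lambda>\<omega>. (cmod (?A j \<omega>))\<^sup>2)) \<le> \<eta>\<^sup>2 * B"
  proof -
    have "(\<Sum>j<m. expectation (\<lambda>\<omega>. (cmod (?A j \<omega>))\<^sup>2))
        = (\<Sum>j<m. \<Sum>i<m*k. expectation (\<lambda>\<omega>. (cmod (c' j i \<omega>))\<^sup>2 * (d i \<omega>)\<^sup>2))"
      by (intro sum.cong refl A2(2)) auto
    also have "\<dots> = (\<Sum>i<m*k. \<Sum>j<m. if i div k = j then expectation (\<lambda>\<omega>. (cmod (c i \<omega>))\<^sup>2 * (d i \<omega>)\<^sup>2) else 0)"
      by (subst sum.swap) (auto simp: c'_def intro!: sum.cong)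
    also have "\<dots> \<le> (\<Sum>i<m*k. expectation (\<lambda>\<omega>. (cmod (c i \<omega>))\<^sup>2 * (d i \<omega>)\<^sup>2))"
      by (intro sum_mono) (auto simp: sum.delta' intro!: integral_nonneg_AE)
    also have "\<dots> \<le> \<eta>\<^sup>2 * B" by (rule le_\<eta>[OF c c\<eta>])
    finally show ?thesis .
  qed
  have g2: "integrable M (\<lambda>\<omega>. (cmod (g (Suc j) \<omega> - g j \<omega>))\<^sup>2)" if "j < m" for j
  proof (rule integrable_const_bound[where B=4])
    show "AE \<omega> in M. norm ((cmod (g (Suc j) \<omega> - g j \<omega>))\<^sup>2) \<le> 4"
    proof (rule AE_I2)
      fix \<omega> assume "\<omega> \<in> space M"
      then have "cmod (g (Suc j) \<omega> - g j \<omega>) \<le> 2"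
        using g1[of "Suc j" \<omega>] g1[of j \<omega>] that norm_triangle_ineq4[of "g (Suc j) \<omega>" "g j \<omega>"] by auto
      from power_mono[OF this, of 2] show "norm ((cmod (g (Suc j) \<omega> - g j \<omega>))\<^sup>2) \<le> 4" by simp
    qed
    have [measurable]: "g j \<in> borel_measurable M" "g (Suc j) \<in> borel_measurable M"
      using that by (auto intro!: measurable_G[OF g])
    show "(\<lambda>\<omega>. (cmod (g (Suc j) \<omega> - g j \<omega>))\<^sup>2) \<in> borel_measurable M" by measurable
  qed
  \<comment> \<open>Products are split by
    \<open>x * y \<le> (\<eta> * x\<^sup>2 + y\<^sup>2 / \<eta>) / 2\<close>. The second moments of
    \<open>T\<close> and of the block sums together are of order \<open>\<eta>\<^sup>2\<close>, so
    division by \<open>\<eta>\<close> leaves order \<open>\<eta>\<close>; the squared increments of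
    \<open>g\<close> are multiplied by \<open>\<eta>\<close> and only have to stay bounded in
    sum.\<close>
  define U where "U \<omega> = (\<eta> + (cmod (T \<omega>))\<^sup>2 / \<eta>) / 2 +
      (\<Sum>j<m. (\<eta> * (cmod (g (Suc j) \<omega> - g j \<omega>))\<^sup>2 + (cmod (?A j \<omega>))\<^sup>2 / \<eta>) / 4)" for \<omega>
  have amgm: "x * y \<le> (\<eta> * x\<^sup>2 + y\<^sup>2 / \<eta>) / 2" for x y :: real
  proof -
    have "0 \<le> (\<eta> * x - y)\<^sup>2 / \<eta>" using \<open>\<eta> > 0\<close> by simp
    also have "(\<eta> * x - y)\<^sup>2 / \<eta> = \<eta> * x\<^sup>2 - 2 * (x * y) + y\<^sup>2 / \<eta>"
      using \<open>\<eta> > 0\<close> by (simp add: power2_eq_square field_simps)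
    finally show ?thesis by simp
  qed
  have iU: "integrable M U" unfolding U_def
    using T2(1) A2(1) g2 by (auto intro!: Bochner_Integration.integrable_add Bochner_Integration.integrable_sum)
  have "expectation (\<lambda>\<omega>. min 1 (cmod (\<Sum>j<m. (g j \<omega> + g (Suc j) \<omega>) / 2 * ?A j \<omega>))) \<le> expectation U"
  proof (rule integral_mono[OF integrable_min1 iU])
    have [measurable]: "(\<lambda>\<omega>. (g j \<omega> + g (Suc j) \<omega>) / 2 * ?A j \<omega>) \<in> borel_measurable M" if "j \<in> {..<m}" for j
      using that jk by (intro borel_measurable_times borel_measurable_divide borel_measurable_add borel_measurable_sum
          measurable_G[OF g] measurable_G[OF c] borel_measurable_of_real square_mdiff_measurable[OF d]) auto
    show "(\<lambda>\<omega>. \<Sum>j<m. (g j \<omega> + g (Suc j) \<omega>) / 2 * ?A j \<omega>) \<in> borel_measurable M" by measurable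
    fix \<omega> assume "\<omega> \<in> space M"
    have "(\<Sum>j<m. (g j \<omega> + g (Suc j) \<omega>) / 2 * ?A j \<omega>) = T \<omega> + (\<Sum>j<m. (g (Suc j) \<omega> - g j \<omega>) / 2 * ?A j \<omega>)"
      unfolding T_eq sum.distrib[symmetric] by (intro sum.cong refl) (simp add: field_simps)
    then have "cmod (\<Sum>j<m. (g j \<omega> + g (Suc j) \<omega>) / 2 * ?A j \<omega>)
        \<le> cmod (T \<omega>) + (\<Sum>j<m. cmod ((g (Suc j) \<omega> - g j \<omega>) / 2 * ?A j \<omega>))"
      by (simp only:) (rule norm_triangle_le[OF add_left_mono[OF norm_sum]])
    also have "\<dots> \<le> U \<omega>"
      unfolding U_def
    proof (intro add_mono sum_mono)
      show "cmod (T \<omega>) \<le> (\<eta> + (cmod (T \<omega>))\<^sup>2 / \<eta>) / 2" using amgm[of 1 "cmod (T \<omega>)"] by simp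
      fix j
      show "cmod ((g (Suc j) \<omega> - g j \<omega>) / 2 * ?A j \<omega>)
          \<le> (\<eta> * (cmod (g (Suc j) \<omega> - g j \<omega>))\<^sup>2 + (cmod (?A j \<omega>))\<^sup>2 / \<eta>) / 4"
        using amgm[of "cmod (g (Suc j) \<omega> - g j \<omega>)" "cmod (?A j \<omega>)"] by (simp add: norm_mult norm_divide)
    qed
    finally show "min 1 (cmod (\<Sum>j<m. (g j \<omega> + g (Suc j) \<omega>) / 2 * ?A j \<omega>)) \<le> U \<omega>" by simp
  qed
  also have "expectation U = (\<eta> + expectation (\<lambda>\<omega>. (cmod (T \<omega>))\<^sup>2) / \<eta>) / 2 +
      (\<Sum>j<m. (\<eta> * expectation (\<lambda>\<omega>. (cmod (g (Suc j) \<omega> - g j \<omega>))\<^sup>2) + expectation (\<lambda>\<omega>. (cmod (?A j \<omega>))\<^sup>2) / \<eta>) / 4)"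
    unfolding U_def using T2(1) A2(1) g2
    by (subst Bochner_Integration.integral_add) (auto simp: Bochner_Integration.integral_sum prob_space
        intro!: Bochner_Integration.integrable_add Bochner_Integration.integrable_sum)
  also have "\<dots> = (\<eta> + expectation (\<lambda>\<omega>. (cmod (T \<omega>))\<^sup>2) / \<eta>) / 2 +
      (\<eta> * (\<Sum>j<m. expectation (\<lambda>\<omega>. (cmod (g (Suc j) \<omega> - g j \<omega>))\<^sup>2)) + (\<Sum>j<m. expectation (\<lambda>\<omega>. (cmod (?A j \<omega>))\<^sup>2)) / \<eta>) / 4"
    by (simp add: sum.distrib sum_distrib_left sum_divide_distrib[symmetric])
  also have "\<dots> \<le> (\<eta> + \<eta>\<^sup>2 * B / \<eta>) / 2 + (\<eta> * S + \<eta>\<^sup>2 * B / \<eta>) / 4"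
    using ET EA S \<open>\<eta> > 0\<close> by (intro add_mono divide_right_mono mult_left_mono order_refl) auto
  also have "\<dots> = \<eta> * (1 / 2 + B * 3 / 4 + S / 4)"
    using \<open>\<eta> > 0\<close> by (simp add: power2_eq_square field_simps)
  also have "\<dots> \<le> \<eta> * (1 + B + S)"
  proof (intro mult_left_mono)
    have "0 \<le> B" by (rule order_trans[OF _ B]) (auto intro!: sum_nonneg integral_nonneg_AE)
    then show "1 / 2 + B * 3 / 4 + S / 4 \<le> 1 + B + S" using S0 by simp
  qed (use \<open>\<eta> > 0\<close> in simp)
  finally show ?thesis .
qed

text \<open>The martingale property is given for consecutive indices; a bounded variable known at
  \<open>i\<close> remains a test variable at every later index, so the steps can be
  chained.\<close>

lemma martingale_test:
  assumes x: "\<And>i. i \<le> N \<Longrightarrow> integrable M (x i)"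
    and mart: "\<And>i. i < N \<Longrightarrow> AE \<omega> in M. real_cond_exp M (G i) (x (Suc i)) \<omega> = x i \<omega>"
    and Z: "Z \<in> borel_measurable (G i)" and Z1: "\<And>\<omega>. \<omega> \<in> space M \<Longrightarrow> \<bar>Z \<omega>\<bar> \<le> 1"
    and "i \<le> n" "n \<le> N"
  shows "expectation (\<lambda>\<omega>. Z \<omega> * x n \<omega>) = expectation (\<lambda>\<omega>. Z \<omega> * x i \<omega>)"
  using assms(5,6)
proof (induction n rule: dec_induct)
  case (step n)
  have ZM: "Z \<in> borel_measurable M" by (rule measurable_G[OF Z])
  have i: "integrable M (\<lambda>\<omega>. Z \<omega> * x (Suc n) \<omega>)"
    by (rule integrable_bounded_mult[OF x ZM Z1]) (use step in auto)
  have "expectation (\<lambda>\<omega>. Z \<omega> * x (Suc n) \<omega>) = expectation (\<lambda>\<omega>. Z \<omega> * real_cond_exp M (G n) (x (Suc n)) \<omega>)"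
    using sigma_finite.real_cond_exp_intg(2)[OF i measurable_G_mono[OF Z]] step x[of "Suc n"] by auto
  also have "\<dots> = expectation (\<lambda>\<omega>. Z \<omega> * x n \<omega>)"
    using mart[of n] x[of n] step ZM by (intro integral_cong_AE) auto
  finally show ?case using step by simp
qed simp

text \<open>
  Stopping when \<open>x\<close> leaves \<open>[-\<lambda>, \<lambda>]\<close> and truncating the last increment makes the increments square
  integrable. The drift that this creates is bounded in \<open>L\<^sup>1\<close> by the overshoot.
\<close>

lemma truncated_martingale:
  fixes x :: "nat \<Rightarrow> 'a \<Rightarrow> real"
  assumes xG: "\<And>i. i \<le> N \<Longrightarrow> x i \<in> borel_measurable (G i)"
    and x: "\<And>i. i \<le> N \<Longrightarrow> integrable M (x i)"
    and mart: "\<And>i. i < N \<Longrightarrow> AE \<omega> in M. real_cond_exp M (G i) (x (Suc i)) \<omega> = x i \<omega>"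
    and x0: "\<And>\<omega>. \<omega> \<in> space M \<Longrightarrow> x 0 \<omega> = 0" and lam: "lam > 0"
  obtains d a where "square_mdiff N d"
    and "(\<Sum>i<N. expectation (\<lambda>\<omega>. (d i \<omega>)\<^sup>2)) \<le> lam\<^sup>2 + 2 * lam * expectation (\<lambda>\<omega>. \<bar>x N \<omega>\<bar>)"
    and "\<And>i. i < N \<Longrightarrow> integrable M (a i)"
    and "(\<Sum>i<N. expectation (\<lambda>\<omega>. \<bar>a i \<omega>\<bar>)) \<le> expectation (\<lambda>\<omega>. \<bar>x N \<omega>\<bar>)"
    and "\<And>i \<omega>. i < N \<Longrightarrow> \<omega> \<in> space M \<Longrightarrow> \<forall>k\<le>N. \<bar>x k \<omega>\<bar> \<le> lam \<Longrightarrow>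
      x (Suc i) \<omega> - x i \<omega> = d i \<omega> + a i \<omega>"
proof -
  define clamp where "clamp y = max (- lam) (min lam y)" for y :: real
  have clamp_le: "\<bar>clamp y\<bar> \<le> lam" and clamp_id: "\<bar>y\<bar> \<le> lam \<Longrightarrow> clamp y = y"
    and clamp_diff: "\<bar>clamp y - y\<bar> \<le> \<bar>y\<bar>" for y
    using lam by (auto simp: clamp_def min_def max_def)
  have [measurable]: "clamp \<in> borel_measurable borel" unfolding clamp_def by measurable
  \<comment> \<open>\<open>I i\<close> is 1 as long as \<open>x\<close> has not left [-lam, lam] up
    to index \<open>i\<close>.\<close>
  define I where "I i \<omega> = (if \<forall>k\<in>{..i}. \<bar>x k \<omega>\<bar> \<le> lam then 1 else 0 :: real)" for i \<omega>
  have I01: "0 \<le> I i \<omega>" "I i \<omega> \<le> 1" "\<bar>I i \<omega>\<bar> \<le> 1" for i \<omega> by (auto simp: I_def)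
  have IG: "I i \<in> borel_measurable (G i)" if "i \<le> N" for i
  proof -
    have [measurable]: "x k \<in> borel_measurable (G i)" if "k \<in> {..i}" for k
      by (rule measurable_G_mono[OF xG]) (use that \<open>i \<le> N\<close> in auto)
    show ?thesis unfolding I_def by measurable
  qed
  \<comment> \<open>\<open>e i\<close> is the increment of the process stopped at its first exit,
    with the exit value clamped. \<open>o' i\<close> is the overshoot removed by clamping, and
    \<open>F i\<close> indicates that the first exit occurs at \<open>Suc i\<close>.\<close>
  define e where "e i \<omega> = I i \<omega> * (clamp (x (Suc i) \<omega>) - x i \<omega>)" for i \<omega>
  define o' where "o' i \<omega> = I i \<omega> * (clamp (x (Suc i) \<omega>) - x (Suc i) \<omega>)" for i \<omega>
  define F where "F i \<omega> = I i \<omega> - I (Suc i) \<omega>" for i \<omega>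
  have F01: "0 \<le> F i \<omega>" "F i \<omega> \<le> 1" for i \<omega> by (auto simp: F_def I_def)
  have eG: "e i \<in> borel_measurable (G (Suc i))" if "i < N" for i
  proof -
    have [measurable]: "x (Suc i) \<in> borel_measurable (G (Suc i))" by (rule xG) (use that in simp)
    have [measurable]: "x i \<in> borel_measurable (G (Suc i))" by (rule measurable_G_mono[OF xG]) (use that in auto)
    have [measurable]: "I i \<in> borel_measurable (G (Suc i))" by (rule measurable_G_mono[OF IG]) (use that in auto)
    show ?thesis unfolding e_def by measurable
  qed
  have eM: "e i \<in> borel_measurable M" if "i < N" for i using measurable_G[OF eG[OF that]] .
  have e_bd: "\<bar>e i \<omega>\<bar> \<le> 2 * lam" if "\<omega> \<in> space M" for i \<omega>
  proof (cases "I i \<omega> = 0")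
    case False
    then have "I i \<omega> = 1" "\<bar>x i \<omega>\<bar> \<le> lam" by (auto simp: I_def split: if_splits)
    moreover from this(1) have "e i \<omega> = clamp (x (Suc i) \<omega>) - x i \<omega>" by (simp add: e_def)
    ultimately show ?thesis using clamp_le[of "x (Suc i) \<omega>"] by linarith
  qed (use lam in \<open>simp add: e_def\<close>)
  have ei: "integrable M (e i)" "integrable M (\<lambda>\<omega>. (e i \<omega>)\<^sup>2)" if "i < N" for i
  proof -
    note [measurable] = eM[OF that]
    show "integrable M (e i)" by (rule integrable_const_bound[where B="2 * lam"]) (auto simp: e_bd)
    show "integrable M (\<lambda>\<omega>. (e i \<omega>)\<^sup>2)"
    proof (rule integrable_const_bound[where B="(2 * lam)\<^sup>2"])
      show "AE \<omega> in M. norm ((e i \<omega>)\<^sup>2) \<le> (2 * lam)\<^sup>2"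
      proof (rule AE_I2)
        fix \<omega> assume "\<omega> \<in> space M"
        from power_mono[OF e_bd[OF this], of i 2] show "norm ((e i \<omega>)\<^sup>2) \<le> (2 * lam)\<^sup>2" by simp
      qed
    qed measurable
  qed
  have oF: "\<bar>o' i \<omega>\<bar> \<le> F i \<omega> * \<bar>x (Suc i) \<omega>\<bar>" for i \<omega>
    using clamp_diff[of "x (Suc i) \<omega>"] clamp_id[of "x (Suc i) \<omega>"]
    by (auto simp: o'_def F_def I_def atMost_Suc)
  have oi: "integrable M (o' i)" if "i < N" for i
  proof -
    have "integrable M (\<lambda>\<omega>. I i \<omega> * (clamp (x (Suc i) \<omega>) - x (Suc i) \<omega>))"
    proof (rule integrable_bounded_mult[OF _ measurable_G[OF IG], where C = 1])
      have "integrable M (\<lambda>\<omega>. clamp (x (Suc i) \<omega>))"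
        using borel_measurable_integrable[OF x[of "Suc i"]] that
        by (intro integrable_const_bound[where B=lam]) (auto simp: clamp_le)
      then show "integrable M (\<lambda>\<omega>. clamp (x (Suc i) \<omega>) - x (Suc i) \<omega>)" using x[of "Suc i"] that by auto
    qed (use that I01 in auto)
    then show ?thesis unfolding o'_def .
  qed
  have FG: "F i \<in> borel_measurable (G (Suc i))" if "i < N" for i
    unfolding F_def using IG[of "Suc i"] measurable_G_mono[OF IG[of i], of "Suc i"] that by auto
  have Eo: "expectation (\<lambda>\<omega>. \<bar>o' i \<omega>\<bar>) \<le> expectation (\<lambda>\<omega>. F i \<omega> * \<bar>x N \<omega>\<bar>)" if "i < N" for i
  proof -
    \<comment> \<open>The sign of \<open>x\<close> at the exit is known at the exit. Testing the
      martingale with it replaces \<open>|x (Suc i)|\<close> on the exit event by the final value,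
      as for the submartingale |x|.\<close>
    define Z where "Z \<omega> = F i \<omega> * sgn (x (Suc i) \<omega>)" for \<omega>
    have Z: "Z \<in> borel_measurable (G (Suc i))"
      unfolding Z_def using FG[OF that] xG[of "Suc i"] that by auto
    have Z1: "\<bar>Z \<omega>\<bar> \<le> 1" for \<omega> using F01[of i \<omega>] by (auto simp: Z_def abs_mult sgn_if)
    have ZM: "Z \<in> borel_measurable M" by (rule measurable_G[OF Z])
    have FM: "F i \<in> borel_measurable M" by (rule measurable_G[OF FG[OF that]])
    have Zx: "Z \<omega> * x (Suc i) \<omega> = F i \<omega> * \<bar>x (Suc i) \<omega>\<bar>" for \<omega> by (simp add: Z_def abs_sgn mult.commute mult.left_commute)
    have "expectation (\<lambda>\<omega>. \<bar>o' i \<omega>\<bar>) \<le> expectation (\<lambda>\<omega>. Z \<omega> * x (Suc i) \<omega>)"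
      using oF[of i] oi[OF that] that
      by (intro integral_mono integrable_bounded_mult[OF x ZM Z1]) (auto simp: Zx)
    also have "\<dots> = expectation (\<lambda>\<omega>. Z \<omega> * x N \<omega>)"
      by (rule martingale_test[where N = N, OF x mart Z Z1, symmetric]) (use that in auto)
    also have "\<dots> \<le> expectation (\<lambda>\<omega>. F i \<omega> * \<bar>x N \<omega>\<bar>)"
    proof (intro integral_mono integrable_bounded_mult[OF x ZM Z1])
      show "integrable M (\<lambda>\<omega>. F i \<omega> * \<bar>x N \<omega>\<bar>)"
        by (rule integrable_bounded_mult[OF _ FM, where C=1]) (use F01 x[of N] in auto)
      fix \<omega>
      have "Z \<omega> * x N \<omega> \<le> \<bar>Z \<omega>\<bar> * \<bar>x N \<omega>\<bar>" by (metis abs_ge_self abs_mult)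
      also have "\<dots> \<le> F i \<omega> * \<bar>x N \<omega>\<bar>"
        using F01[of i \<omega>] by (intro mult_right_mono) (auto simp: Z_def abs_mult sgn_if)
      finally show "Z \<omega> * x N \<omega> \<le> F i \<omega> * \<bar>x N \<omega>\<bar>" .
    qed simp
    finally show ?thesis .
  qed
  have sumF: "(\<Sum>i<N. expectation (\<lambda>\<omega>. F i \<omega> * \<bar>x N \<omega>\<bar>)) \<le> expectation (\<lambda>\<omega>. \<bar>x N \<omega>\<bar>)"
  proof -
    have Fi: "integrable M (\<lambda>\<omega>. F i \<omega> * \<bar>x N \<omega>\<bar>)" if "i < N" for i
      by (rule integrable_bounded_mult[OF _ measurable_G[OF FG[OF that]], where C=1]) (use F01 x[of N] in auto)
    have "(\<Sum>i<N. expectation (\<lambda>\<omega>. F i \<omega> * \<bar>x N \<omega>\<bar>)) = expectation (\<lambda>\<omega>. \<Sum>i<N. F i \<omega> * \<bar>x N \<omega>\<bar>)"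
      using Fi by (subst Bochner_Integration.integral_sum) auto
    also have "\<dots> \<le> expectation (\<lambda>\<omega>. \<bar>x N \<omega>\<bar>)"
    proof (rule integral_mono)
      fix \<omega>
      \<comment> \<open>The first exit occurs at most once, so the indicators telescope to at most 1
        and the overshoots together cost a single E |x N|.\<close>
      have "(\<Sum>i<N. F i \<omega>) = I 0 \<omega> - I N \<omega>" unfolding F_def by (rule sum_lessThan_telescope')
      then have "(\<Sum>i<N. F i \<omega>) \<le> 1" using I01(2)[of 0 \<omega>] I01(1)[of N \<omega>] by linarith
      then show "(\<Sum>i<N. F i \<omega> * \<bar>x N \<omega>\<bar>) \<le> \<bar>x N \<omega>\<bar>"
        unfolding sum_distrib_right[symmetric] by (intro mult_left_le_one_le) (auto intro!: sum_nonneg F01)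
    qed (use Fi x[of N] in auto)
    finally show ?thesis .
  qed
  \<comment> \<open>\<open>e i\<close> and \<open>o' i\<close> differ by the stopped martingale
    increment \<open>I i * (x (Suc i) - x i)\<close>, whose product with any \<open>Z\<close> known
    at \<open>i\<close> has mean 0.\<close>
  have Ze: "expectation (\<lambda>\<omega>. Z \<omega> * e i \<omega>) = expectation (\<lambda>\<omega>. Z \<omega> * o' i \<omega>)"
    if "i < N" and Z: "Z \<in> borel_measurable (G i)" and Z1: "\<And>\<omega>. \<omega> \<in> space M \<Longrightarrow> \<bar>Z \<omega>\<bar> \<le> 1" for Z i
  proof -
    have ZI: "(\<lambda>\<omega>. Z \<omega> * I i \<omega>) \<in> borel_measurable (G i)" using Z IG[of i] that(1) by auto
    have ZI1: "\<bar>Z \<omega> * I i \<omega>\<bar> \<le> 1" if "\<omega> \<in> space M" for \<omega> using Z1[OF that] by (auto simp: I_def)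
    have int: "integrable M (\<lambda>\<omega>. (Z \<omega> * I i \<omega>) * x n \<omega>)" if "n \<le> N" for n
      by (rule integrable_bounded_mult[OF x[OF that] measurable_G[OF ZI] ZI1])
    have Zo: "integrable M (\<lambda>\<omega>. Z \<omega> * o' i \<omega>)"
      by (rule integrable_bounded_mult[OF oi[OF that(1)] measurable_G[OF Z] Z1])
    have "Z \<omega> * e i \<omega> = Z \<omega> * o' i \<omega> + ((Z \<omega> * I i \<omega>) * x (Suc i) \<omega> - (Z \<omega> * I i \<omega>) * x i \<omega>)" for \<omega>
      by (simp add: e_def o'_def algebra_simps)
    then have "expectation (\<lambda>\<omega>. Z \<omega> * e i \<omega>) = expectation (\<lambda>\<omega>. Z \<omega> * o' i \<omega>) +
        (expectation (\<lambda>\<omega>. (Z \<omega> * I i \<omega>) * x (Suc i) \<omega>) - expectation (\<lambda>\<omega>. (Z \<omega> * I i \<omega>) * x i \<omega>))"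
      using int[of i] int[of "Suc i"] Zo that(1) by simp
    moreover have "expectation (\<lambda>\<omega>. (Z \<omega> * I i \<omega>) * x (Suc i) \<omega>) = expectation (\<lambda>\<omega>. (Z \<omega> * I i \<omega>) * x i \<omega>)"
      by (rule martingale_test[where N = N, OF x mart ZI ZI1]) (use that(1) in auto)
    ultimately show ?thesis by simp
  qed
  \<comment> \<open>The compensator of the clamped increments. It is not 0 because clamping destroys
    the martingale property, but it only sees the overshoot.\<close>
  define a where "a i = real_cond_exp M (G i) (e i)" for i
  have aG: "a i \<in> borel_measurable (G i)" for i unfolding a_def by measurable
  have ai: "integrable M (a i)" if "i < N" for i
    unfolding a_def using sigma_finite.real_cond_exp_int(1)[OF ei(1)[OF that]] .
  have aE: "expectation (\<lambda>\<omega>. Z \<omega> * a i \<omega>) = expectation (\<lambda>\<omega>. Z \<omega> * e i \<omega>)"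
    if "i < N" "integrable M (\<lambda>\<omega>. Z \<omega> * e i \<omega>)" "Z \<in> borel_measurable (G i)" for Z i
    unfolding a_def using sigma_finite.real_cond_exp_intg(2)[OF that(2,3) eM[OF that(1)]] .
  have a_bd: "AE \<omega> in M. \<bar>a i \<omega>\<bar> \<le> 2 * lam" if "i < N" for i
  proof -
    have "AE \<omega> in M. - (2 * lam) \<le> real_cond_exp M (G i) (e i) \<omega>"
      using e_bd[of _ i] by (intro sigma_finite.real_cond_exp_ge_c ei(1)[OF that] AE_I2) force
    moreover have "AE \<omega> in M. real_cond_exp M (G i) (e i) \<omega> \<le> 2 * lam"
      using e_bd[of _ i] by (intro sigma_finite.real_cond_exp_le_c ei(1)[OF that] AE_I2) force
    ultimately show ?thesis unfolding a_def by eventually_elim auto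
  qed
  have a2: "integrable M (\<lambda>\<omega>. (a i \<omega>)\<^sup>2)" if "i < N" for i
  proof (rule integrable_const_bound[where B="(2 * lam)\<^sup>2"])
    show "AE \<omega> in M. norm ((a i \<omega>)\<^sup>2) \<le> (2 * lam)\<^sup>2"
      using a_bd[OF that]
    proof eventually_elim
      case (elim \<omega>)
      from power_mono[OF elim, of 2] show ?case by simp
    qed
    show "(\<lambda>\<omega>. (a i \<omega>)\<^sup>2) \<in> borel_measurable M" using measurable_G[OF aG] by auto
  qed
  define d where "d i \<omega> = e i \<omega> - a i \<omega>" for i \<omega>
  have ae: "integrable M (\<lambda>\<omega>. a i \<omega> * e i \<omega>)" if "i < N" for i
    by (rule integrable_product_of_squares[OF measurable_G[OF aG] eM[OF that] a2[OF that] ei(2)[OF that]])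
  have d2eq: "(d i \<omega>)\<^sup>2 = (e i \<omega>)\<^sup>2 - 2 * (a i \<omega> * e i \<omega>) + (a i \<omega>)\<^sup>2" for i \<omega>
    by (simp add: d_def power2_diff mult.commute mult.left_commute)
  have d2: "integrable M (\<lambda>\<omega>. (d i \<omega>)\<^sup>2)" if "i < N" for i
    unfolding d2eq using ae[OF that] a2[OF that] ei(2)[OF that] by auto
  have Ed2: "expectation (\<lambda>\<omega>. (d i \<omega>)\<^sup>2) \<le> expectation (\<lambda>\<omega>. (e i \<omega>)\<^sup>2)" if "i < N" for i
  proof -
    have "expectation (\<lambda>\<omega>. a i \<omega> * e i \<omega>) = expectation (\<lambda>\<omega>. (a i \<omega>)\<^sup>2)"
      using aE[OF that ae[OF that] aG] by (simp add: power2_eq_square)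
    then have "expectation (\<lambda>\<omega>. (d i \<omega>)\<^sup>2) = expectation (\<lambda>\<omega>. (e i \<omega>)\<^sup>2) - expectation (\<lambda>\<omega>. (a i \<omega>)\<^sup>2)"
      unfolding d2eq using ae[OF that] a2[OF that] ei(2)[OF that] by simp
    moreover have "0 \<le> expectation (\<lambda>\<omega>. (a i \<omega>)\<^sup>2)" by (rule integral_nonneg_AE) auto
    ultimately show ?thesis by simp
  qed
  have dm: "square_mdiff N d"
    unfolding square_mdiff_def
  proof (intro allI impI conjI d2)
    fix i assume i: "i < N"
    show "d i \<in> borel_measurable (G (Suc i))"
      unfolding d_def using eG[OF i] measurable_G_mono[OF aG, of i "Suc i"] by auto
    have "AE \<omega> in M. real_cond_exp M (G i) (\<lambda>\<omega>. e i \<omega> - a i \<omega>) \<omega>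
        = real_cond_exp M (G i) (e i) \<omega> - real_cond_exp M (G i) (a i) \<omega>"
      by (rule sigma_finite.real_cond_exp_diff[OF ei(1)[OF i] ai[OF i]])
    moreover have "AE \<omega> in M. real_cond_exp M (G i) (a i) \<omega> = a i \<omega>"
      by (rule sigma_finite.real_cond_exp_F_meas[OF ai[OF i] aG])
    ultimately show "AE \<omega> in M. real_cond_exp M (G i) (d i) \<omega> = 0"
      unfolding d_def by eventually_elim (simp add: a_def)
  qed
  have Ea: "expectation (\<lambda>\<omega>. \<bar>a i \<omega>\<bar>) \<le> expectation (\<lambda>\<omega>. \<bar>o' i \<omega>\<bar>)" if "i < N" for i
  proof -
    \<comment> \<open>\<open>sgn (a i)\<close> is known at \<open>i\<close>, so as a test variable
      it exchanges \<open>e i\<close> for \<open>o' i\<close> and yields the L^1 bound.\<close>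
    have Z: "(\<lambda>\<omega>. sgn (a i \<omega>)) \<in> borel_measurable (G i)" using aG[of i] by auto
    have Z1: "\<bar>sgn (a i \<omega>)\<bar> \<le> 1" for \<omega> by (simp add: sgn_if)
    have "expectation (\<lambda>\<omega>. \<bar>a i \<omega>\<bar>) = expectation (\<lambda>\<omega>. sgn (a i \<omega>) * a i \<omega>)"
      by (simp add: abs_sgn mult.commute)
    also have "\<dots> = expectation (\<lambda>\<omega>. sgn (a i \<omega>) * o' i \<omega>)"
      using aE[OF that integrable_bounded_mult[OF ei(1)[OF that] measurable_G[OF Z] Z1] Z] Ze[OF that Z Z1] by simp
    also have "\<dots> \<le> expectation (\<lambda>\<omega>. \<bar>o' i \<omega>\<bar>)"
      by (intro integral_mono integrable_bounded_mult[OF oi[OF that] measurable_G[OF Z] Z1] integrable_abs oi[OF that])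
        (simp add: sgn_if abs_if)
    finally show ?thesis .
  qed
  \<comment> \<open>The partial sums of \<open>e\<close> are \<open>x\<close> itself before the exit
    and a clamped value from the exit on, so they never exceed \<open>lam\<close> in
    modulus.\<close>
  define Y where "Y n \<omega> = (\<Sum>i<n. e i \<omega>)" for n \<omega>
  have Y: "\<bar>Y n \<omega>\<bar> \<le> lam \<and> (I n \<omega> \<noteq> 0 \<longrightarrow> Y n \<omega> = x n \<omega>)" if "\<omega> \<in> space M" for n \<omega>
  proof (induction n)
    case 0
    then show ?case using x0[OF that] lam by (simp add: Y_def)
  next
    case (Suc n)
    have S: "Y (Suc n) \<omega> = Y n \<omega> + e n \<omega>" by (simp add: Y_def)
    show ?case
    proof (cases "I n \<omega> = 0")
      case True
      then have "I (Suc n) \<omega> = 0" by (auto simp: I_def split: if_splits)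
      then show ?thesis using True Suc by (simp add: S e_def)
    next
      case False
      then have "I n \<omega> = 1" by (auto simp: I_def split: if_splits)
      then have "Y (Suc n) \<omega> = clamp (x (Suc n) \<omega>)" using Suc False by (simp add: S e_def)
      moreover have "I (Suc n) \<omega> \<noteq> 0 \<Longrightarrow> \<bar>x (Suc n) \<omega>\<bar> \<le> lam" by (auto simp: I_def split: if_splits)
      ultimately show ?thesis using clamp_le clamp_id by auto
    qed
  qed
  have YG: "Y n \<in> borel_measurable (G n)" if "n \<le> N" for n
    unfolding Y_def using that
    by (intro borel_measurable_sum measurable_G_mono[OF eG]) auto
  \<comment> \<open>Expand the square of \<open>Y n + e n\<close>. The test variable
    \<open>Y n / lam\<close> shows that the cross term has the same mean as
    \<open>Y n * o' n\<close>, which is at least -lam E |o' n|.\<close>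
  have EY: "n \<le> N \<Longrightarrow> (\<Sum>i<n. expectation (\<lambda>\<omega>. (e i \<omega>)\<^sup>2)) \<le> expectation (\<lambda>\<omega>. (Y n \<omega>)\<^sup>2)
      + 2 * lam * (\<Sum>i<n. expectation (\<lambda>\<omega>. \<bar>o' i \<omega>\<bar>))" for n
  proof (induction n)
    case (Suc n)
    then have n: "n < N" by simp
    note YnM = measurable_G[OF YG[of n]]
    define Z where "Z \<omega> = Y n \<omega> / lam" for \<omega>
    have Z: "Z \<in> borel_measurable (G n)" unfolding Z_def using YG[of n] n by auto
    have Z1: "\<bar>Z \<omega>\<bar> \<le> 1" if "\<omega> \<in> space M" for \<omega> using Y[OF that, of n] lam by (simp add: Z_def)
    have Yb: "\<bar>Y n \<omega>\<bar> \<le> lam" if "\<omega> \<in> space M" for \<omega> using Y[OF that, of n] by simp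
    have Y2: "integrable M (\<lambda>\<omega>. (Y n \<omega>)\<^sup>2)"
    proof (rule integrable_const_bound[where B="lam\<^sup>2"])
      show "AE \<omega> in M. norm ((Y n \<omega>)\<^sup>2) \<le> lam\<^sup>2"
        using Yb power_mono[of "\<bar>Y n _\<bar>" lam 2] by (intro AE_I2) simp
    qed (use YnM n in auto)
    have Ye: "integrable M (\<lambda>\<omega>. Y n \<omega> * e n \<omega>)"
      by (rule integrable_bounded_mult[OF ei(1)[OF n] YnM Yb]) (use n in auto)
    have "- expectation (\<lambda>\<omega>. \<bar>o' n \<omega>\<bar>) \<le> expectation (\<lambda>\<omega>. Z \<omega> * o' n \<omega>)"
    proof -
      have "expectation (\<lambda>\<omega>. - \<bar>o' n \<omega>\<bar>) \<le> expectation (\<lambda>\<omega>. Z \<omega> * o' n \<omega>)"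
      proof (intro integral_mono integrable_bounded_mult[OF oi[OF n] measurable_G[OF Z] Z1] integrable_minus integrable_abs oi[OF n])
        fix \<omega> assume "\<omega> \<in> space M"
        then have "\<bar>Z \<omega> * o' n \<omega>\<bar> \<le> \<bar>o' n \<omega>\<bar>" using Z1 by (simp add: abs_mult mult_left_le_one_le)
        then show "- \<bar>o' n \<omega>\<bar> \<le> Z \<omega> * o' n \<omega>" by linarith
      qed
      then show ?thesis by simp
    qed
    also have "expectation (\<lambda>\<omega>. Z \<omega> * o' n \<omega>) = expectation (\<lambda>\<omega>. Y n \<omega> * e n \<omega>) / lam"
      using Ze[OF n Z Z1, symmetric] by (simp add: Z_def)
    finally have 1: "- (lam * expectation (\<lambda>\<omega>. \<bar>o' n \<omega>\<bar>)) \<le> expectation (\<lambda>\<omega>. Y n \<omega> * e n \<omega>)"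
      using lam by (simp add: field_simps)
    have "(Y (Suc n) \<omega>)\<^sup>2 = (Y n \<omega>)\<^sup>2 + 2 * (Y n \<omega> * e n \<omega>) + (e n \<omega>)\<^sup>2" for \<omega>
      by (simp add: Y_def power2_sum)
    then have "expectation (\<lambda>\<omega>. (Y (Suc n) \<omega>)\<^sup>2) = expectation (\<lambda>\<omega>. (Y n \<omega>)\<^sup>2)
        + 2 * expectation (\<lambda>\<omega>. Y n \<omega> * e n \<omega>) + expectation (\<lambda>\<omega>. (e n \<omega>)\<^sup>2)"
      using Y2 Ye ei(2)[OF n] by simp
    then show ?case using 1 Suc n by (simp add: algebra_simps)
  qed (simp add: Y_def)
  have sumo: "(\<Sum>i<N. expectation (\<lambda>\<omega>. \<bar>o' i \<omega>\<bar>)) \<le> expectation (\<lambda>\<omega>. \<bar>x N \<omega>\<bar>)"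
    by (rule order_trans[OF sum_mono sumF]) (auto intro: Eo)
  have "expectation (\<lambda>\<omega>. (Y N \<omega>)\<^sup>2) \<le> expectation (\<lambda>\<omega>. lam\<^sup>2)"
  proof (rule integral_mono)
    have b: "(Y N \<omega>)\<^sup>2 \<le> lam\<^sup>2" if "\<omega> \<in> space M" for \<omega>
      using power_mono[of "\<bar>Y N \<omega>\<bar>" lam 2] Y[OF that, of N] by simp
    show "integrable M (\<lambda>\<omega>. (Y N \<omega>)\<^sup>2)"
      by (rule integrable_const_bound[where B="lam\<^sup>2"]) (use b measurable_G[OF YG[of N]] in auto)
  qed (use Y[of _ N] power_mono[of "\<bar>Y N _\<bar>" lam 2] in auto)
  then have EYN: "expectation (\<lambda>\<omega>. (Y N \<omega>)\<^sup>2) \<le> lam\<^sup>2" by (simp add: prob_space)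
  have "(\<Sum>i<N. expectation (\<lambda>\<omega>. (d i \<omega>)\<^sup>2)) \<le> (\<Sum>i<N. expectation (\<lambda>\<omega>. (e i \<omega>)\<^sup>2))"
    by (intro sum_mono Ed2) auto
  also have "\<dots> \<le> lam\<^sup>2 + 2 * lam * expectation (\<lambda>\<omega>. \<bar>x N \<omega>\<bar>)"
  proof -
    have "2 * lam * (\<Sum>i<N. expectation (\<lambda>\<omega>. \<bar>o' i \<omega>\<bar>)) \<le> 2 * lam * expectation (\<lambda>\<omega>. \<bar>x N \<omega>\<bar>)"
      by (intro mult_left_mono sumo) (use lam in simp)
    then show ?thesis using EY[of N] EYN by linarith
  qed
  finally have D: "(\<Sum>i<N. expectation (\<lambda>\<omega>. (d i \<omega>)\<^sup>2)) \<le> lam\<^sup>2 + 2 * lam * expectation (\<lambda>\<omega>. \<bar>x N \<omega>\<bar>)" .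
  have A: "(\<Sum>i<N. expectation (\<lambda>\<omega>. \<bar>a i \<omega>\<bar>)) \<le> expectation (\<lambda>\<omega>. \<bar>x N \<omega>\<bar>)"
    by (rule order_trans[OF sum_mono sumo]) (auto intro: Ea)
  have inc: "x (Suc i) \<omega> - x i \<omega> = d i \<omega> + a i \<omega>"
    if "i < N" "\<omega> \<in> space M" "\<forall>k\<le>N. \<bar>x k \<omega>\<bar> \<le> lam" for i \<omega>
    using that by (auto simp: d_def e_def I_def clamp_id)
  show ?thesis by (rule that[OF dm D ai A inc])
qed

text \<open>The martingale differences fall under \<open>weighted_blocks\<close>, and the
  compensators contribute at most \<open>\<eta>\<close> times the sum of their L^1 norms. Besides
  \<open>lam\<close> and \<open>S\<close>, only the final value enters the bound, so refining the
  grid between fixed ends does not spoil it. \<open>\<Delta>\<close> reproduces the increments of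
  \<open>x\<close> only on paths within [-lam, lam]; the others are left to a localization.\<close>

lemma martingale_blocks:
  fixes c g :: "nat \<Rightarrow> 'a \<Rightarrow> complex" and x :: "nat \<Rightarrow> 'a \<Rightarrow> real"
  assumes xG: "\<And>i. i \<le> m * k \<Longrightarrow> x i \<in> borel_measurable (G i)"
    and x: "\<And>i. i \<le> m * k \<Longrightarrow> integrable M (x i)"
    and mart: "\<And>i. i < m * k \<Longrightarrow> AE \<omega> in M. real_cond_exp M (G i) (x (Suc i)) \<omega> = x i \<omega>"
    and x0: "\<And>\<omega>. \<omega> \<in> space M \<Longrightarrow> x 0 \<omega> = 0" and lam: "lam > 0"
    and "k > 0" and "\<eta> > 0"
    and c: "\<And>i. i < m * k \<Longrightarrow> c i \<in> borel_measurable (G i)"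
    and c\<eta>: "\<And>i \<omega>. i < m * k \<Longrightarrow> \<omega> \<in> space M \<Longrightarrow> cmod (c i \<omega>) \<le> \<eta>"
    and g: "\<And>j. j \<le> m \<Longrightarrow> g j \<in> borel_measurable (G (j * k))"
    and g1: "\<And>j \<omega>. j \<le> m \<Longrightarrow> \<omega> \<in> space M \<Longrightarrow> cmod (g j \<omega>) \<le> 1"
    and S: "(\<Sum>j<m. expectation (\<lambda>\<omega>. (cmod (g (Suc j) \<omega> - g j \<omega>))\<^sup>2)) \<le> S"
  obtains \<Delta> where "\<And>i. i < m * k \<Longrightarrow> \<Delta> i \<in> borel_measurable M"
    and "\<And>i \<omega>. i < m * k \<Longrightarrow> \<omega> \<in> space M \<Longrightarrow> \<forall>l\<le>m * k. \<bar>x l \<omega>\<bar> \<le> lam \<Longrightarrow>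
      x (Suc i) \<omega> - x i \<omega> = \<Delta> i \<omega>"
    and "expectation (\<lambda>\<omega>. min 1 (cmod (\<Sum>j<m. (g j \<omega> + g (Suc j) \<omega>) / 2 *
      (\<Sum>i=j*k..<j*k+k. c i \<omega> * of_real (\<Delta> i \<omega>)))))
      \<le> \<eta> * (1 + lam\<^sup>2 + (2 * lam + 1) * expectation (\<lambda>\<omega>. \<bar>x (m * k) \<omega>\<bar>) + S)"
proof -
  obtain d a where d: "square_mdiff (m * k) d"
    and B: "(\<Sum>i<m*k. expectation (\<lambda>\<omega>. (d i \<omega>)\<^sup>2)) \<le> lam\<^sup>2 + 2 * lam * expectation (\<lambda>\<omega>. \<bar>x (m * k) \<omega>\<bar>)"
    and ai: "\<And>i. i < m * k \<Longrightarrow> integrable M (a i)"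
    and A: "(\<Sum>i<m*k. expectation (\<lambda>\<omega>. \<bar>a i \<omega>\<bar>)) \<le> expectation (\<lambda>\<omega>. \<bar>x (m * k) \<omega>\<bar>)"
    and da: "\<And>i \<omega>. i < m * k \<Longrightarrow> \<omega> \<in> space M \<Longrightarrow> \<forall>l\<le>m * k. \<bar>x l \<omega>\<bar> \<le> lam \<Longrightarrow>
      x (Suc i) \<omega> - x i \<omega> = d i \<omega> + a i \<omega>"
    by (rule truncated_martingale[where N = "m * k" and x = x and lam = lam, OF xG x mart x0 lam]; (assumption | (rule that; assumption)))
  let ?X = "expectation (\<lambda>\<omega>. \<bar>x (m * k) \<omega>\<bar>)"
  define P where "P \<omega> = (\<Sum>j<m. (g j \<omega> + g (Suc j) \<omega>) / 2 * (\<Sum>i=j*k..<j*k+k. c i \<omega> * of_real (d i \<omega>)))" for \<omega>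
  define Q where "Q \<omega> = (\<Sum>j<m. (g j \<omega> + g (Suc j) \<omega>) / 2 * (\<Sum>i=j*k..<j*k+k. c i \<omega> * of_real (a i \<omega>)))" for \<omega>
  have jk: "i < m * k" if "i \<in> {j*k..<j*k+k}" "j < m" for i j
  proof -
    have "j * k + k \<le> m * k" using that(2) mult_le_mono1[of "Suc j" m k] by simp
    with that(1) show ?thesis by simp
  qed
  have meas: "(\<lambda>\<omega>. \<Sum>j<m. (g j \<omega> + g (Suc j) \<omega>) / 2 * (\<Sum>i=j*k..<j*k+k. c i \<omega> * of_real (f i \<omega>))) \<in> borel_measurable M"
    if f: "\<And>i. i < m * k \<Longrightarrow> f i \<in> borel_measurable M" for f :: "nat \<Rightarrow> 'a \<Rightarrow> real"
  proof -
    have "(\<lambda>\<omega>. complex_of_real (f i \<omega>)) \<in> borel_measurable M" if "i < m * k" for i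
      using f[OF that] by measurable
    with jk show ?thesis by (intro borel_measurable_times borel_measurable_divide borel_measurable_add borel_measurable_sum
          measurable_G[OF g] measurable_G[OF c]) auto
  qed
  have aM: "a i \<in> borel_measurable M" if "i < m * k" for i using ai[OF that] by simp
  have PM: "P \<in> borel_measurable M" unfolding P_def by (rule meas[OF square_mdiff_measurable[OF d]])
  have QM: "Q \<in> borel_measurable M" unfolding Q_def by (rule meas[OF aM])
  have Qle: "cmod (Q \<omega>) \<le> (\<Sum>i<m*k. \<eta> * \<bar>a i \<omega>\<bar>)" if "\<omega> \<in> space M" for \<omega>
  proof -
    have "cmod (Q \<omega>) \<le> (\<Sum>j<m. \<Sum>i=j*k..<j*k+k. \<eta> * \<bar>a i \<omega>\<bar>)"
      unfolding Q_def
    proof (rule sum_norm_le)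
      fix j assume j: "j \<in> {..<m}"
      have "cmod ((g j \<omega> + g (Suc j) \<omega>) / 2) \<le> 1"
        using norm_triangle_ineq[of "g j \<omega>" "g (Suc j) \<omega>"] g1[of j \<omega>] g1[of "Suc j" \<omega>] j that by (simp add: norm_divide)
      moreover have "cmod (\<Sum>i=j*k..<j*k+k. c i \<omega> * of_real (a i \<omega>)) \<le> (\<Sum>i=j*k..<j*k+k. \<eta> * \<bar>a i \<omega>\<bar>)"
        using jk j that by (intro sum_norm_le) (auto simp: norm_mult intro!: mult_right_mono c\<eta>)
      ultimately have "cmod ((g j \<omega> + g (Suc j) \<omega>) / 2) * cmod (\<Sum>i=j*k..<j*k+k. c i \<omega> * of_real (a i \<omega>))
          \<le> 1 * (\<Sum>i=j*k..<j*k+k. \<eta> * \<bar>a i \<omega>\<bar>)"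
        by (intro mult_mono) auto
      then show "cmod ((g j \<omega> + g (Suc j) \<omega>) / 2 * (\<Sum>i=j*k..<j*k+k. c i \<omega> * of_real (a i \<omega>)))
          \<le> (\<Sum>i=j*k..<j*k+k. \<eta> * \<bar>a i \<omega>\<bar>)" by (simp add: norm_mult)
    qed
    also have "\<dots> = (\<Sum>i<m*k. \<eta> * \<bar>a i \<omega>\<bar>)" by (rule sum.nat_group)
    finally show ?thesis .
  qed
  have "expectation (\<lambda>\<omega>. min 1 (cmod (P \<omega> + Q \<omega>))) \<le> expectation (\<lambda>\<omega>. min 1 (cmod (P \<omega>)) + (\<Sum>i<m*k. \<eta> * \<bar>a i \<omega>\<bar>))"
  proof (rule integral_mono)
    fix \<omega> assume "\<omega> \<in> space M"
    from Qle[OF this] show "min 1 (cmod (P \<omega> + Q \<omega>)) \<le> min 1 (cmod (P \<omega>)) + (\<Sum>i<m*k. \<eta> * \<bar>a i \<omega>\<bar>)"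
      using min_one_add[OF norm_triangle_ineq[of "P \<omega>" "Q \<omega>"]] by simp
  qed (use PM QM ai in \<open>auto intro!: integrable_min1 Bochner_Integration.integrable_add Bochner_Integration.integrable_sum\<close>)
  also have "\<dots> = expectation (\<lambda>\<omega>. min 1 (cmod (P \<omega>))) + \<eta> * (\<Sum>i<m*k. expectation (\<lambda>\<omega>. \<bar>a i \<omega>\<bar>))"
    using ai PM by (subst Bochner_Integration.integral_add)
      (auto intro!: integrable_min1 Bochner_Integration.integrable_sum simp: sum_distrib_left Bochner_Integration.integral_sum)
  also have "expectation (\<lambda>\<omega>. min 1 (cmod (P \<omega>))) \<le> \<eta> * (1 + (lam\<^sup>2 + 2 * lam * ?X) + S)"
    unfolding P_def by (rule weighted_blocks[OF d B \<open>k > 0\<close> \<open>\<eta> > 0\<close> c c\<eta> g g1 S])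
  also have "\<eta> * (\<Sum>i<m*k. expectation (\<lambda>\<omega>. \<bar>a i \<omega>\<bar>)) \<le> \<eta> * ?X"
    using A \<open>\<eta> > 0\<close> by (intro mult_left_mono) auto
  finally have "expectation (\<lambda>\<omega>. min 1 (cmod (P \<omega> + Q \<omega>))) \<le> \<eta> * (1 + (lam\<^sup>2 + 2 * lam * ?X) + S) + \<eta> * ?X"
    by simp
  also have "\<dots> = \<eta> * (1 + lam\<^sup>2 + (2 * lam + 1) * ?X + S)" by (simp add: algebra_simps)
  also have "(\<lambda>\<omega>. min 1 (cmod (P \<omega> + Q \<omega>))) = (\<lambda>\<omega>. min 1 (cmod (\<Sum>j<m. (g j \<omega> + g (Suc j) \<omega>) / 2 *
      (\<Sum>i=j*k..<j*k+k. c i \<omega> * of_real (d i \<omega> + a i \<omega>)))))"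
    by (simp add: P_def Q_def sum.distrib distrib_left)
  finally show ?thesis
    using square_mdiff_measurable[OF d] aM da by (intro that[of "\<lambda>i \<omega>. d i \<omega> + a i \<omega>"]) auto
qed

end

section \<open>Brownian increments\<close>

lemma borel_measurable_cis [measurable]: "cis \<in> borel_measurable borel"
  by (rule borel_measurable_continuous_onI) (simp add: cis_conv_exp continuous_intros)

context prob_space
begin

text \<open>Translates independence of an increment from the past, stated for sigma-algebras, into
  independence of functions measurable with respect to them, for which expectations
  factorize.\<close>

lemma indep_var_of_indep_set:
  fixes Z Y :: "'a \<Rightarrow> 'b::topological_space"
  assumes i: "indep_set (sets A) (sets B)" and "space A = space M" "space B = space M"
    and Z: "Z \<in> borel_measurable A" and Y: "Y \<in> borel_measurable B"
  shows "indep_var borel Z borel Y"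
proof -
  have AM: "sets A \<subseteq> events" and BM: "sets B \<subseteq> events"
    using indep_setD_ev1[OF i] indep_setD_ev2[OF i] .
  have ZM: "Z \<in> borel_measurable M"
    using measurable_from_subalg[of M A Z borel] Z AM assms(2) by (simp add: subalgebra_def)
  have YM: "Y \<in> borel_measurable M"
    using measurable_from_subalg[of M B Y borel] Y BM assms(3) by (simp add: subalgebra_def)
  have "{Z -` S \<inter> space M |S. S \<in> sets borel} \<subseteq> sets A"
    using measurable_sets[OF Z] assms(2) by auto
  from sets.sigma_sets_subset[OF this]
  have SA: "sigma_sets (space M) {Z -` S \<inter> space M |S. S \<in> sets borel} \<subseteq> sets A"
    by (simp only: assms(2))
  have "{Y -` S \<inter> space M |S. S \<in> sets borel} \<subseteq> sets B"
    using measurable_sets[OF Y] assms(3) by auto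
  from sets.sigma_sets_subset[OF this]
  have SB: "sigma_sets (space M) {Y -` S \<inter> space M |S. S \<in> sets borel} \<subseteq> sets B"
    by (simp only: assms(3))
  show ?thesis
    unfolding indep_var_eq indep_sets2_eq
  proof (intro conjI ballI)
    fix a b
    assume "a \<in> sigma_sets (space M) {Z -` S \<inter> space M |S. S \<in> sets borel}"
      "b \<in> sigma_sets (space M) {Y -` S \<inter> space M |S. S \<in> sets borel}"
    then show "prob (a \<inter> b) = prob a * prob b"
      using SA SB by (intro indep_setD[OF i]) (rule subsetD, assumption+)+
  qed (fact ZM YM order_trans[OF SA AM] order_trans[OF SB BM])+
qed

text \<open>Scaling from the standard normal law. Its third absolute moment is 2 sqrt (2 / pi),
  whence the constant 2; the last claim is its characteristic function at
  \<open>a * \<sigma>\<close>.\<close>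

lemma normal_moments:
  assumes D: "distributed M lborel X (normal_density 0 \<sigma>)" and \<sigma>: "\<sigma> > 0"
  shows "integrable M X" "expectation X = 0"
    and "integrable M (\<lambda>\<omega>. (X \<omega>)\<^sup>2)" "expectation (\<lambda>\<omega>. (X \<omega>)\<^sup>2) = \<sigma>\<^sup>2"
    and "integrable M (\<lambda>\<omega>. \<bar>X \<omega>\<bar> ^ 3)" "expectation (\<lambda>\<omega>. \<bar>X \<omega>\<bar> ^ 3) \<le> 2 * \<sigma> ^ 3"
    and "expectation (\<lambda>\<omega>. cis (a * X \<omega>)) = of_real (exp (- (a\<^sup>2 * \<sigma>\<^sup>2 / 2)))"
proof -
  define Y where "Y \<omega> = X \<omega> / \<sigma>" for \<omega>
  have XY: "X = (\<lambda>\<omega>. \<sigma> * Y \<omega>)" using \<sigma> by (auto simp: Y_def)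
  have DY: "distributed M lborel Y std_normal_density"
    using D normal_standard_normal_convert[OF \<sigma>, of X 0] by (simp add: Y_def[abs_def])
  have i: "integrable M (\<lambda>\<omega>. f (Y \<omega>)) \<longleftrightarrow> integrable lborel (\<lambda>x. std_normal_density x * f x)"
    and e: "expectation (\<lambda>\<omega>. f (Y \<omega>)) = (\<integral>x. std_normal_density x * f x \<partial>lborel)"
    if "f \<in> borel_measurable borel" for f :: "real \<Rightarrow> real"
    using distributed_integrable[OF DY, of f] distributed_integral[OF DY, of f] that by auto
  have iY: "integrable M Y" using i[of "\<lambda>x. x"] integrable_std_normal_moment[of 1] by simp
  have eY: "expectation Y = 0" using e[of "\<lambda>x. x"] integral_std_normal_moment_odd[of 0] by simp
  have iY2: "integrable M (\<lambda>\<omega>. (Y \<omega>)\<^sup>2)" using i[of "\<lambda>x. x\<^sup>2"] integrable_std_normal_moment[of 2] by simp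
  have eY2: "expectation (\<lambda>\<omega>. (Y \<omega>)\<^sup>2) = 1"
    using e[of "\<lambda>x. x\<^sup>2"] integral_std_normal_moment_even[of 1] by (simp add: fact_numeral)
  have iY3: "integrable M (\<lambda>\<omega>. \<bar>Y \<omega>\<bar> ^ 3)" using i[of "\<lambda>x. \<bar>x\<bar> ^ 3"] integrable_std_normal_moment_abs[of 3] by simp
  have eY3: "expectation (\<lambda>\<omega>. \<bar>Y \<omega>\<bar> ^ 3) \<le> 2"
  proof -
    have "expectation (\<lambda>\<omega>. \<bar>Y \<omega>\<bar> ^ 3) = sqrt (2 / pi) * 2"
      using e[of "\<lambda>x. \<bar>x\<bar> ^ 3"] integral_std_normal_moment_abs_odd[of 1] by (simp add: numeral_3_eq_3)
    moreover have "sqrt (2 / pi) \<le> 1" using pi_gt3 by simp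
    ultimately show ?thesis by linarith
  qed
  show "integrable M X" "expectation X = 0" unfolding XY using iY eY by simp_all
  show "integrable M (\<lambda>\<omega>. (X \<omega>)\<^sup>2)" "expectation (\<lambda>\<omega>. (X \<omega>)\<^sup>2) = \<sigma>\<^sup>2"
    unfolding XY power_mult_distrib using iY2 eY2 by simp_all
  have "\<bar>X \<omega>\<bar> ^ 3 = \<sigma> ^ 3 * \<bar>Y \<omega>\<bar> ^ 3" for \<omega>
    unfolding XY using \<sigma> by (simp add: abs_mult power_mult_distrib)
  then show "integrable M (\<lambda>\<omega>. \<bar>X \<omega>\<bar> ^ 3)" "expectation (\<lambda>\<omega>. \<bar>X \<omega>\<bar> ^ 3) \<le> 2 * \<sigma> ^ 3"
    using iY3 eY3 \<sigma> by (simp_all add: mult.commute)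
  have YM: "Y \<in> borel_measurable M" using borel_measurable_integrable[OF iY] .
  have "expectation (\<lambda>\<omega>. iexp ((a * \<sigma>) * Y \<omega>)) = (\<integral>x. iexp ((a * \<sigma>) * x) \<partial>distr M lborel Y)"
    using YM by (subst integral_distr) auto
  also have "distr M lborel Y = std_normal_distribution"
    using distributed_distr_eq_density[OF DY] .
  also have "(\<integral>x. iexp ((a * \<sigma>) * x) \<partial>std_normal_distribution) = of_real (exp (- (a * \<sigma>)\<^sup>2 / 2))"
    using fun_cong[OF char_std_normal_distribution, of "a * \<sigma>"] by (simp only: char_def)
  finally have "expectation (\<lambda>\<omega>. cis ((a * \<sigma>) * Y \<omega>)) = of_real (exp (- (a * \<sigma>)\<^sup>2 / 2))"
    unfolding cis_conv_exp .
  moreover have "(a * \<sigma>) * Y \<omega> = a * X \<omega>" for \<omega> using \<sigma> by (simp add: Y_def)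
  moreover have "- (a * \<sigma>)\<^sup>2 / 2 = - (a\<^sup>2 * \<sigma>\<^sup>2 / 2)" by (simp add: power_mult_distrib)
  ultimately show "expectation (\<lambda>\<omega>. cis (a * X \<omega>)) = of_real (exp (- (a\<^sup>2 * \<sigma>\<^sup>2 / 2)))"
    by (simp only:)
qed

end

text \<open>
  Every Brownian motion has a modification of this kind, because the filtration is complete.
\<close>

locale brownian_filtration = usual_filtration M F
  for M :: "'a measure" and F :: "real \<Rightarrow> 'a measure" +
  fixes W :: "real \<Rightarrow> 'a \<Rightarrow> real"
  assumes W_adapted: "0 \<le> t \<Longrightarrow> W t \<in> borel_measurable (F t)"
    and W_continuous: "\<omega> \<in> space M \<Longrightarrow> continuous_on {0..} (\<lambda>t. W t \<omega>)"
    and W_0: "\<omega> \<in> space M \<Longrightarrow> W 0 \<omega> = 0"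
    and W_mean: "0 \<le> s \<Longrightarrow> s < t \<Longrightarrow> AE \<omega> in M. real_cond_exp M (F s) (\<lambda>\<omega>. W t \<omega> - W s \<omega>) \<omega> = 0"
    and W_square: "0 \<le> s \<Longrightarrow> s < t \<Longrightarrow> integrable M (\<lambda>\<omega>. (W t \<omega> - W s \<omega>)\<^sup>2)"
      "0 \<le> s \<Longrightarrow> s < t \<Longrightarrow> expectation (\<lambda>\<omega>. (W t \<omega> - W s \<omega>)\<^sup>2) = t - s"
    and W_cube: "0 \<le> s \<Longrightarrow> s < t \<Longrightarrow> integrable M (\<lambda>\<omega>. \<bar>W t \<omega> - W s \<omega>\<bar> ^ 3)"
      "0 \<le> s \<Longrightarrow> s < t \<Longrightarrow> expectation (\<lambda>\<omega>. \<bar>W t \<omega> - W s \<omega>\<bar> ^ 3) \<le> 2 * (sqrt (t - s)) ^ 3"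
    and W_char: "0 \<le> s \<Longrightarrow> s < t \<Longrightarrow> Z \<in> borel_measurable (F s) \<Longrightarrow> (\<And>\<omega>. \<omega> \<in> space M \<Longrightarrow> cmod (Z \<omega>) \<le> C) \<Longrightarrow>
      expectation (\<lambda>\<omega>. Z \<omega> * cis (a * (W t \<omega> - W s \<omega>))) = expectation Z * of_real (exp (- (a\<^sup>2 * (t - s) / 2)))"

section \<open>Consequences of the usual conditions\<close>

context usual_filtration
begin

lemma space_F: "0 \<le> t \<Longrightarrow> space (F t) = space M"
  using subalgebra[of t] by (simp add: subalgebra_def)

lemma subalgebra_mono: "0 \<le> s \<Longrightarrow> s \<le> t \<Longrightarrow> subalgebra (F t) (F s)"
  using filtration.sets_F_mono[OF filtration, of s t] by (simp add: subalgebra_def space_F)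

lemma measurable_F: "0 \<le> t \<Longrightarrow> f \<in> borel_measurable (F t) \<Longrightarrow> f \<in> borel_measurable M"
  by (rule measurable_from_subalg[OF subalgebra])

lemma measurable_F_mono: "0 \<le> s \<Longrightarrow> s \<le> t \<Longrightarrow> f \<in> borel_measurable (F s) \<Longrightarrow> f \<in> borel_measurable (F t)"
  by (rule measurable_from_subalg[OF subalgebra_mono])

lemma sigma_finite_F: "0 \<le> t \<Longrightarrow> sigma_finite_subalgebra M (F t)"
proof -
  assume "0 \<le> t"
  then interpret finite_measure_subalgebra M "F t" by unfold_locales (rule subalgebra)
  show ?thesis ..
qed

text \<open>Null sets of \<open>M\<close> already belong to \<open>F 0\<close>, so an exceptional
  set can be removed without losing adaptedness.\<close>

lemma AE_event_F0:
  assumes "AE \<omega> in M. P \<omega>"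
  obtains A where "A \<in> sets (F 0)" "A \<subseteq> space M" "AE \<omega> in M. \<omega> \<in> A" "\<And>\<omega>. \<omega> \<in> A \<Longrightarrow> P \<omega>"
proof -
  obtain N where N: "{\<omega>\<in>space M. \<not> P \<omega>} \<subseteq> N" "N \<in> null_sets M"
    using assms by (metis AE_E null_setsI)
  have "N \<in> sets (F 0)" using null_sets N(2) by auto
  then have "space (F 0) - N \<in> sets (F 0)" by auto
  moreover have "AE \<omega> in M. \<omega> \<in> space M - N"
    using AE_not_in[OF N(2)] AE_space by eventually_elim auto
  ultimately show ?thesis using N(1) by (intro that[of "space M - N"]) (auto simp: space_F)
qed

lemma brownian_modification:
  assumes W0: "brownian_motion M F W0"
  obtains W where "brownian_filtration M F W" "AE \<omega> in M. \<forall>t\<ge>0. W t \<omega> = W0 t \<omega>"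
proof -
  have ad: "W0 t \<in> borel_measurable (F t)" if "t \<ge> 0" for t
    using W0 that by (auto simp: brownian_motion_def adapted_def)
  have D: "distributed M lborel (\<lambda>\<omega>. W0 t \<omega> - W0 s \<omega>) (normal_density 0 (sqrt (t - s)))"
    and ind: "indep_set (sets (F s)) (sets (vimage_algebra (space M) (\<lambda>\<omega>. W0 t \<omega> - W0 s \<omega>) borel))"
    if "0 \<le> s" "s < t" for s t
    using W0 that by (auto simp: brownian_motion_def)
  have "AE \<omega> in M. continuous_on {0..} (\<lambda>t. W0 t \<omega>) \<and> W0 0 \<omega> = 0"
    using W0 by (auto simp: brownian_motion_def ae_continuous_def)
  then obtain A where A: "A \<in> sets (F 0)" "A \<subseteq> space M" "AE \<omega> in M. \<omega> \<in> A"
    "\<And>\<omega>. \<omega> \<in> A \<Longrightarrow> continuous_on {0..} (\<lambda>t. W0 t \<omega>) \<and> W0 0 \<omega> = 0"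
    by (rule AE_event_F0) blast
  \<comment> \<open>The zero path is continuous and starts at 0. As \<open>A\<close> belongs to
    \<open>F 0\<close>, switching to it off \<open>A\<close> keeps the process adapted.\<close>
  define W where "W t \<omega> = (if \<omega> \<in> A then W0 t \<omega> else 0)" for t \<omega>
  have eq: "AE \<omega> in M. \<forall>t. W t \<omega> = W0 t \<omega>" using A(3) by eventually_elim (simp add: W_def)
  have eqd: "AE \<omega> in M. W t \<omega> - W s \<omega> = W0 t \<omega> - W0 s \<omega>" for s t
    using eq by eventually_elim simp
  have WF: "W t \<in> borel_measurable (F t)" if "t \<ge> 0" for t
  proof -
    have [measurable]: "A \<in> sets (F t)" using A(1) subalgebra_mono[of 0 t] that by (auto simp: subalgebra_def)
    note [measurable] = ad[OF that]
    show ?thesis unfolding W_def by measurable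
  qed
  have WM: "W t \<in> borel_measurable M" "W0 t \<in> borel_measurable M" if "t \<ge> 0" for t
    using measurable_F[OF that] WF[OF that] ad[OF that] by auto
  have W0F: "(\<lambda>\<omega>. W0 t \<omega> - W0 s \<omega>) \<in> borel_measurable (vimage_algebra (space M) (\<lambda>\<omega>. W0 t \<omega> - W0 s \<omega>) borel)" for s t
    by (rule measurable_vimage_algebra1) auto
  have "brownian_filtration M F W"
  proof (unfold_locales)
    show "W t \<in> borel_measurable (F t)" if "0 \<le> t" for t by (rule WF[OF that])
    show "continuous_on {0..} (\<lambda>t. W t \<omega>)" "W 0 \<omega> = 0" for \<omega>
      using A(4)[of \<omega>] by (cases "\<omega> \<in> A"; simp add: W_def)+
  next
    fix s t :: real assume st: "0 \<le> s" "s < t"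
    have \<sigma>: "sqrt (t - s) > 0" using st by simp
    have t0: "0 \<le> t" using st by simp
    note mom = normal_moments[OF D[OF st] \<sigma>]
    note [measurable] = WM[OF t0] WM[OF st(1)]
    have tr: "integrable M (\<lambda>\<omega>. f (W t \<omega> - W s \<omega>)) \<longleftrightarrow> integrable M (\<lambda>\<omega>. f (W0 t \<omega> - W0 s \<omega>))"
      "expectation (\<lambda>\<omega>. f (W t \<omega> - W s \<omega>)) = expectation (\<lambda>\<omega>. f (W0 t \<omega> - W0 s \<omega>))"
      if [measurable]: "f \<in> borel_measurable borel" for f :: "real \<Rightarrow> real"
    proof -
      have *: "AE \<omega> in M. f (W t \<omega> - W s \<omega>) = f (W0 t \<omega> - W0 s \<omega>)"
        using eqd[of t s] by eventually_elim simp
      show "integrable M (\<lambda>\<omega>. f (W t \<omega> - W s \<omega>)) \<longleftrightarrow> integrable M (\<lambda>\<omega>. f (W0 t \<omega> - W0 s \<omega>))"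
        by (rule integrable_cong_AE[OF _ _ *]) measurable
      show "expectation (\<lambda>\<omega>. f (W t \<omega> - W s \<omega>)) = expectation (\<lambda>\<omega>. f (W0 t \<omega> - W0 s \<omega>))"
        by (rule integral_cong_AE[OF _ _ *]) measurable
    qed
    show "integrable M (\<lambda>\<omega>. (W t \<omega> - W s \<omega>)\<^sup>2)" "expectation (\<lambda>\<omega>. (W t \<omega> - W s \<omega>)\<^sup>2) = t - s"
      using mom(3,4) tr[of "\<lambda>x. x\<^sup>2"] st by simp_all
    show "integrable M (\<lambda>\<omega>. \<bar>W t \<omega> - W s \<omega>\<bar> ^ 3)" "expectation (\<lambda>\<omega>. \<bar>W t \<omega> - W s \<omega>\<bar> ^ 3) \<le> 2 * (sqrt (t - s)) ^ 3"
      using mom(5,6) tr[of "\<lambda>x. \<bar>x\<bar> ^ 3"] by simp_all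
    have iW: "integrable M (\<lambda>\<omega>. W t \<omega> - W s \<omega>)" "expectation (\<lambda>\<omega>. W t \<omega> - W s \<omega>) = 0"
      using mom(1,2) tr[of "\<lambda>x. x"] by simp_all
    have spB: "space (vimage_algebra (space M) (\<lambda>\<omega>. W0 t \<omega> - W0 s \<omega>) borel) = space M" by simp
    interpret Fs: sigma_finite_subalgebra M "F s" by (rule sigma_finite_F[OF st(1)])
    show "AE \<omega> in M. real_cond_exp M (F s) (\<lambda>\<omega>. W t \<omega> - W s \<omega>) \<omega> = 0"
    proof (rule Fs.real_cond_exp_charact)
      fix B assume B: "B \<in> sets (F s)"
      have [measurable]: "B \<in> sets M" using B subalgebra[OF st(1)] by (auto simp: subalgebra_def)
      \<comment> \<open>Independence makes the increment centered on every \<open>B\<close> of the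
        past, which characterizes its conditional mean as 0.\<close>
      have "indep_var borel (indicat_real B) borel (\<lambda>\<omega>. W0 t \<omega> - W0 s \<omega>)"
        by (rule indep_var_of_indep_set[OF ind[OF st] space_F[OF st(1)] spB _ W0F]) (use B in auto)
      from indep_var_lebesgue_integral[OF this]
      have "expectation (\<lambda>\<omega>. indicat_real B \<omega> * (W0 t \<omega> - W0 s \<omega>)) = 0"
        using mom(1,2) integrable_indicator_event[of B] by simp
      moreover have "expectation (\<lambda>\<omega>. indicat_real B \<omega> * (W t \<omega> - W s \<omega>))
          = expectation (\<lambda>\<omega>. indicat_real B \<omega> * (W0 t \<omega> - W0 s \<omega>))"
        using eqd[of t s] by (intro integral_cong_AE) auto
      ultimately show "set_lebesgue_integral M B (\<lambda>\<omega>. W t \<omega> - W s \<omega>) = set_lebesgue_integral M B (\<lambda>x. 0)"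
        by (simp add: set_lebesgue_integral_def)
    qed (use iW in auto)
    fix Z :: "'a \<Rightarrow> complex" and C a :: real
    assume Z: "Z \<in> borel_measurable (F s)" and ZC: "\<And>\<omega>. \<omega> \<in> space M \<Longrightarrow> cmod (Z \<omega>) \<le> C"
    note [measurable] = measurable_F[OF st(1) Z]
    have iZ: "integrable M Z" by (rule integrable_const_bound[where B=C]) (auto simp: ZC)
    have iE: "integrable M (\<lambda>\<omega>. cis (a * (W0 t \<omega> - W0 s \<omega>)))"
      by (rule integrable_const_bound[where B=1]) auto
    have "indep_var borel Z borel (\<lambda>\<omega>. cis (a * (W0 t \<omega> - W0 s \<omega>)))"
    proof (rule indep_var_of_indep_set[OF ind[OF st] space_F[OF st(1)] spB Z])
      note [measurable] = W0F[of t s]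
      show "(\<lambda>\<omega>. cis (a * (W0 t \<omega> - W0 s \<omega>))) \<in> borel_measurable (vimage_algebra (space M) (\<lambda>\<omega>. W0 t \<omega> - W0 s \<omega>) borel)"
        by (rule measurable_compose[OF W0F[of t s], where g = "\<lambda>x. cis (a * x)"]) measurable
    qed
    from indep_var_lebesgue_integral[OF this iZ iE]
    have "expectation (\<lambda>\<omega>. Z \<omega> * cis (a * (W0 t \<omega> - W0 s \<omega>))) = expectation Z * of_real (exp (- (a\<^sup>2 * (t - s) / 2)))"
      using mom(7)[of a] st by simp
    moreover have "expectation (\<lambda>\<omega>. Z \<omega> * cis (a * (W t \<omega> - W s \<omega>))) = expectation (\<lambda>\<omega>. Z \<omega> * cis (a * (W0 t \<omega> - W0 s \<omega>)))"
      using eqd[of t s] by (intro integral_cong_AE) auto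
    ultimately show "expectation (\<lambda>\<omega>. Z \<omega> * cis (a * (W t \<omega> - W s \<omega>))) = expectation Z * of_real (exp (- (a\<^sup>2 * (t - s) / 2)))"
      by simp
  qed
  moreover have "AE \<omega> in M. \<forall>t\<ge>0. W t \<omega> = W0 t \<omega>" using eq by eventually_elim simp
  ultimately show ?thesis by (rule that)
qed

end

section \<open>Existence\<close>

lemma borel_measurable_disc_field [measurable]: "disc_field \<in> borel_measurable borel"
  by (rule borel_measurable_continuous_onI) (intro continuous_intros)

lemma borel_measurable_cnj [measurable]: "cnj \<in> borel_measurable borel"
  by (rule borel_measurable_continuous_onI) (intro continuous_intros)

context brownian_filtration
begin

lemma W_measurable: "0 \<le> t \<Longrightarrow> W t \<in> borel_measurable M"
  by (rule measurable_F[OF _ W_adapted])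

text \<open>A pointwise limit of left Riemann sums, each of which uses the process at times up to
  \<open>t\<close> only.\<close>

lemma adapted_integral:
  fixes X :: "real \<Rightarrow> 'a \<Rightarrow> complex"
  assumes "0 \<le> t" and X: "\<And>s. s \<in> {0..t} \<Longrightarrow> X s \<in> borel_measurable (F s)"
    and c: "\<And>\<omega>. \<omega> \<in> space M \<Longrightarrow> continuous_on {0..t} (\<lambda>s. X s \<omega>)"
  shows "(\<lambda>\<omega>. integral {0..t} (\<lambda>s. X s \<omega>)) \<in> borel_measurable (F t)"
proof (rule borel_measurable_LIMSEQ_metric)
  show "(\<lambda>m. \<Sum>i<Suc m. X (grid 0 t (Suc m) i) \<omega> * of_real ((t - 0) / real (Suc m)))
      \<longlonglongrightarrow> integral {0..t} (\<lambda>s. X s \<omega>)" if "\<omega> \<in> space (F t)" for \<omega>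
    using that c space_F[OF \<open>0 \<le> t\<close>] by (intro left_riemann_tendsto \<open>0 \<le> t\<close>) auto
  fix m
  have "X (grid 0 t (Suc m) i) \<in> borel_measurable (F t)" if "i \<in> {..<Suc m}" for i
  proof -
    have "grid 0 t (Suc m) i \<in> {0..t}" using that \<open>0 \<le> t\<close> by (intro grid_mem) auto
    with X[OF this] show ?thesis by (intro measurable_F_mono[of "grid 0 t (Suc m) i" t]) auto
  qed
  then show "(\<lambda>\<omega>. \<Sum>i<Suc m. X (grid 0 t (Suc m) i) \<omega> * of_real ((t - 0) / real (Suc m))) \<in> borel_measurable (F t)"
    by (intro borel_measurable_sum borel_measurable_times) auto
qed

text \<open>One factor \<open>sqrt (t - s)\<close> of the third moment is bounded by
  \<open>sqrt \<delta>\<close>; what is left is linear in \<open>t - s\<close> and telescopes over a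
  partition.\<close>

lemma cube_bound:
  assumes "0 \<le> s" "s \<le> t" "t - s \<le> \<delta>"
  shows "integrable M (\<lambda>\<omega>. \<bar>W t \<omega> - W s \<omega>\<bar> ^ 3)"
    and "expectation (\<lambda>\<omega>. \<bar>W t \<omega> - W s \<omega>\<bar> ^ 3) \<le> 2 * sqrt \<delta> * (t - s)"
proof -
  have "integrable M (\<lambda>\<omega>. \<bar>W t \<omega> - W s \<omega>\<bar> ^ 3) \<and>
    expectation (\<lambda>\<omega>. \<bar>W t \<omega> - W s \<omega>\<bar> ^ 3) \<le> 2 * sqrt \<delta> * (t - s)"
  proof (cases "s = t")
    case False
    then have st: "s < t" using assms by simp
    have "(sqrt (t - s)) ^ 3 = sqrt (t - s) * (t - s)" using st by (simp add: power3_eq_cube)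
    also have "\<dots> \<le> sqrt \<delta> * (t - s)" using assms by (intro mult_right_mono) auto
    finally show ?thesis using W_cube[OF assms(1) st] by simp
  qed simp
  then show "integrable M (\<lambda>\<omega>. \<bar>W t \<omega> - W s \<omega>\<bar> ^ 3)"
    and "expectation (\<lambda>\<omega>. \<bar>W t \<omega> - W s \<omega>\<bar> ^ 3) \<le> 2 * sqrt \<delta> * (t - s)" by blast+
qed

text \<open>The mean of the cubic sum is at most 2 t times the square root of the mesh.\<close>

lemma prob_null_cube_sum:
  assumes p: "partition_seq 0 t N p" and X: "\<And>m. X m \<in> borel_measurable M"
    and le: "\<And>m \<omega>. \<omega> \<in> space M \<Longrightarrow> cmod (X m \<omega>) \<le> C * (\<Sum>i<N m. \<bar>W (p m (Suc i)) \<omega> - W (p m i) \<omega>\<bar> ^ 3)"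
    and "C \<ge> 0"
  shows "prob_null X"
proof (rule prob_nullI[OF X])
  fix \<epsilon> :: real assume "\<epsilon> > 0"
  have t0: "0 \<le> t" using partition_seq_le[OF p] .
  \<comment> \<open>Chosen so that \<open>(C + 1) * (2 * sqrt \<delta> * (t + 1))\<close> equals the
    tolerance; the summands 1 exclude a zero denominator.\<close>
  define \<delta> where "\<delta> = (\<epsilon> / (2 * (C + 1) * (t + 1)))\<^sup>2"
  have pos: "0 < \<epsilon> / (2 * (C + 1) * (t + 1))"
    using \<open>C \<ge> 0\<close> t0 \<open>\<epsilon> > 0\<close> by (intro divide_pos_pos mult_pos_pos) auto
  have sq: "sqrt \<delta> = \<epsilon> / (2 * (C + 1) * (t + 1))"
    unfolding \<delta>_def real_sqrt_abs using pos by (rule abs_of_pos)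
  have "\<delta> > 0" unfolding \<delta>_def using pos by (rule zero_less_power)
  then have "\<forall>\<^sub>F m in sequentially. \<forall>i<N m. p m (Suc i) - p m i < \<delta>"
    using p by (auto simp: partition_seq_def)
  then show "\<forall>\<^sub>F m in sequentially. expectation (\<lambda>\<omega>. min 1 (cmod (X m \<omega>))) \<le> \<epsilon>"
  proof eventually_elim
    case (elim m)
    let ?D = "\<lambda>i \<omega>. \<bar>W (p m (Suc i)) \<omega> - W (p m i) \<omega>\<bar> ^ 3"
    have pm: "p m i \<le> p m (Suc i)" "0 \<le> p m i" if "i < N m" for i
      using p partition_seq_mem[OF p that, of "p m i"] that by (auto simp: partition_seq_def)
    have D: "integrable M (?D i)" "expectation (?D i) \<le> 2 * sqrt \<delta> * (p m (Suc i) - p m i)" if "i < N m" for i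
      using cube_bound[OF pm(2)[OF that] pm(1)[OF that], of \<delta>] elim that by auto
    have "expectation (\<lambda>\<omega>. min 1 (cmod (X m \<omega>))) \<le> expectation (\<lambda>\<omega>. C * (\<Sum>i<N m. ?D i \<omega>))"
      using D(1) le[of _ m] by (intro integral_mono integrable_min1 X) (auto intro: order_trans[OF min.cobounded2])
    also have "\<dots> = C * (\<Sum>i<N m. expectation (?D i))"
      using D(1) by (simp add: Bochner_Integration.integral_sum)
    also have "\<dots> \<le> C * (\<Sum>i<N m. 2 * sqrt \<delta> * (p m (Suc i) - p m i))"
      using D(2) by (intro mult_left_mono sum_mono \<open>C \<ge> 0\<close>) auto
    also have "\<dots> = C * (2 * sqrt \<delta> * t)"
      using p sum_lessThan_telescope[of "p m" "N m"] by (simp add: sum_distrib_left[symmetric] partition_seq_def)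
    also have "\<dots> \<le> (C + 1) * (2 * sqrt \<delta> * (t + 1))"
      using \<open>C \<ge> 0\<close> t0 \<open>\<delta> > 0\<close> by (intro mult_mono) auto
    also have "\<dots> = \<epsilon>"
    proof -
      have *: "A * (2 * (\<epsilon> / (2 * A * B)) * B) = \<epsilon>" if "A \<noteq> 0" "B \<noteq> 0" for A B :: real
        using that by simp
      have "C + 1 \<noteq> 0" "t + 1 \<noteq> 0" using \<open>C \<ge> 0\<close> t0 by auto
      from *[OF this] show ?thesis unfolding sq .
    qed
    finally show ?case .
  qed
qed

end

text \<open>The bound on \<open>\<xi>\<close> is required at every point, so that the disc arguments
  are pathwise; a datum bounded almost surely is first changed on a null set. In the theorem
  \<open>a\<close> is \<open>sqrt 2 * \<epsilon>\<close>.\<close>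

locale disc_setup = brownian_filtration M F W
  for M :: "'a measure" and F and W +
  fixes K a :: real and \<xi> :: "'a \<Rightarrow> complex"
  assumes K: "K > 0" and a: "a > 0"
    and \<xi>_measurable: "\<xi> \<in> borel_measurable (F 0)" and \<xi>_le: "\<And>\<omega>. cmod (\<xi> \<omega>) \<le> 1"
begin

definition b :: "complex \<Rightarrow> complex" where "b z = of_real K * (1 - z\<^sup>2)"

definition e :: "real \<Rightarrow> 'a \<Rightarrow> complex" where "e t \<omega> = cis (a * W t \<omega>)"

definition u :: "real \<Rightarrow> 'a \<Rightarrow> complex" where "u t \<omega> = rot_solution (\<lambda>s. e s \<omega>) K (\<xi> \<omega>) t"

definition h :: "real \<Rightarrow> 'a \<Rightarrow> complex" where "h t \<omega> = e t \<omega> * u t \<omega>"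

lemma norm_e [simp]: "cmod (e t \<omega>) = 1"
  by (simp add: e_def)

lemma e_continuous: "\<omega> \<in> space M \<Longrightarrow> continuous_on {0..} (\<lambda>t. e t \<omega>)"
  unfolding e_def cis_conv_exp by (intro continuous_intros W_continuous)

lemma e_continuous': "\<omega> \<in> space M \<Longrightarrow> 0 \<le> s \<Longrightarrow> continuous_on {s..t} (\<lambda>t. e t \<omega>)"
  by (rule continuous_on_subset[OF e_continuous]) auto

lemma e_cnj: "e t \<omega> * (cnj (e t \<omega>) * z) = z"
  by (simp add: e_def mult.assoc[symmetric] cis_cnj cis_mult)

lemma u_continuous: "\<omega> \<in> space M \<Longrightarrow> continuous_on {0..T} (\<lambda>t. u t \<omega>)"
  unfolding u_def by (rule rot_solution_continuous[OF e_continuous _ K \<xi>_le]) auto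

lemma h_continuous: "\<omega> \<in> space M \<Longrightarrow> continuous_on {0..T} (\<lambda>t. h t \<omega>)"
  unfolding h_def by (intro continuous_intros u_continuous e_continuous') auto

lemma h_continuous': "\<omega> \<in> space M \<Longrightarrow> 0 \<le> s \<Longrightarrow> continuous_on {s..t} (\<lambda>t. h t \<omega>)"
  by (rule continuous_on_subset[OF h_continuous[of \<omega> t]]) auto

lemma norm_h:
  assumes "\<omega> \<in> space M" "0 \<le> t"
  shows "cmod (h t \<omega>) \<le> 1"
    and "cmod (\<xi> \<omega>) = 1 \<Longrightarrow> cmod (h t \<omega>) = 1"
    and "cmod (\<xi> \<omega>) < 1 \<Longrightarrow> cmod (h t \<omega>) < 1"
  using norm_rot_solution[OF e_continuous[OF assms(1)] _ K \<xi>_le assms(2)]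
  by (simp_all add: h_def norm_mult u_def)

lemma norm_u: "\<omega> \<in> space M \<Longrightarrow> 0 \<le> t \<Longrightarrow> cmod (u t \<omega>) \<le> 1"
  using norm_h(1)[of \<omega> t] by (simp add: h_def norm_mult)

lemma norm_b: "cmod z \<le> 1 \<Longrightarrow> cmod (b z) \<le> 2 * K"
proof -
  assume "cmod z \<le> 1"
  then have "cmod (1 - z\<^sup>2) \<le> 2"
    using norm_triangle_ineq4[of 1 "z\<^sup>2"] by (simp add: norm_power) (smt (verit) norm_ge_zero power_le_one)
  then show ?thesis using K by (simp add: b_def norm_mult)
qed

lemma b_continuous [continuous_intros]: "continuous_on S f \<Longrightarrow> continuous_on S (\<lambda>s. b (f s))"
  unfolding b_def by (intro continuous_intros)

lemma u_eq: "\<omega> \<in> space M \<Longrightarrow> 0 \<le> t \<Longrightarrow> u t \<omega> = \<xi> \<omega> + integral {0..t} (\<lambda>s. cnj (e s \<omega>) * b (h s \<omega>))"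
  unfolding u_def h_def b_def
  by (subst rot_solution_eq[OF e_continuous _ K \<xi>_le]) (auto simp: mult_ac)

lemma u_0: "\<omega> \<in> space M \<Longrightarrow> u 0 \<omega> = \<xi> \<omega>"
  using u_eq[of \<omega> 0] by simp

lemma cnj_e_continuous: "\<omega> \<in> space M \<Longrightarrow> 0 \<le> s \<Longrightarrow> continuous_on {s..t} (\<lambda>s. cnj (e s \<omega>) * b (h s \<omega>))"
  by (intro continuous_intros e_continuous' h_continuous')

lemma u_diff:
  assumes "\<omega> \<in> space M" "0 \<le> s" "s \<le> t"
  shows "u t \<omega> - u s \<omega> = integral {s..t} (\<lambda>s. cnj (e s \<omega>) * b (h s \<omega>))"
proof -
  have "(\<lambda>s. cnj (e s \<omega>) * b (h s \<omega>)) integrable_on {0..t}"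
    by (intro integrable_continuous_real cnj_e_continuous assms(1)) auto
  from Henstock_Kurzweil_Integration.integral_combine[OF assms(2,3) this] show ?thesis
    using u_eq[OF assms(1), of t] u_eq[OF assms(1), of s] assms by (simp add: algebra_simps)
qed

text \<open>The derivative of \<open>u\<close> has modulus at most 2 K on the disc. All roughness of
  \<open>h\<close> sits in the factor \<open>e\<close>, which makes products with an increment of
  \<open>u\<close> easy to control.\<close>

lemma u_lipschitz:
  assumes "\<omega> \<in> space M" "0 \<le> s" "s \<le> t"
  shows "cmod (u t \<omega> - u s \<omega>) \<le> 2 * K * (t - s)"
  unfolding u_diff[OF assms] using assms
  by (intro integral_bound cnj_e_continuous) (auto simp: norm_mult intro!: norm_b norm_h)

lemma e_adapted: "0 \<le> t \<Longrightarrow> e t \<in> borel_measurable (F t)"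
proof -
  assume "0 \<le> t"
  note [measurable] = W_adapted[OF this]
  show ?thesis unfolding e_def by measurable
qed

text \<open>Each Picard iterate is adapted by induction, being an integral of an adapted continuous
  process, and \<open>lim\<close> preserves measurability.\<close>

lemma u_adapted: "0 \<le> t \<Longrightarrow> u t \<in> borel_measurable (F t)"
proof -
  have pc: "(\<lambda>\<omega>. picard (rot_field (\<lambda>s. e s \<omega>) K) (\<xi> \<omega>) n t) \<in> borel_measurable (F t)" if "0 \<le> t" for n t
    using that
  proof (induction n arbitrary: t)
    case 0
    then show ?case using measurable_F_mono[OF _ _ \<xi>_measurable, of t] by simp
  next
    case (Suc n)
    have "(\<lambda>\<omega>. integral {0..t} (\<lambda>s. rot_field (\<lambda>s. e s \<omega>) K s (picard (rot_field (\<lambda>s. e s \<omega>) K) (\<xi> \<omega>) n s)))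
        \<in> borel_measurable (F t)"
    proof (rule adapted_integral[OF Suc.prems])
      fix s assume s: "s \<in> {0..t}"
      then have s0: "0 \<le> s" by simp
      define P where "P \<omega> = picard (rot_field (\<lambda>s. e s \<omega>) K) (\<xi> \<omega>) n s" for \<omega>
      note [measurable] = Suc.IH[OF s0, folded P_def] e_adapted[OF s0]
      show "(\<lambda>\<omega>. rot_field (\<lambda>s. e s \<omega>) K s (picard (rot_field (\<lambda>s. e s \<omega>) K) (\<xi> \<omega>) n s)) \<in> borel_measurable (F s)"
        unfolding P_def[symmetric] unfolding rot_field_def by measurable
    next
      fix \<omega> assume \<omega>: "\<omega> \<in> space M"
      show "continuous_on {0..t} (\<lambda>s. rot_field (\<lambda>s. e s \<omega>) K s (picard (rot_field (\<lambda>s. e s \<omega>) K) (\<xi> \<omega>) n s))"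
        by (intro rot_field_continuous[OF e_continuous[OF \<omega>] _ K \<xi>_le]
            picard_continuous[where L = "6 * K" and B = "2 * K"]
            rot_field_lipschitz[OF e_continuous[OF \<omega>] _ K \<xi>_le] norm_rot_field_le[OF e_continuous[OF \<omega>] _ K \<xi>_le])
          (use K in auto)
    qed
    then show ?case
      using measurable_F_mono[OF _ _ \<xi>_measurable, of t] Suc.prems by simp
  qed
  assume "0 \<le> t"
  then show "u t \<in> borel_measurable (F t)"
    unfolding u_def rot_solution_def using pc by measurable
qed


lemma h_adapted: "0 \<le> t \<Longrightarrow> h t \<in> borel_measurable (F t)"
  unfolding h_def by (intro borel_measurable_times e_adapted u_adapted)

lemma b_measurable [measurable]: "b \<in> borel_measurable borel"
  unfolding b_def by measurable

text \<open>The Ito drift. Half the covariation of \<open>\<i> a h\<close> with \<open>W\<close> is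
  (i a)^2 / 2 = -a^2 / 2 times the integral of \<open>h\<close>.\<close>

definition drift :: "complex \<Rightarrow> complex" where "drift z = b z - of_real (a\<^sup>2 / 2) * z"

text \<open>The martingale part of \<open>h\<close>, in Ito notation the integral of
  \<open>\<i> a h dW\<close>, defined by what remains after removing the drift.\<close>

definition L :: "real \<Rightarrow> 'a \<Rightarrow> complex" where
  "L t \<omega> = h t \<omega> - \<xi> \<omega> - integral {0..t} (\<lambda>s. drift (h s \<omega>))"

lemma drift_measurable [measurable]: "drift \<in> borel_measurable borel"
  unfolding drift_def by measurable

lemma norm_drift: "cmod z \<le> 1 \<Longrightarrow> cmod (drift z) \<le> 2 * K + a\<^sup>2 / 2"
proof -
  assume z: "cmod z \<le> 1"
  have "cmod (drift z) \<le> cmod (b z) + (a\<^sup>2 / 2) * cmod z"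
    unfolding drift_def using norm_triangle_ineq4[of "b z" "of_real (a\<^sup>2 / 2) * z"] by (simp add: norm_mult norm_divide norm_power)
  also have "\<dots> \<le> 2 * K + (a\<^sup>2 / 2) * 1"
    using z by (intro add_mono norm_b mult_left_mono) auto
  finally show ?thesis by simp
qed

lemma drift_continuous: "\<omega> \<in> space M \<Longrightarrow> 0 \<le> s \<Longrightarrow> continuous_on {s..t} (\<lambda>s. drift (h s \<omega>))"
  unfolding drift_def by (intro continuous_intros h_continuous')

lemma drift_integral_diff:
  assumes "\<omega> \<in> space M" "0 \<le> s" "s \<le> t"
  shows "integral {0..t} (\<lambda>s. drift (h s \<omega>)) - integral {0..s} (\<lambda>s. drift (h s \<omega>)) = integral {s..t} (\<lambda>s. drift (h s \<omega>))"
proof -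
  have "(\<lambda>s. drift (h s \<omega>)) integrable_on {0..t}"
    by (intro integrable_continuous_real drift_continuous assms(1)) auto
  from Henstock_Kurzweil_Integration.integral_combine[OF assms(2,3) this] show ?thesis by (simp add: algebra_simps)
qed

lemma norm_drift_integral:
  assumes "\<omega> \<in> space M" "0 \<le> s" "s \<le> t"
  shows "cmod (integral {s..t} (\<lambda>s. drift (h s \<omega>))) \<le> (2 * K + a\<^sup>2 / 2) * (t - s)"
  using assms by (intro integral_bound drift_continuous) (auto intro!: norm_drift norm_h)

lemma drift_integral_adapted: "0 \<le> t \<Longrightarrow> (\<lambda>\<omega>. integral {0..t} (\<lambda>s. drift (h s \<omega>))) \<in> borel_measurable (F t)"
proof (rule adapted_integral)
  fix s assume "s \<in> {0..t}"
  then have [measurable]: "h s \<in> borel_measurable (F s)" by (intro h_adapted) auto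
  show "(\<lambda>\<omega>. drift (h s \<omega>)) \<in> borel_measurable (F s)" by measurable
qed (auto intro: drift_continuous)

lemma \<xi>_adapted: "0 \<le> t \<Longrightarrow> \<xi> \<in> borel_measurable (F t)"
  using measurable_F_mono[OF _ _ \<xi>_measurable, of t] by simp

lemma L_adapted: "0 \<le> t \<Longrightarrow> L t \<in> borel_measurable (F t)"
  unfolding L_def by (intro borel_measurable_diff h_adapted \<xi>_adapted drift_integral_adapted)

lemma L_0: "\<omega> \<in> space M \<Longrightarrow> L 0 \<omega> = 0"
  by (simp add: L_def h_def u_0 e_def W_0)

lemma norm_L:
  assumes "\<omega> \<in> space M" "0 \<le> t"
  shows "cmod (L t \<omega>) \<le> 2 + (2 * K + a\<^sup>2 / 2) * t"
proof -
  have "cmod (L t \<omega>) \<le> cmod (h t \<omega>) + cmod (\<xi> \<omega>) + cmod (integral {0..t} (\<lambda>s. drift (h s \<omega>)))"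
    unfolding L_def using norm_triangle_ineq4 norm_triangle_le_diff by (meson add_mono order_refl order_trans)
  also have "\<dots> \<le> 1 + 1 + (2 * K + a\<^sup>2 / 2) * (t - 0)"
    using assms by (intro add_mono norm_h \<xi>_le norm_drift_integral) auto
  finally show ?thesis by simp
qed

lemma e_step: "e t \<omega> = e s \<omega> * cis (a * (W t \<omega> - W s \<omega>))"
  by (simp add: e_def cis_mult algebra_simps)

text \<open>
  Given the past, the increments of \<open>h\<close> are, up to drift, those of the martingale
  \<open>exp (i a W + a\<^sup>2 t / 2)\<close>, whose conditional mean is the characteristic function of a Gaussian.
\<close>

lemma L_increment_zero:
  assumes s: "0 \<le> s" and st: "s < t" and A: "A \<in> sets (F s)"
  shows "expectation (\<lambda>\<omega>. indicator A \<omega> * (L t \<omega> - L s \<omega>)) = 0"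
proof -
  define p where "p m = grid s t (Suc m)" for m
  define \<delta> where "\<delta> m = (t - s) / real (Suc m)" for m
  \<comment> \<open>The mean of \<open>cis (a * dW)\<close> over a cell of length
    \<open>\<delta> m\<close>. Subtracting it centers the summands of \<open>S m\<close> given the
    past.\<close>
  define q where "q m = exp (- (a\<^sup>2 * \<delta> m / 2))" for m
  define S where "S m \<omega> = (\<Sum>i<Suc m. h (p m i) \<omega> * (cis (a * (W (p m (Suc i)) \<omega> - W (p m i) \<omega>)) - of_real (q m)))" for m \<omega>
  define R where "R m \<omega> = L t \<omega> - L s \<omega> - S m \<omega>" for m \<omega>
  have t0: "0 \<le> t" using s st by simp
  have \<delta>0: "\<delta> m > 0" for m using st by (simp add: \<delta>_def)
  have pS: "p m (Suc i) = p m i + \<delta> m" for m i by (simp add: p_def \<delta>_def grid_Suc del: of_nat_Suc)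
  have p_mem: "p m i \<in> {s..t}" if "i \<le> Suc m" for m i
    unfolding p_def using st that by (intro grid_mem) auto
  have p0: "0 \<le> p m i" "s \<le> p m i" if "i \<le> Suc m" for m i using p_mem[OF that] s by auto
  have ps: "partition_seq s t Suc p" unfolding p_def[abs_def] using st by (intro partition_seq_grid) simp
  have AM: "A \<in> sets M" using A subalgebra[OF s] by (auto simp: subalgebra_def)
  have hM: "h (p m i) \<in> borel_measurable M" "W (p m i) \<in> borel_measurable M" if "i \<le> Suc m" for m i
    using p0[OF that] h_adapted W_measurable measurable_F by auto
  have SM: "S m \<in> borel_measurable M" for m
    unfolding S_def
  proof (intro borel_measurable_sum)
    fix i assume i: "i \<in> {..<Suc m}"
    then have [measurable]: "h (p m i) \<in> borel_measurable M" "W (p m i) \<in> borel_measurable M" "W (p m (Suc i)) \<in> borel_measurable M"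
      using hM[of i m] hM[of "Suc i" m] by auto
    show "(\<lambda>\<omega>. h (p m i) \<omega> * (cis (a * (W (p m (Suc i)) \<omega> - W (p m i) \<omega>)) - of_real (q m))) \<in> borel_measurable M"
      by measurable
  qed
  have LM: "L t \<in> borel_measurable M" "L s \<in> borel_measurable M"
    using measurable_F[OF t0 L_adapted[OF t0]] measurable_F[OF s L_adapted[OF s]] by auto
  have term0: "integrable M (\<lambda>\<omega>. indicator A \<omega> * (h (p m i) \<omega> * (cis (a * (W (p m (Suc i)) \<omega> - W (p m i) \<omega>)) - of_real (q m)))) \<and>
     expectation (\<lambda>\<omega>. indicator A \<omega> * (h (p m i) \<omega> * (cis (a * (W (p m (Suc i)) \<omega> - W (p m i) \<omega>)) - of_real (q m)))) = 0"
    if i: "i < Suc m" for i m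
  proof -
    define Z where "Z \<omega> = indicator A \<omega> * h (p m i) \<omega>" for \<omega>
    have i': "i \<le> Suc m" "Suc i \<le> Suc m" using i by auto
    have "A \<in> sets (F (p m i))" using A subalgebra_mono[OF s p0(2)[OF i'(1)]] by (auto simp: subalgebra_def)
    then have Z: "Z \<in> borel_measurable (F (p m i))"
      unfolding Z_def using h_adapted[OF p0(1)[OF i'(1)]] by (intro borel_measurable_times) auto
    have Z1: "cmod (Z \<omega>) \<le> 1" if "\<omega> \<in> space M" for \<omega>
      using norm_h(1)[OF that p0(1)[OF i'(1)]] by (simp add: Z_def norm_mult split: split_indicator)
    have ZM[measurable]: "Z \<in> borel_measurable M" using measurable_F[OF p0(1)[OF i'(1)] Z] .
    note [measurable] = hM(2)[OF i'(1)] hM(2)[OF i'(2)]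
    have iZ: "integrable M Z" by (rule integrable_const_bound[where B=1]) (use Z1 in auto)
    have iZc: "integrable M (\<lambda>\<omega>. Z \<omega> * cis (a * (W (p m (Suc i)) \<omega> - W (p m i) \<omega>)))"
      by (rule integrable_const_bound[where B=1]) (use Z1 in \<open>auto simp: norm_mult\<close>)
    have lt: "p m i < p m (Suc i)" using pS \<delta>0 by simp
    have "expectation (\<lambda>\<omega>. Z \<omega> * cis (a * (W (p m (Suc i)) \<omega> - W (p m i) \<omega>))) = expectation Z * of_real (q m)"
      using W_char[OF p0(1)[OF i'(1)] lt Z Z1, of a] pS by (simp add: q_def)
    moreover have "(\<lambda>\<omega>. indicator A \<omega> * (h (p m i) \<omega> * (cis (a * (W (p m (Suc i)) \<omega> - W (p m i) \<omega>)) - of_real (q m))))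
        = (\<lambda>\<omega>. Z \<omega> * cis (a * (W (p m (Suc i)) \<omega> - W (p m i) \<omega>)) - Z \<omega> * of_real (q m))"
      by (simp add: Z_def algebra_simps)
    ultimately show ?thesis using iZ iZc by simp
  qed
  have S0: "integrable M (\<lambda>\<omega>. indicator A \<omega> * S m \<omega>)" "expectation (\<lambda>\<omega>. indicator A \<omega> * S m \<omega>) = 0" for m
  proof -
    have eq: "(\<lambda>\<omega>. indicator A \<omega> * S m \<omega>) = (\<lambda>\<omega>. \<Sum>i<Suc m. indicator A \<omega> *
        (h (p m i) \<omega> * (cis (a * (W (p m (Suc i)) \<omega> - W (p m i) \<omega>)) - of_real (q m))))"
      unfolding S_def sum_distrib_left ..
    show "integrable M (\<lambda>\<omega>. indicator A \<omega> * S m \<omega>)"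
      unfolding eq by (intro Bochner_Integration.integrable_sum) (use term0 in auto)
    show "expectation (\<lambda>\<omega>. indicator A \<omega> * S m \<omega>) = 0"
      unfolding eq by (subst Bochner_Integration.integral_sum) (use term0 in auto)
  qed
  \<comment> \<open>On each cell \<open>h\<close> changes by \<open>e\<close> at the right end times
    the increment of \<open>u\<close>, by the centered term in \<open>S m\<close>, and by
    \<open>(q m - 1) * h\<close> at the left end. As \<open>q m - 1\<close> is close to -a^2 / 2
    times the cell length, the last part produces the correction in \<open>drift\<close>.\<close>
  have R_eq: "R m \<omega> = (\<Sum>i<Suc m. e (p m (Suc i)) \<omega> * integral {p m i..p m (Suc i)} (\<lambda>s. cnj (e s \<omega>) * b (h s \<omega>)))
      + of_real (q m - 1) * (\<Sum>i<Suc m. h (p m i) \<omega>) - integral {s..t} (\<lambda>s. drift (h s \<omega>))"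
    if \<omega>: "\<omega> \<in> space M" for m \<omega>
  proof -
    have st': "s = p m 0" "t = p m (Suc m)" using grid_self[of "Suc m" s t] by (simp_all add: p_def)
    have "L t \<omega> - L s \<omega> = h t \<omega> - h s \<omega> - integral {s..t} (\<lambda>s. drift (h s \<omega>))"
      unfolding L_def using drift_integral_diff[OF \<omega> s, of t] st by (simp add: algebra_simps)
    also have "h t \<omega> - h s \<omega> = (\<Sum>i<Suc m. h (p m (Suc i)) \<omega> - h (p m i) \<omega>)"
      using sum_lessThan_telescope[of "\<lambda>i. h (p m i) \<omega>" "Suc m"] st' by simp
    also have "\<dots> = (\<Sum>i<Suc m. e (p m (Suc i)) \<omega> * integral {p m i..p m (Suc i)} (\<lambda>s. cnj (e s \<omega>) * b (h s \<omega>))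
        + (h (p m i) \<omega> * (cis (a * (W (p m (Suc i)) \<omega> - W (p m i) \<omega>)) - of_real (q m)) + of_real (q m - 1) * h (p m i) \<omega>))"
    proof (intro sum.cong refl)
      fix i assume "i \<in> {..<Suc m}"
      then have "integral {p m i..p m (Suc i)} (\<lambda>s. cnj (e s \<omega>) * b (h s \<omega>)) = u (p m (Suc i)) \<omega> - u (p m i) \<omega>"
        using u_diff[OF \<omega> p0(1)[of i m], of "p m (Suc i)"] pS \<delta>0[of m] by simp
      note I = this
      have hh: "h (p m (Suc i)) \<omega> = e (p m i) \<omega> * cis (a * (W (p m (Suc i)) \<omega> - W (p m i) \<omega>)) * u (p m (Suc i)) \<omega>"
        "h (p m i) \<omega> = e (p m i) \<omega> * u (p m i) \<omega>"
        using e_step[of "p m (Suc i)" \<omega> "p m i"] by (simp_all add: h_def)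
      show "h (p m (Suc i)) \<omega> - h (p m i) \<omega> = e (p m (Suc i)) \<omega> * integral {p m i..p m (Suc i)} (\<lambda>s. cnj (e s \<omega>) * b (h s \<omega>))
        + (h (p m i) \<omega> * (cis (a * (W (p m (Suc i)) \<omega> - W (p m i) \<omega>)) - of_real (q m)) + of_real (q m - 1) * h (p m i) \<omega>)"
        unfolding I hh e_step[of "p m (Suc i)" \<omega> "p m i"] by (simp only: algebra_simps of_real_diff of_real_1 mult_1)
    qed
    finally show ?thesis by (simp only: R_def S_def sum.distrib sum_distrib_left) simp
  qed
  have q_bd: "\<bar>q m - 1\<bar> \<le> a\<^sup>2 / 2 * \<delta> m" for m
  proof -
    have "1 + (- (a\<^sup>2 * \<delta> m / 2)) \<le> q m" unfolding q_def by (rule exp_ge_add_one_self)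
    moreover have "q m \<le> 1" using \<delta>0[of m] by (simp add: q_def)
    ultimately show ?thesis by (simp add: abs_if)
  qed
  have sum_\<delta>: "real (Suc m) * \<delta> m = t - s" for m by (simp add: \<delta>_def)
  \<comment> \<open>Independent of \<open>m\<close>, as dominated convergence requires.\<close>
  have R_bd: "cmod (R m \<omega>) \<le> (4 * K + a\<^sup>2) * (t - s)" if \<omega>: "\<omega> \<in> space M" for m \<omega>
  proof -
    have 1: "cmod (\<Sum>i<Suc m. e (p m (Suc i)) \<omega> * integral {p m i..p m (Suc i)} (\<lambda>s. cnj (e s \<omega>) * b (h s \<omega>))) \<le> 2 * K * (t - s)"
    proof -
      have "cmod (\<Sum>i<Suc m. e (p m (Suc i)) \<omega> * integral {p m i..p m (Suc i)} (\<lambda>s. cnj (e s \<omega>) * b (h s \<omega>)))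
          \<le> (\<Sum>i<Suc m. 2 * K * \<delta> m)"
      proof (rule sum_norm_le)
        fix i assume "i \<in> {..<Suc m}"
        then have "cmod (u (p m (Suc i)) \<omega> - u (p m i) \<omega>) \<le> 2 * K * (p m (Suc i) - p m i)"
          and "integral {p m i..p m (Suc i)} (\<lambda>s. cnj (e s \<omega>) * b (h s \<omega>)) = u (p m (Suc i)) \<omega> - u (p m i) \<omega>"
          using u_diff[OF \<omega> p0(1)[of i m], of "p m (Suc i)"] u_lipschitz[OF \<omega> p0(1)[of i m], of "p m (Suc i)"] pS \<delta>0[of m]
          by simp_all
        then show "cmod (e (p m (Suc i)) \<omega> * integral {p m i..p m (Suc i)} (\<lambda>s. cnj (e s \<omega>) * b (h s \<omega>))) \<le> 2 * K * \<delta> m"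
          by (simp add: norm_mult pS)
      qed
      also have "\<dots> = 2 * K * (t - s)" using sum_\<delta>[of m] by (simp del: of_nat_Suc)
      finally show ?thesis .
    qed
    have 2: "cmod (of_real (q m - 1) * (\<Sum>i<Suc m. h (p m i) \<omega>)) \<le> a\<^sup>2 / 2 * (t - s)"
    proof -
      have "cmod (\<Sum>i<Suc m. h (p m i) \<omega>) \<le> (\<Sum>i<Suc m. 1)"
        using p0(1)[of _ m] by (intro sum_norm_le norm_h[OF \<omega>]) auto
      then have "\<bar>q m - 1\<bar> * cmod (\<Sum>i<Suc m. h (p m i) \<omega>) \<le> (a\<^sup>2 / 2 * \<delta> m) * real (Suc m)"
        using q_bd[of m] \<delta>0[of m] by (intro mult_mono) auto
      also have "\<dots> = a\<^sup>2 / 2 * (t - s)" using sum_\<delta>[of m] by (simp only: mult.assoc mult.commute[of "\<delta> m"])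
      finally show ?thesis by (simp only: norm_mult norm_of_real)
    qed
    have "cmod (R m \<omega>) \<le> 2 * K * (t - s) + a\<^sup>2 / 2 * (t - s) + (2 * K + a\<^sup>2 / 2) * (t - s)"
      unfolding R_eq[OF \<omega>] using 1 2 norm_drift_integral[OF \<omega> s, of t] st
      by (intro order_trans[OF norm_triangle_ineq4] add_mono order_trans[OF norm_triangle_ineq]) auto
    then show ?thesis by (simp add: algebra_simps)
  qed
  have R_lim: "(\<lambda>m. R m \<omega>) \<longlonglongrightarrow> 0" if \<omega>: "\<omega> \<in> space M" for \<omega>
  proof -
    have 1: "(\<lambda>m. \<Sum>i<Suc m. e (p m (Suc i)) \<omega> * integral {p m i..p m (Suc i)} (\<lambda>s. cnj (e s \<omega>) * b (h s \<omega>)))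
        \<longlonglongrightarrow> integral {s..t} (\<lambda>s. e s \<omega> * (cnj (e s \<omega>) * b (h s \<omega>)))"
    proof (rule weighted_riemann_tendsto[OF ps])
      show "continuous_on {s..t} (\<lambda>s. cnj (e s \<omega>) * b (h s \<omega>))" by (rule cnj_e_continuous[OF \<omega> s])
      show ce: "continuous_on {s..t} (\<lambda>s. e s \<omega>)" by (rule e_continuous'[OF \<omega> s])
      fix \<epsilon> :: real assume "\<epsilon> > 0"
      from partition_seq_osc[OF ps ce this]
      show "\<forall>\<^sub>F m in sequentially. \<forall>i<Suc m. \<forall>r\<in>{p m i..p m (Suc i)}. cmod (e (p m (Suc i)) \<omega> - e r \<omega>) \<le> \<epsilon>"
        by eventually_elim (use pS \<delta>0 in \<open>auto simp: dist_norm intro!: less_imp_le\<close>)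
    qed
    have 2: "(\<lambda>m. \<Sum>i<Suc m. h (p m i) \<omega> * of_real (\<delta> m)) \<longlonglongrightarrow> integral {s..t} (\<lambda>s. h s \<omega>)"
      unfolding p_def \<delta>_def using st by (intro left_riemann_tendsto h_continuous'[OF \<omega> s]) simp
    have 3: "(\<lambda>m. (q m - 1) / \<delta> m) \<longlonglongrightarrow> - (a\<^sup>2 / 2)"
    proof -
      define x where "x m = - (a\<^sup>2 * \<delta> m / 2)" for m
      have x0: "x m \<noteq> 0" for m using \<delta>0[of m] a by (simp add: x_def)
      have "\<delta> \<longlonglongrightarrow> 0" unfolding \<delta>_def by (rule LIMSEQ_Suc[OF lim_const_over_n])
      then have "x \<longlonglongrightarrow> - (a\<^sup>2 * 0 / 2)" unfolding x_def by (intro tendsto_intros) auto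
      then have "filterlim x (at 0) sequentially" using x0 by (intro filterlim_atI) auto
      from filterlim_compose[OF lim_exp_minus_1 this] have "(\<lambda>m. (exp (x m) - 1) / x m) \<longlonglongrightarrow> 1" .
      from tendsto_mult[OF this tendsto_const, of "- (a\<^sup>2 / 2)"]
      have "(\<lambda>m. (exp (x m) - 1) / x m * - (a\<^sup>2 / 2)) \<longlonglongrightarrow> - (a\<^sup>2 / 2)" by simp
      moreover have "(exp (x m) - 1) / x m * - (a\<^sup>2 / 2) = (q m - 1) / \<delta> m" for m
        using \<delta>0[of m] a by (simp add: x_def q_def field_simps)
      ultimately show ?thesis by simp
    qed
    have "(\<lambda>m. of_real ((q m - 1) / \<delta> m) * (\<Sum>i<Suc m. h (p m i) \<omega> * of_real (\<delta> m)))
        \<longlonglongrightarrow> of_real (- (a\<^sup>2 / 2)) * integral {s..t} (\<lambda>s. h s \<omega>)"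
      by (intro tendsto_mult 2 tendsto_of_real 3)
    moreover have "of_real ((q m - 1) / \<delta> m) * (\<Sum>i<Suc m. h (p m i) \<omega> * of_real (\<delta> m))
        = of_real (q m - 1) * (\<Sum>i<Suc m. h (p m i) \<omega>)" for m
    proof -
      have "complex_of_real ((q m - 1) / \<delta> m) * of_real (\<delta> m) = of_real (q m - 1)"
        unfolding of_real_mult[symmetric] using \<delta>0[of m] by simp
      moreover have "x * (y * z) = (x * z) * y" for x y z :: complex by (simp add: mult_ac)
      ultimately show ?thesis unfolding sum_distrib_right[symmetric] by (simp only:)
    qed
    ultimately have 4: "(\<lambda>m. of_real (q m - 1) * (\<Sum>i<Suc m. h (p m i) \<omega>))
        \<longlonglongrightarrow> of_real (- (a\<^sup>2 / 2)) * integral {s..t} (\<lambda>s. h s \<omega>)" by (simp only:)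
    have "integral {s..t} (\<lambda>s. drift (h s \<omega>)) = integral {s..t} (\<lambda>s. b (h s \<omega>)) - of_real (a\<^sup>2 / 2) * integral {s..t} (\<lambda>s. h s \<omega>)"
      unfolding drift_def integral_mult_right[symmetric]
      by (intro integral_diff integrable_continuous_real continuous_intros h_continuous'[OF \<omega> s])
    then have z: "integral {s..t} (\<lambda>s. e s \<omega> * (cnj (e s \<omega>) * b (h s \<omega>)))
        + of_real (- (a\<^sup>2 / 2)) * integral {s..t} (\<lambda>s. h s \<omega>) - integral {s..t} (\<lambda>s. drift (h s \<omega>)) = 0"
      unfolding e_cnj by simp
    show ?thesis
      using tendsto_diff[OF tendsto_add[OF 1 4] tendsto_const[of "integral {s..t} (\<lambda>s. drift (h s \<omega>))"]]
      unfolding R_eq[OF \<omega>] z .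
  qed
  have RM: "R m \<in> borel_measurable M" for m unfolding R_def using SM LM by (intro borel_measurable_diff)
  \<comment> \<open>\<open>S m\<close> has mean 0 on \<open>A\<close>, so these expectations do not
    depend on \<open>m\<close>: they all equal that of the increment of \<open>L\<close>. A constant
    sequence tending to 0 is 0.\<close>
  have "(\<lambda>m. expectation (\<lambda>\<omega>. indicator A \<omega> * R m \<omega>)) \<longlonglongrightarrow> expectation (\<lambda>\<omega>. 0 :: complex)"
  proof (rule integral_dominated_convergence[where w = "\<lambda>_. (4 * K + a\<^sup>2) * (t - s)"])
    show "AE \<omega> in M. (\<lambda>m. indicator A \<omega> * R m \<omega>) \<longlonglongrightarrow> 0"
      by (intro AE_I2 tendsto_mult_right_zero R_lim)
    show "AE \<omega> in M. cmod (indicator A \<omega> * R m \<omega>) \<le> (4 * K + a\<^sup>2) * (t - s)" for m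
      using R_bd K st by (intro AE_I2) (auto simp: norm_mult split: split_indicator)
  qed (use RM AM in \<open>auto intro!: borel_measurable_times\<close>)
  moreover have "expectation (\<lambda>\<omega>. indicator A \<omega> * R m \<omega>) = expectation (\<lambda>\<omega>. indicator A \<omega> * (L t \<omega> - L s \<omega>))" for m
  proof -
    have "integrable M (\<lambda>\<omega>. indicator A \<omega> * R m \<omega>)"
      by (rule integrable_const_bound[where B = "(4 * K + a\<^sup>2) * (t - s)"])
        (use R_bd K st RM AM in \<open>auto simp: norm_mult split: split_indicator\<close>)
    then have "expectation (\<lambda>\<omega>. indicator A \<omega> * R m \<omega> + indicator A \<omega> * S m \<omega>) = expectation (\<lambda>\<omega>. indicator A \<omega> * R m \<omega>)"
      using S0[of m] by simp
    then show ?thesis by (simp add: R_def algebra_simps)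
  qed
  ultimately have "(\<lambda>m::nat. expectation (\<lambda>\<omega>. indicator A \<omega> * (L t \<omega> - L s \<omega>))) \<longlonglongrightarrow> 0" by simp
  then show ?thesis by (simp add: LIMSEQ_const_iff)
qed

end

lemma norm_midpoint_diff_le:
  fixes x y z :: complex
  assumes "cmod (x - z) \<le> r" "cmod (y - z) \<le> r"
  shows "cmod ((x + y) / 2 - z) \<le> r"
proof -
  have "(x + y) / 2 - z = ((x - z) + (y - z)) / 2" by (simp add: field_simps)
  then have "cmod ((x + y) / 2 - z) = cmod ((x - z) + (y - z)) / 2"
    by (simp only: norm_divide norm_numeral)
  then show ?thesis using norm_triangle_ineq[of "x - z" "y - z"] assms by linarith
qed

context disc_setup
begin

text \<open>\<open>\<phi>\<close> stands for the real or the imaginary part. The cutoff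
  \<open>c\<close> will be the minimum of a constant localizing time and the horizon, and the value
  at 0 is subtracted to match \<open>continuous_local_martingale\<close>.\<close>

lemma L_martingale:
  fixes \<phi> :: "complex \<Rightarrow> real"
  assumes \<phi>: "bounded_linear \<phi>" and \<phi>1: "\<And>z. \<bar>\<phi> z\<bar> \<le> cmod z" and c: "0 \<le> c"
  shows "martingale M F (\<lambda>t \<omega>. \<phi> (L (min t c) \<omega>) - \<phi> (L 0 \<omega>))"
proof -
  interpret \<phi>: bounded_linear \<phi> by (rule \<phi>)
  have \<phi>M: "\<phi> \<in> borel_measurable borel"
    by (rule borel_measurable_continuous_onI) (rule linear_continuous_on[OF \<phi>])
  have X_eq: "\<phi> (L (min t c) \<omega>) - \<phi> (L 0 \<omega>) = \<phi> (L (min t c) \<omega>)" if "\<omega> \<in> space M" for t \<omega>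
    using L_0[OF that] \<phi>.zero by simp
  have XF: "(\<lambda>\<omega>. \<phi> (L (min t c) \<omega>) - \<phi> (L 0 \<omega>)) \<in> borel_measurable (F t)" if "0 \<le> t" for t
  proof -
    have [measurable]: "L (min t c) \<in> borel_measurable (F t)" "L 0 \<in> borel_measurable (F t)"
      using that c measurable_F_mono[OF _ _ L_adapted, of "min t c" t] measurable_F_mono[OF _ _ L_adapted, of 0 t] by auto
    note [measurable] = \<phi>M
    show ?thesis by measurable
  qed
  have L_int: "integrable M (L t)" if "0 \<le> t" for t
    by (rule integrable_const_bound[where B = "2 + (2 * K + a\<^sup>2 / 2) * t"])
      (use norm_L that measurable_F[OF that L_adapted[OF that]] in auto)
  have Xi: "integrable M (\<lambda>\<omega>. \<phi> (L (min t c) \<omega>) - \<phi> (L 0 \<omega>))" if "0 \<le> t" for t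
    using L_int[of "min t c"] L_int[of 0] that c by (intro Bochner_Integration.integrable_diff integrable_bounded_linear[OF \<phi>]) auto
  show ?thesis
    unfolding martingale_def adapted_def
  proof (intro conjI allI impI XF Xi)
    fix s t :: real assume st: "0 \<le> s \<and> s \<le> t"
    interpret Fs: sigma_finite_subalgebra M "F s" by (rule sigma_finite_F) (use st in simp)
    show "AE \<omega> in M. real_cond_exp M (F s) (\<lambda>\<omega>. \<phi> (L (min t c) \<omega>) - \<phi> (L 0 \<omega>)) \<omega> = \<phi> (L (min s c) \<omega>) - \<phi> (L 0 \<omega>)"
    proof (rule Fs.real_cond_exp_charact)
      fix A assume A: "A \<in> sets (F s)"
      have AM[measurable]: "A \<in> sets M" using A subalgebra[of s] st by (auto simp: subalgebra_def)
      have "expectation (\<lambda>\<omega>. indicator A \<omega> * (L (min t c) \<omega> - L (min s c) \<omega>)) = 0"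
      proof (cases "s < min t c")
        case True
        then have "min s c = s" by simp
        then show ?thesis using L_increment_zero[OF _ True A] st by simp
      next
        case False
        then have "min t c = min s c" using st by (auto simp: min_def)
        then show ?thesis by simp
      qed
      moreover have "integrable M (\<lambda>\<omega>. indicator A \<omega> * (L (min t c) \<omega> - L (min s c) \<omega>))"
      proof (rule integrable_const_bound[where B = "(2 + (2 * K + a\<^sup>2 / 2) * min t c) + (2 + (2 * K + a\<^sup>2 / 2) * min s c)"])
        show "AE \<omega> in M. cmod (indicator A \<omega> * (L (min t c) \<omega> - L (min s c) \<omega>))
            \<le> (2 + (2 * K + a\<^sup>2 / 2) * min t c) + (2 + (2 * K + a\<^sup>2 / 2) * min s c)"
        proof (rule AE_I2)
          fix \<omega> assume \<omega>: "\<omega> \<in> space M"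
          have "cmod (indicator A \<omega> * (L (min t c) \<omega> - L (min s c) \<omega>)) \<le> cmod (L (min t c) \<omega> - L (min s c) \<omega>)"
            by (simp add: norm_mult split: split_indicator)
          also have "\<dots> \<le> cmod (L (min t c) \<omega>) + cmod (L (min s c) \<omega>)" by (rule norm_triangle_ineq4)
          also have "\<dots> \<le> (2 + (2 * K + a\<^sup>2 / 2) * min t c) + (2 + (2 * K + a\<^sup>2 / 2) * min s c)"
            using st c by (intro add_mono norm_L[OF \<omega>]) auto
          finally show "cmod (indicator A \<omega> * (L (min t c) \<omega> - L (min s c) \<omega>))
            \<le> (2 + (2 * K + a\<^sup>2 / 2) * min t c) + (2 + (2 * K + a\<^sup>2 / 2) * min s c)" .
        qed
        show "(\<lambda>\<omega>. indicator A \<omega> * (L (min t c) \<omega> - L (min s c) \<omega>)) \<in> borel_measurable M"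
          using borel_measurable_integrable[OF L_int[of "min t c"]] borel_measurable_integrable[OF L_int[of "min s c"]] st c
          by (intro borel_measurable_times borel_measurable_diff) auto
      qed
      ultimately have "expectation (\<lambda>\<omega>. \<phi> (indicator A \<omega> * (L (min t c) \<omega> - L (min s c) \<omega>))) = 0"
        using integral_bounded_linear[OF \<phi>] \<phi>.zero by metis
      moreover have "\<phi> (indicator A \<omega> * (L (min t c) \<omega> - L (min s c) \<omega>))
          = indicator A \<omega> * (\<phi> (L (min t c) \<omega>) - \<phi> (L 0 \<omega>)) - indicator A \<omega> * (\<phi> (L (min s c) \<omega>) - \<phi> (L 0 \<omega>))" for \<omega>
        by (simp add: \<phi>.diff \<phi>.zero split: split_indicator)
      moreover have "integrable M (\<lambda>\<omega>. indicator A \<omega> * (\<phi> (L (min r c) \<omega>) - \<phi> (L 0 \<omega>)))" if "0 \<le> r" for r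
        by (rule integrable_bounded_mult[OF Xi[OF that], where C = 1]) (auto split: split_indicator)
      ultimately show "set_lebesgue_integral M A (\<lambda>\<omega>. \<phi> (L (min t c) \<omega>) - \<phi> (L 0 \<omega>))
          = set_lebesgue_integral M A (\<lambda>\<omega>. \<phi> (L (min s c) \<omega>) - \<phi> (L 0 \<omega>))"
        using st by (simp add: set_lebesgue_integral_def)
    qed (use st Xi XF in auto)
  qed
qed

lemma L_continuous: "\<omega> \<in> space M \<Longrightarrow> continuous_on {0..T} (\<lambda>t. L t \<omega>)"
  unfolding L_def
  by (intro continuous_intros h_continuous indefinite_integral_continuous_1 integrable_continuous_real drift_continuous) auto

lemma continuous_on_stopped:
  fixes f :: "real \<Rightarrow> 'b::topological_space"
  assumes "continuous_on {0..T} f" "0 \<le> T"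
  shows "continuous_on {0..} (\<lambda>t. f (min t T))"
  by (rule continuous_on_compose2[OF assms(1)]) (use assms(2) in \<open>auto intro!: continuous_intros\<close>)

text \<open>Decomposition into \<open>L\<close> and \<open>A\<close>, the initial value plus the
  drift integral. \<open>A\<close> is Lipschitz in time, so its variation up to \<open>t\<close> is
  at most a constant times \<open>t\<close>.\<close>

lemma h_semimartingale:
  fixes \<phi> :: "complex \<Rightarrow> real"
  assumes \<phi>: "bounded_linear \<phi>" and \<phi>1: "\<And>z. \<bar>\<phi> z\<bar> \<le> cmod z" and T: "0 < T"
  shows "continuous_semimartingale M F (\<lambda>t \<omega>. \<phi> (h (min t T) \<omega>))"
proof -
  interpret \<phi>: bounded_linear \<phi> by (rule \<phi>)
  have \<phi>M: "\<phi> \<in> borel_measurable borel"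
    by (rule borel_measurable_continuous_onI) (rule linear_continuous_on[OF \<phi>])
  have stopped: "(\<lambda>\<omega>. \<phi> (X (min t T) \<omega>)) \<in> borel_measurable (F t)"
    if "0 \<le> t" and X: "\<And>t. 0 \<le> t \<Longrightarrow> X t \<in> borel_measurable (F t)" for t and X :: "real \<Rightarrow> 'a \<Rightarrow> complex"
  proof -
    have "X (min t T) \<in> borel_measurable (F t)"
      using measurable_F_mono[OF _ _ X, of "min t T" t] that(1) T by auto
    from measurable_compose[OF this \<phi>M] show ?thesis .
  qed
  have cont: "ae_continuous M (\<lambda>t \<omega>. \<phi> (X (min t T) \<omega>))"
    if "\<And>\<omega>. \<omega> \<in> space M \<Longrightarrow> continuous_on {0..T} (\<lambda>t. X t \<omega>)" for X :: "real \<Rightarrow> 'a \<Rightarrow> complex"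
    unfolding ae_continuous_def
  proof (rule AE_I2)
    fix \<omega> assume "\<omega> \<in> space M"
    then have "continuous_on {0..T} (\<lambda>t. \<phi> (X t \<omega>))" by (intro \<phi>.continuous_on that)
    from continuous_on_stopped[OF this] T show "continuous_on {0..} (\<lambda>t. \<phi> (X (min t T) \<omega>))" by simp
  qed
  define A where "A t \<omega> = \<xi> \<omega> + integral {0..t} (\<lambda>s. drift (h s \<omega>))" for t \<omega>
  have AF: "A t \<in> borel_measurable (F t)" if "0 \<le> t" for t
    unfolding A_def using that by (intro borel_measurable_add \<xi>_adapted drift_integral_adapted)
  have A_cont: "continuous_on {0..T} (\<lambda>t. A t \<omega>)" if "\<omega> \<in> space M" for \<omega>
    unfolding A_def using that
    by (intro continuous_intros indefinite_integral_continuous_1 integrable_continuous_real drift_continuous) auto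
  have lm: "continuous_local_martingale M F (\<lambda>t \<omega>. \<phi> (L (min t T) \<omega>))"
    unfolding continuous_local_martingale_def
  \<comment> \<open>\<open>L\<close> is bounded on bounded time intervals, so constant times
    localize it.\<close>
  proof (intro conjI exI[of _ "\<lambda>n _. real n"] allI ballI)
    show "adapted F (\<lambda>t \<omega>. \<phi> (L (min t T) \<omega>))"
      unfolding adapted_def using stopped[of _ L] L_adapted by auto
    show "ae_continuous M (\<lambda>t \<omega>. \<phi> (L (min t T) \<omega>))" by (intro cont L_continuous)
    show "stopping_time (\<lambda>t. F (max 0 t)) (\<lambda>_. real n)" for n by (rule stopping_time_const)
    show "AE \<omega> in M. incseq real \<and> filterlim real at_top sequentially"
      by (auto simp: incseq_def filterlim_real_sequentially)
    have "martingale M F (\<lambda>t \<omega>. \<phi> (L (min t (min (real n) T)) \<omega>) - \<phi> (L 0 \<omega>))" for n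
      using T by (intro L_martingale[OF \<phi> \<phi>1]) auto
    then show "martingale M F (\<lambda>t \<omega>. \<phi> (L (min (min t (real n)) T) \<omega>) - \<phi> (L (min 0 T) \<omega>))" for n
      using T by (simp add: min.assoc)
  qed simp
  show ?thesis
    unfolding continuous_semimartingale_def
  proof (rule conjI, goal_cases)
    case 1
    show "adapted F (\<lambda>t \<omega>. \<phi> (h (min t T) \<omega>))"
      unfolding adapted_def using stopped[of _ h] h_adapted by auto
  next
    case 2
    show ?case
    proof (rule exI[of _ "\<lambda>t \<omega>. \<phi> (L (min t T) \<omega>)"], rule exI[of _ "\<lambda>t \<omega>. \<phi> (A (min t T) \<omega>)"], intro conjI lm)
    show "adapted F (\<lambda>t \<omega>. \<phi> (A (min t T) \<omega>))"
      unfolding adapted_def using stopped[of _ A] AF by auto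
    show "ae_continuous M (\<lambda>t \<omega>. \<phi> (A (min t T) \<omega>))" by (intro cont A_cont)
    show "AE \<omega> in M. \<forall>t\<ge>0. \<phi> (h (min t T) \<omega>) = \<phi> (L (min t T) \<omega>) + \<phi> (A (min t T) \<omega>)"
      by (simp add: L_def A_def \<phi>.add[symmetric])
    show "AE \<omega> in M. locally_bounded_variation (\<lambda>t. \<phi> (A (min t T) \<omega>))"
    proof (rule AE_I2)
      fix \<omega> assume \<omega>: "\<omega> \<in> space M"
      let ?C = "2 * K + a\<^sup>2 / 2"
      have lip: "\<bar>\<phi> (A (min t T) \<omega>) - \<phi> (A (min s T) \<omega>)\<bar> \<le> ?C * (t - s)" if "0 \<le> s" "s \<le> t" for s t
      proof -
        have "A (min t T) \<omega> - A (min s T) \<omega> = integral {min s T..min t T} (\<lambda>s. drift (h s \<omega>))"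
          unfolding A_def using drift_integral_diff[OF \<omega>, of "min s T" "min t T"] that T by auto
        then have "cmod (A (min t T) \<omega> - A (min s T) \<omega>) \<le> ?C * (min t T - min s T)"
          using norm_drift_integral[OF \<omega>, of "min s T" "min t T"] that T by auto
        also have "\<dots> \<le> ?C * (t - s)" using that K by (intro mult_left_mono) auto
        finally show ?thesis using \<phi>1[of "A (min t T) \<omega> - A (min s T) \<omega>"] by (simp add: \<phi>.diff)
      qed
      show "locally_bounded_variation (\<lambda>t. \<phi> (A (min t T) \<omega>))"
        unfolding locally_bounded_variation_def
      proof (intro allI impI exI[of _ "?C * _"])
        fix t :: real and n p assume "0 \<le> t" and p: "subdivision t n p"
        have "(\<Sum>i<n. \<bar>\<phi> (A (min (p (Suc i)) T) \<omega>) - \<phi> (A (min (p i) T) \<omega>)\<bar>) \<le> (\<Sum>i<n. ?C * (p (Suc i) - p i))"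
        proof (intro sum_mono lip)
          fix i assume i: "i \<in> {..<n}"
          show "0 \<le> p i" using p i partition_mono[of n p 0 i] by (auto simp: subdivision_def)
          show "p i \<le> p (Suc i)" using p i by (auto simp: subdivision_def)
        qed
        also have "\<dots> = ?C * t"
          using p sum_lessThan_telescope[of p n] by (simp add: sum_distrib_left[symmetric] subdivision_def)
        finally show "(\<Sum>i<n. \<bar>\<phi> (A (min (p (Suc i)) T) \<omega>) - \<phi> (A (min (p i) T) \<omega>)\<bar>) \<le> ?C * t" .
      qed
    qed
    qed
  qed
qed

section \<open>The Stratonovich integral of the candidate\<close>

definition \<sigma> :: "complex \<Rightarrow> complex" where "\<sigma> z = \<i> * of_real a * z"

text \<open>The value that the equation forces on the integral. What has to be proved is that the
  trapezoidal sums converge to it.\<close>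

definition J :: "real \<Rightarrow> 'a \<Rightarrow> complex" where
  "J t \<omega> = h t \<omega> - \<xi> \<omega> - integral {0..t} (\<lambda>s. b (h s \<omega>))"

lemma b_integral_adapted: "0 \<le> t \<Longrightarrow> (\<lambda>\<omega>. integral {0..t} (\<lambda>s. b (h s \<omega>))) \<in> borel_measurable (F t)"
proof (rule adapted_integral)
  fix s assume "s \<in> {0..t}"
  then have [measurable]: "h s \<in> borel_measurable (F s)" by (intro h_adapted) auto
  show "(\<lambda>\<omega>. b (h s \<omega>)) \<in> borel_measurable (F s)" by measurable
qed (auto intro!: continuous_intros h_continuous)

lemma J_measurable: "0 \<le> t \<Longrightarrow> J t \<in> borel_measurable M"
  by (rule measurable_F, assumption)
    (unfold J_def, intro borel_measurable_diff h_adapted \<xi>_adapted b_integral_adapted)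

lemma cis_increment_trapezoid:
  "cmod (e t \<omega> - e s \<omega> - \<i> * of_real a * ((e s \<omega> + e t \<omega>) / 2) * of_real (W t \<omega> - W s \<omega>)) \<le> a ^ 3 * \<bar>W t \<omega> - W s \<omega>\<bar> ^ 3"
proof -
  let ?x = "a * (W t \<omega> - W s \<omega>)"
  have "e t \<omega> - e s \<omega> - \<i> * of_real a * ((e s \<omega> + e t \<omega>) / 2) * of_real (W t \<omega> - W s \<omega>)
      = e s \<omega> * (cis ?x - 1 - \<i> * of_real ?x * ((1 + cis ?x) / 2))"
    unfolding e_step[of t \<omega> s] by (simp add: field_simps)
  then have "cmod (e t \<omega> - e s \<omega> - \<i> * of_real a * ((e s \<omega> + e t \<omega>) / 2) * of_real (W t \<omega> - W s \<omega>)) \<le> \<bar>?x\<bar> ^ 3"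
    using cis_trapezoid[of ?x] by (simp only: norm_mult norm_e mult_1)
  then show ?thesis using a by (simp add: abs_mult power_mult_distrib)
qed

lemma norm_e_increment: "cmod (e t \<omega> - e s \<omega>) \<le> 2"
  using norm_triangle_ineq4[of "e t \<omega>" "e s \<omega>"] by simp

text \<open>Product rule with means: the increment of \<open>h = e u\<close> is the mean of
  \<open>e\<close> times du plus the mean of \<open>u\<close> times de. Replacing de by its
  trapezoidal approximation costs cubic terms, and the du part is a Riemann sum for the integral of
  \<open>b (h s)\<close>.\<close>

lemma stratonovich_sum_null:
  assumes p: "partition_seq 0 t N p"
  shows "prob_null (\<lambda>m \<omega>. stratonovich_sum (\<lambda>s \<omega>. \<sigma> (h s \<omega>)) W (N m) (p m) \<omega> - J t \<omega>)"
proof -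
  have t0: "0 \<le> t" using partition_seq_le[OF p] .
  have pm: "p m 0 = 0" "p m (N m) = t" for m using p by (auto simp: partition_seq_def)
  have pi: "p m i \<le> p m (Suc i)" "0 \<le> p m i" "0 \<le> p m (Suc i)" if "i < N m" for m i
  proof -
    show le: "p m i \<le> p m (Suc i)" using p that by (auto simp: partition_seq_def)
    then show "0 \<le> p m i" using partition_seq_mem[OF p that, of "p m i"] by auto
    with le show "0 \<le> p m (Suc i)" by simp
  qed
  let ?dW = "\<lambda>m i \<omega>. W (p m (Suc i)) \<omega> - W (p m i) \<omega>"
  let ?eh = "\<lambda>m i \<omega>. (e (p m i) \<omega> + e (p m (Suc i)) \<omega>) / 2"
  let ?uh = "\<lambda>m i \<omega>. (u (p m i) \<omega> + u (p m (Suc i)) \<omega>) / 2"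
  let ?de = "\<lambda>m i \<omega>. e (p m (Suc i)) \<omega> - e (p m i) \<omega>"
  let ?du = "\<lambda>m i \<omega>. u (p m (Suc i)) \<omega> - u (p m i) \<omega>"
  \<comment> \<open>The cubic errors, which vanish only in probability; what remains in
    \<open>Q\<close> is shown to vanish on every path.\<close>
  define P where "P m \<omega> = (\<Sum>i<N m. - (?uh m i \<omega> * (?de m i \<omega> - \<i> * of_real a * ?eh m i \<omega> * of_real (?dW m i \<omega>))))" for m \<omega>
  define Q where "Q m \<omega> = stratonovich_sum (\<lambda>s \<omega>. \<sigma> (h s \<omega>)) W (N m) (p m) \<omega> - J t \<omega> - P m \<omega>" for m \<omega>
  have meas: "e (p m i) \<in> borel_measurable M" "u (p m i) \<in> borel_measurable M" "W (p m i) \<in> borel_measurable M"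
    "h (p m i) \<in> borel_measurable M" if "i \<le> N m" for m i
  proof -
    have "0 \<le> p m i" using partition_mono[of "N m" "p m" 0 i] that p by (auto simp: partition_seq_def)
    note 0 = measurable_F[OF this] this
    show "e (p m i) \<in> borel_measurable M" "u (p m i) \<in> borel_measurable M" "W (p m i) \<in> borel_measurable M"
      "h (p m i) \<in> borel_measurable M"
      by (intro 0 e_adapted u_adapted W_adapted h_adapted)+
  qed
  have PM: "P m \<in> borel_measurable M" for m
    unfolding P_def
  proof (rule borel_measurable_sum)
    fix i assume "i \<in> {..<N m}"
    then have "i \<le> N m" "Suc i \<le> N m" by auto
    note [measurable] = meas[OF this(1)] meas[OF this(2)]
    show "(\<lambda>\<omega>. - (?uh m i \<omega> * (?de m i \<omega> - \<i> * of_real a * ?eh m i \<omega> * of_real (?dW m i \<omega>)))) \<in> borel_measurable M"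
      by measurable
  qed
  have SM: "(\<lambda>\<omega>. stratonovich_sum (\<lambda>s \<omega>. \<sigma> (h s \<omega>)) W (N m) (p m) \<omega>) \<in> borel_measurable M" for m
    unfolding stratonovich_sum_def \<sigma>_def
  proof (rule borel_measurable_sum)
    fix i assume "i \<in> {..<N m}"
    then have "i \<le> N m" "Suc i \<le> N m" by auto
    note [measurable] = meas[OF this(1)] meas[OF this(2)]
    show "(\<lambda>\<omega>. (\<i> * of_real a * h (p m i) \<omega> + \<i> * of_real a * h (p m (Suc i)) \<omega>) / 2 * of_real (?dW m i \<omega>)) \<in> borel_measurable M"
      by measurable
  qed
  have P: "prob_null P"
  proof (rule prob_null_cube_sum[OF p PM])
    fix m \<omega> assume \<omega>: "\<omega> \<in> space M"
    show "cmod (P m \<omega>) \<le> a ^ 3 * (\<Sum>i<N m. \<bar>?dW m i \<omega>\<bar> ^ 3)"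
      unfolding P_def sum_distrib_left
    proof (rule sum_norm_le)
      fix i assume i: "i \<in> {..<N m}"
      have "cmod (u (p m i) \<omega>) \<le> 1" "cmod (u (p m (Suc i)) \<omega>) \<le> 1"
        using i by (auto intro!: norm_u[OF \<omega>] pi)
      then have "cmod (?uh m i \<omega>) \<le> 1"
        using norm_triangle_ineq[of "u (p m i) \<omega>" "u (p m (Suc i)) \<omega>"] by (simp add: norm_divide)
      then have "cmod (?uh m i \<omega>) * cmod (?de m i \<omega> - \<i> * of_real a * ?eh m i \<omega> * of_real (?dW m i \<omega>)) \<le> 1 * (a ^ 3 * \<bar>?dW m i \<omega>\<bar> ^ 3)"
        by (intro mult_mono cis_increment_trapezoid) auto
      then show "cmod (- (?uh m i \<omega> * (?de m i \<omega> - \<i> * of_real a * ?eh m i \<omega> * of_real (?dW m i \<omega>)))) \<le> a ^ 3 * \<bar>?dW m i \<omega>\<bar> ^ 3"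
        by (simp only: norm_mult norm_minus_cancel mult_1)
    qed
  qed (use a in simp)
  have Q: "prob_null Q"
  proof (rule prob_null_AE)
    show "Q m \<in> borel_measurable M" for m
      unfolding Q_def using PM SM J_measurable[OF t0] by (intro borel_measurable_diff)
    show "AE \<omega> in M. (\<lambda>m. Q m \<omega>) \<longlonglongrightarrow> 0"
    proof (rule AE_I2)
      fix \<omega> assume \<omega>: "\<omega> \<in> space M"
      let ?f = "\<lambda>s. cnj (e s \<omega>) * b (h s \<omega>)"
      \<comment> \<open>The mean of a product exceeds the product of the means by
        \<open>de * du / 4\<close>. This third order term appears because the sum averages
        \<open>h\<close> itself and not its factors.\<close>
      define R where "R m = (\<Sum>i<N m. \<i> * of_real a / 4 * ?de m i \<omega> * ?du m i \<omega> * of_real (?dW m i \<omega>))" for m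
      have Q_eq: "Q m \<omega> = R m - ((\<Sum>i<N m. ?eh m i \<omega> * integral {p m i..p m (Suc i)} ?f) - integral {0..t} (\<lambda>s. b (h s \<omega>)))" for m
      proof -
        have "h t \<omega> - \<xi> \<omega> = (\<Sum>i<N m. h (p m (Suc i)) \<omega> - h (p m i) \<omega>)"
          using sum_lessThan_telescope[of "\<lambda>i. h (p m i) \<omega>" "N m"] pm[of m] \<omega> by (simp add: h_def u_0 e_def W_0)
        moreover have "(\<Sum>i<N m. ?eh m i \<omega> * integral {p m i..p m (Suc i)} ?f) = (\<Sum>i<N m. ?eh m i \<omega> * ?du m i \<omega>)"
          using pi u_diff[OF \<omega>] by (intro sum.cong refl) auto
        moreover have "(\<Sum>i<N m. (\<sigma> (h (p m i) \<omega>) + \<sigma> (h (p m (Suc i)) \<omega>)) / 2 * of_real (?dW m i \<omega>))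
            - (\<Sum>i<N m. h (p m (Suc i)) \<omega> - h (p m i) \<omega>) - P m \<omega> = R m - (\<Sum>i<N m. ?eh m i \<omega> * ?du m i \<omega>)"
          unfolding P_def R_def sum_subtractf[symmetric]
          by (intro sum.cong refl) (simp add: \<sigma>_def h_def field_simps)
        ultimately show ?thesis unfolding Q_def J_def stratonovich_sum_def by (simp add: algebra_simps)
      qed
      have "continuous_on {0..t} (\<lambda>s. W s \<omega>)"
        using W_continuous[OF \<omega>] by (rule continuous_on_subset) auto
      note oscW = partition_seq_osc[OF p this]
      have R: "R \<longlonglongrightarrow> 0"
      proof (rule tendstoI)
        fix \<epsilon> :: real assume "\<epsilon> > 0"
        define \<eta> where "\<eta> = \<epsilon> / (a * K * (t + 1))"
        have "\<eta> > 0" using \<open>\<epsilon> > 0\<close> a K t0 by (auto simp: \<eta>_def intro!: divide_pos_pos mult_pos_pos)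
        from oscW[OF this] show "\<forall>\<^sub>F m in sequentially. dist (R m) 0 < \<epsilon>"
        proof eventually_elim
          case (elim m)
          have "cmod (R m) \<le> (\<Sum>i<N m. a * K * \<eta> * (p m (Suc i) - p m i))"
            unfolding R_def
          proof (rule sum_norm_le)
            fix i assume i: "i \<in> {..<N m}"
            have w: "\<bar>?dW m i \<omega>\<bar> \<le> \<eta>"
              using elim pi(1)[of i m] i by (auto simp: dist_real_def less_imp_le)
            have "cmod (\<i> * of_real a / 4 * ?de m i \<omega> * ?du m i \<omega> * of_real (?dW m i \<omega>))
                = a / 4 * cmod (?de m i \<omega>) * cmod (?du m i \<omega>) * \<bar>?dW m i \<omega>\<bar>"
              using a by (simp add: norm_mult norm_divide del: of_real_diff)
            also have "\<dots> \<le> a / 4 * 2 * (2 * K * (p m (Suc i) - p m i)) * \<eta>"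
              using a K pi[of i m] i w by (intro mult_mono norm_e_increment u_lipschitz[OF \<omega>]) auto
            finally show "cmod (\<i> * of_real a / 4 * ?de m i \<omega> * ?du m i \<omega> * of_real (?dW m i \<omega>)) \<le> a * K * \<eta> * (p m (Suc i) - p m i)"
              by (simp add: mult_ac)
          qed
          also have "\<dots> = a * K * \<eta> * t"
            using sum_lessThan_telescope[of "p m" "N m"] pm[of m] by (simp add: sum_distrib_left[symmetric])
          also have "\<dots> < a * K * \<eta> * (t + 1)" using a K \<open>\<eta> > 0\<close> by (intro mult_strict_left_mono) auto
          also have "\<dots> = \<epsilon>" using a K t0 by (simp add: \<eta>_def)
          finally show ?case by simp
        qed
      qed
      have ce: "continuous_on {0..t} (\<lambda>s. e s \<omega>)" by (rule e_continuous'[OF \<omega>]) simp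
      have "(\<lambda>m. \<Sum>i<N m. ?eh m i \<omega> * integral {p m i..p m (Suc i)} ?f) \<longlonglongrightarrow> integral {0..t} (\<lambda>s. e s \<omega> * ?f s)"
      proof (rule weighted_riemann_tendsto[OF p cnj_e_continuous[OF \<omega> order_refl] ce])
        fix \<epsilon> :: real assume "\<epsilon> > 0"
        from partition_seq_osc[OF p ce this]
        show "\<forall>\<^sub>F m in sequentially. \<forall>i<N m. \<forall>s\<in>{p m i..p m (Suc i)}. cmod (?eh m i \<omega> - e s \<omega>) \<le> \<epsilon>"
        proof eventually_elim
          case (elim m)
          show ?case
          proof (intro allI impI ballI)
            fix i s assume i: "i < N m" and s: "s \<in> {p m i..p m (Suc i)}"
            then have "cmod (e (p m i) \<omega> - e s \<omega>) < \<epsilon>" "cmod (e (p m (Suc i)) \<omega> - e s \<omega>) < \<epsilon>"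
              using elim pi(1)[OF i] by (auto simp: dist_norm)
            then show "cmod (?eh m i \<omega> - e s \<omega>) \<le> \<epsilon>"
              by (intro norm_midpoint_diff_le) auto
          qed
        qed
      qed
      then have "(\<lambda>m. \<Sum>i<N m. ?eh m i \<omega> * integral {p m i..p m (Suc i)} ?f) \<longlonglongrightarrow> integral {0..t} (\<lambda>s. b (h s \<omega>))"
        unfolding e_cnj .
      from tendsto_diff[OF R tendsto_diff[OF this tendsto_const[of "integral {0..t} (\<lambda>s. b (h s \<omega>))"]]]
      show "(\<lambda>m. Q m \<omega>) \<longlonglongrightarrow> 0" unfolding Q_eq by simp
    qed
  qed
  have "(\<lambda>m \<omega>. stratonovich_sum (\<lambda>s \<omega>. \<sigma> (h s \<omega>)) W (N m) (p m) \<omega> - J t \<omega>) = (\<lambda>m \<omega>. P m \<omega> + Q m \<omega>)"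
    by (simp add: Q_def)
  then show ?thesis using prob_null_add[OF P Q] by simp
qed

text \<open>The definition quantifies over all partitions of small mesh, the convergence was proved
  along sequences. If it failed, a bad partition of mesh below 1 / (m + 1) for each \<open>m\<close>
  would form a sequence contradicting it.\<close>

lemma h_stratonovich_integral:
  assumes "0 \<le> t"
  shows "has_stratonovich_integral M (\<lambda>s \<omega>. \<sigma> (h s \<omega>)) W t (J t)"
  unfolding has_stratonovich_integral_def
proof (intro conjI allI impI J_measurable assms)
  fix \<eta> \<epsilon> :: real assume "\<eta> > 0" "\<epsilon> > 0"
  let ?X = "\<lambda>n p \<omega>. stratonovich_sum (\<lambda>s \<omega>. \<sigma> (h s \<omega>)) W n p \<omega> - J t \<omega>"
  show "\<exists>\<delta>>0. \<forall>n p. subdivision t n p \<and> (\<forall>i<n. p (Suc i) - p i < \<delta>) \<longrightarrow> \<P>(\<omega> in M. cmod (?X n p \<omega>) > \<eta>) < \<epsilon>"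
  proof (rule ccontr)
    assume "\<not> ?thesis"
    then have "\<exists>n p. subdivision t n p \<and> (\<forall>i<n. p (Suc i) - p i < \<delta>) \<and> \<epsilon> \<le> \<P>(\<omega> in M. cmod (?X n p \<omega>) > \<eta>)" if "\<delta> > 0" for \<delta>
      using that by (meson not_less)
    then have "\<forall>m. \<exists>np. subdivision t (fst np) (snd np) \<and> (\<forall>i<fst np. snd np (Suc i) - snd np i < inverse (real (Suc m))) \<and>
        \<epsilon> \<le> \<P>(\<omega> in M. cmod (?X (fst np) (snd np) \<omega>) > \<eta>)"
      by simp
    from choice[OF this] obtain np where np: "\<forall>m. subdivision t (fst (np m)) (snd (np m)) \<and>
        (\<forall>i<fst (np m). snd (np m) (Suc i) - snd (np m) i < inverse (real (Suc m))) \<and>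
        \<epsilon> \<le> \<P>(\<omega> in M. cmod (?X (fst (np m)) (snd (np m)) \<omega>) > \<eta>)"
      by blast
    define N where "N m = fst (np m)" for m
    define p where "p m = snd (np m)" for m
    have Np: "subdivision t (N m) (p m)" "\<And>i. i < N m \<Longrightarrow> p m (Suc i) - p m i < inverse (real (Suc m))"
        "\<epsilon> \<le> \<P>(\<omega> in M. cmod (?X (N m) (p m) \<omega>) > \<eta>)" for m
      using np unfolding N_def p_def by blast+
    have "partition_seq 0 t N p"
      unfolding partition_seq_def
    proof (intro conjI allI impI)
      fix \<delta> :: real assume "\<delta> > 0"
      from order_tendstoD(2)[OF LIMSEQ_inverse_real_of_nat this]
      show "\<forall>\<^sub>F m in sequentially. \<forall>i<N m. p m (Suc i) - p m i < \<delta>"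
        by eventually_elim (use Np(2) in \<open>force intro: less_trans\<close>)
    qed (use Np(1) in \<open>auto simp: subdivision_def\<close>)
    note null = stratonovich_sum_null[OF this]
    have "min 1 \<eta> * \<epsilon> > 0" using \<open>\<eta> > 0\<close> \<open>\<epsilon> > 0\<close> by simp
    then have "\<forall>\<^sub>F m in sequentially. expectation (\<lambda>\<omega>. min 1 (cmod (?X (N m) (p m) \<omega>))) < min 1 \<eta> * \<epsilon>"
      using null order_tendstoD(2) unfolding prob_null_def by blast
    then obtain m where m: "expectation (\<lambda>\<omega>. min 1 (cmod (?X (N m) (p m) \<omega>))) < min 1 \<eta> * \<epsilon>"
      by (auto simp: eventually_sequentially)
    have "\<epsilon> \<le> expectation (\<lambda>\<omega>. min 1 (cmod (?X (N m) (p m) \<omega>))) / min 1 \<eta>"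
      using Np(3)[of m] prob_le_expectation_min1[OF prob_null_measurable[OF null, of m] \<open>\<eta> > 0\<close>] by simp
    also have "\<dots> < \<epsilon>" using m \<open>\<eta> > 0\<close> by (simp add: divide_less_eq mult.commute)
    finally show False by simp
  qed
qed

lemma h_solution:
  assumes "T > 0"
  shows "stratonovich_solution M F W b \<sigma> \<xi> T h"
  unfolding stratonovich_solution_def complex_continuous_semimartingale_def
proof (intro conjI exI[of _ J] ballI)
  show "h t \<in> borel_measurable (F t)" if "t \<in> {0..T}" for t using that by (intro h_adapted) auto
  show "AE \<omega> in M. continuous_on {0..T} (\<lambda>t. h t \<omega>)" by (intro AE_I2 h_continuous)
  show "continuous_semimartingale M F (\<lambda>t \<omega>. Re (h (min t T) \<omega>))"
    by (intro h_semimartingale bounded_linear_Re abs_Re_le_cmod assms)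
  show "continuous_semimartingale M F (\<lambda>t \<omega>. Im (h (min t T) \<omega>))"
    by (intro h_semimartingale bounded_linear_Im abs_Im_le_cmod assms)
  show "AE \<omega> in M. h 0 \<omega> = \<xi> \<omega>" by (intro AE_I2) (simp add: h_def e_def u_0 W_0)
  show "has_stratonovich_integral M (\<lambda>s \<omega>. \<sigma> (h s \<omega>)) W t (J t)" if "t \<in> {0..T}" for t
    using that by (intro h_stratonovich_integral) auto
  show "AE \<omega> in M. \<forall>t\<in>{0..T}. h t \<omega> = \<xi> \<omega> + integral {0..t} (\<lambda>s. b (h s \<omega>)) + J t \<omega>"
    by (simp add: J_def)
qed

end

section \<open>Uniqueness\<close>

lemma norm_cis_diff_le: "cmod (cis x - cis y) \<le> \<bar>x - y\<bar>"
proof -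
  have "cis x - cis y = cis y * (cis (x - y) - 1)" by (simp add: right_diff_distrib cis_mult)
  then have "cmod (cis x - cis y) = cmod (cis (x - y) - 1)" by (simp add: norm_mult)
  also have "\<dots> \<le> \<bar>x - y\<bar>" using iexp_approx1[of "x - y" 0] by (simp add: cis_conv_exp)
  finally show ?thesis .
qed

text \<open>The events are not assumed monotone; eventual membership makes the indicators of the
  complements tend to 0, dominated by 1.\<close>

lemma (in prob_space) prob_complement_tendsto_0:
  assumes S[measurable]: "\<And>n. S n \<in> sets M" and ev: "AE \<omega> in M. \<forall>\<^sub>F n in sequentially. \<omega> \<in> S n"
  shows "(\<lambda>n. prob (space M - S n)) \<longlonglongrightarrow> 0"
proof -
  have "(\<lambda>n. expectation (indicat_real (space M - S n))) \<longlonglongrightarrow> expectation (\<lambda>_. 0)"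
  proof (rule integral_dominated_convergence[where w = "\<lambda>_. 1"])
    show "AE \<omega> in M. (\<lambda>n. indicat_real (space M - S n) \<omega>) \<longlonglongrightarrow> 0"
      using ev
    proof eventually_elim
      case (elim \<omega>)
      then have "\<forall>\<^sub>F n in sequentially. indicat_real (space M - S n) \<omega> = 0"
        by eventually_elim (simp add: indicator_def)
      then show ?case by (rule tendsto_eventually)
    qed
    show "AE \<omega> in M. norm (indicat_real (space M - S n) \<omega>) \<le> 1" for n
      by (intro AE_I2) (simp add: indicator_def)
  qed auto
  then show ?thesis by simp
qed

lemma grid_refine: "k > 0 \<Longrightarrow> grid \<alpha> \<beta> (n * k) (j * k) = grid \<alpha> \<beta> n j"
  by (simp add: grid_def)

section \<open>Discrete Levy areas on nested grids\<close>

locale nested_grids = disc_setup M F W K a \<xi>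
  for M :: "'a measure" and F and W and K a and \<xi> +
  fixes t :: real and \<kappa> :: "nat \<Rightarrow> nat"
  assumes t: "t > 0" and \<kappa>: "\<And>m. \<kappa> m > 0"
begin

text \<open>The fine grid: each of the \<open>Suc m\<close> coarse intervals is cut into
  \<open>\<kappa> m\<close> equal parts. Since \<open>\<kappa>\<close> is arbitrary here, it can be
  fixed afterwards by a diagonal choice.\<close>

definition s :: "nat \<Rightarrow> nat \<Rightarrow> real" where "s m i = grid 0 t (Suc m * \<kappa> m) i"

text \<open>The left end of the coarse interval containing the fine interval \<open>i\<close>: the
  base point from which the oscillation in the discrete area is measured.\<close>

definition start :: "nat \<Rightarrow> nat \<Rightarrow> real" where "start m i = grid 0 t (Suc m) (i div \<kappa> m)"

definition g :: "nat \<Rightarrow> nat \<Rightarrow> 'a \<Rightarrow> complex" where "g m j \<omega> = cnj (e (grid 0 t (Suc m) j) \<omega>)"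

text \<open>Sums of fine terms over the coarse intervals. The weight is the mean of
  \<open>cnj e\<close> over both ends, the factor of dh in the product rule for
  \<open>cnj e * h\<close>.\<close>

definition blocks :: "(nat \<Rightarrow> nat \<Rightarrow> 'a \<Rightarrow> complex) \<Rightarrow> nat \<Rightarrow> 'a \<Rightarrow> complex" where
  "blocks X m \<omega> = (\<Sum>j<Suc m. (g m j \<omega> + g m (Suc j) \<omega>) / 2 * (\<Sum>i=j*\<kappa> m..<j*\<kappa> m+\<kappa> m. X m i \<omega>))"

declare mult_Suc [simp del] sum.lessThan_Suc [simp del]

lemma s_0 [simp]: "s m 0 = 0"
  by (simp add: s_def)

lemma s_mono: "i \<le> j \<Longrightarrow> s m i \<le> s m j"
  unfolding s_def using t by (intro grid_mono) auto

lemma s_nonneg: "0 \<le> s m i"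
  using s_mono[of 0 i m] by (simp add: s_def)

lemma s_less: "s m i < s m (Suc i)"
  unfolding s_def grid_Suc using t \<kappa>[of m] by (auto intro!: divide_pos_pos)

lemma s_last: "s m (Suc m * \<kappa> m) = t"
  unfolding s_def using \<kappa>[of m] by (intro grid_self) auto

lemma s_le: "i \<le> Suc m * \<kappa> m \<Longrightarrow> s m i \<le> t"
  using s_mono[of i "Suc m * \<kappa> m" m] s_last[of m] by simp

lemma s_block: "s m (j * \<kappa> m) = grid 0 t (Suc m) j"
  unfolding s_def using \<kappa> by (rule grid_refine)

lemma start_eq: "start m i = s m (i div \<kappa> m * \<kappa> m)"
  by (simp only: start_def s_block)

lemma start_le: "start m i \<le> s m i"
  unfolding start_eq by (intro s_mono) simp

lemma start_nonneg: "0 \<le> start m i"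
  unfolding start_eq by (rule s_nonneg)

lemma coarse: "partition_seq 0 t Suc (\<lambda>m. grid 0 t (Suc m))"
  using t by (intro partition_seq_grid) simp

lemma block_index:
  assumes "i < Suc m * \<kappa> m"
  shows "i div \<kappa> m < Suc m" "s m i \<in> {grid 0 t (Suc m) (i div \<kappa> m)..grid 0 t (Suc m) (Suc (i div \<kappa> m))}"
proof -
  show "i div \<kappa> m < Suc m" using assms \<kappa>[of m] by (simp add: less_mult_imp_div_less)
  have "i div \<kappa> m * \<kappa> m \<le> i" by simp
  moreover have "i \<le> Suc (i div \<kappa> m) * \<kappa> m"
  proof -
    have "i div \<kappa> m * \<kappa> m + i mod \<kappa> m = i" by (rule div_mult_mod_eq)
    then show ?thesis using mod_less_divisor[OF \<kappa>[of m], of i] unfolding mult_Suc by linarith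
  qed
  ultimately show "s m i \<in> {grid 0 t (Suc m) (i div \<kappa> m)..grid 0 t (Suc m) (Suc (i div \<kappa> m))}"
    unfolding s_block[symmetric] by (auto intro: s_mono simp del: mult_Suc)
qed

text \<open>A fine point and its \<open>start\<close> share a coarse interval, so the coarse mesh
  alone matters, whatever \<open>\<kappa>\<close> is.\<close>

lemma osc_start:
  fixes f :: "real \<Rightarrow> 'b::real_normed_vector"
  assumes "continuous_on {0..t} f" "\<eta> > 0"
  shows "\<forall>\<^sub>F m in sequentially. \<forall>i<Suc m * \<kappa> m. norm (f (s m i) - f (start m i)) \<le> \<eta>"
  using partition_seq_osc[OF coarse assms]
proof eventually_elim
  case (elim m)
  show ?case
  proof (intro allI impI)
    fix i assume i: "i < Suc m * \<kappa> m"
    have "start m i \<in> {grid 0 t (Suc m) (i div \<kappa> m)..grid 0 t (Suc m) (Suc (i div \<kappa> m))}"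
      unfolding start_def using t by (auto intro!: grid_mono)
    with elim block_index[OF i] show "norm (f (s m i) - f (start m i)) \<le> \<eta>"
      by (auto simp: dist_norm intro!: less_imp_le)
  qed
qed

lemma discrete: "discrete_filtration M (\<lambda>i. F (s m i))"
proof
  show "subalgebra M (F (s m i))" for i by (rule subalgebra[OF s_nonneg])
  show "subalgebra (F (s m j)) (F (s m i))" if "i \<le> j" for i j
    by (rule subalgebra_mono[OF s_nonneg s_mono[OF that]])
qed

lemma g_measurable: "g m j \<in> borel_measurable (F (s m (j * \<kappa> m)))"
proof -
  have [measurable]: "e (s m (j * \<kappa> m)) \<in> borel_measurable (F (s m (j * \<kappa> m)))" by (rule e_adapted[OF s_nonneg])
  show ?thesis unfolding g_def s_block[symmetric] by measurable
qed

lemma norm_g: "cmod (g m j \<omega>) = 1"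
  by (simp add: g_def)

lemma g_M: "g m j \<in> borel_measurable M"
  by (rule measurable_F[OF s_nonneg g_measurable])

lemma W_M: "W (s m i) \<in> borel_measurable M" "W (start m i) \<in> borel_measurable M"
  using W_measurable[OF s_nonneg] W_measurable[OF start_nonneg] by auto

text \<open>\<open>cis\<close> is 1-Lipschitz and the increments of \<open>W\<close> have variance
  equal to the elapsed time. This is the constant \<open>S\<close> for the block estimates.\<close>

lemma g_increments: "(\<Sum>j<Suc m. expectation (\<lambda>\<omega>. (cmod (g m (Suc j) \<omega> - g m j \<omega>))\<^sup>2)) \<le> a\<^sup>2 * t"
proof -
  let ?\<tau> = "grid 0 t (Suc m)"
  have \<tau>: "0 \<le> ?\<tau> j" "?\<tau> j < ?\<tau> (Suc j)" for j
    using t grid_mono[of 0 t 0 j "Suc m"] by (auto simp: grid_Suc[of _ _ "Suc m"] simp del: of_nat_Suc)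
  have "(\<Sum>j<Suc m. expectation (\<lambda>\<omega>. (cmod (g m (Suc j) \<omega> - g m j \<omega>))\<^sup>2)) \<le> (\<Sum>j<Suc m. a\<^sup>2 * (?\<tau> (Suc j) - ?\<tau> j))"
  proof (rule sum_mono)
    fix j
    have le: "(cmod (g m (Suc j) \<omega> - g m j \<omega>))\<^sup>2 \<le> a\<^sup>2 * (W (?\<tau> (Suc j)) \<omega> - W (?\<tau> j) \<omega>)\<^sup>2" for \<omega>
    proof -
      have "cmod (g m (Suc j) \<omega> - g m j \<omega>) = cmod (e (?\<tau> (Suc j)) \<omega> - e (?\<tau> j) \<omega>)"
        unfolding g_def complex_cnj_diff[symmetric] by (rule complex_mod_cnj)
      also have "\<dots> \<le> \<bar>a * W (?\<tau> (Suc j)) \<omega> - a * W (?\<tau> j) \<omega>\<bar>" unfolding e_def by (rule norm_cis_diff_le)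
      also have "\<dots> = \<bar>a * (W (?\<tau> (Suc j)) \<omega> - W (?\<tau> j) \<omega>)\<bar>" by (simp add: algebra_simps)
      finally have "(cmod (g m (Suc j) \<omega> - g m j \<omega>))\<^sup>2 \<le> \<bar>a * (W (?\<tau> (Suc j)) \<omega> - W (?\<tau> j) \<omega>)\<bar>\<^sup>2"
        by (intro power_mono) auto
      then show ?thesis by (simp add: power_mult_distrib)
    qed
    note W2 = W_square[OF \<tau>, of j]
    have "integrable M (\<lambda>\<omega>. (cmod (g m (Suc j) \<omega> - g m j \<omega>))\<^sup>2)"
      by (rule Bochner_Integration.integrable_bound[OF integrable_mult_right[OF W2(1), of "a\<^sup>2"]])
        (use g_M le in auto)
    then have "expectation (\<lambda>\<omega>. (cmod (g m (Suc j) \<omega> - g m j \<omega>))\<^sup>2)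
        \<le> expectation (\<lambda>\<omega>. a\<^sup>2 * (W (?\<tau> (Suc j)) \<omega> - W (?\<tau> j) \<omega>)\<^sup>2)"
      using W2(1) le by (intro integral_mono) auto
    then show "expectation (\<lambda>\<omega>. (cmod (g m (Suc j) \<omega> - g m j \<omega>))\<^sup>2) \<le> a\<^sup>2 * (?\<tau> (Suc j) - ?\<tau> j)"
      using W2(2) by simp
  qed
  also have "\<dots> = a\<^sup>2 * t"
    unfolding sum_distrib_left[symmetric] using sum_lessThan_telescope[of ?\<tau> "Suc m"] grid_self[of "Suc m" 0 t] by simp
  finally show ?thesis .
qed

lemma W_square_mdiff:
  shows "discrete_filtration.square_mdiff M (\<lambda>i. F (s m i)) N (\<lambda>i \<omega>. W (s m (Suc i)) \<omega> - W (s m i) \<omega>)"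
    and "(\<Sum>i<Suc m * \<kappa> m. expectation (\<lambda>\<omega>. (W (s m (Suc i)) \<omega> - W (s m i) \<omega>)\<^sup>2)) = t"
proof -
  interpret discrete_filtration M "\<lambda>i. F (s m i)" by (rule discrete)
  show "square_mdiff N (\<lambda>i \<omega>. W (s m (Suc i)) \<omega> - W (s m i) \<omega>)"
    unfolding square_mdiff_def
  proof (intro allI impI conjI)
    fix i
    show "(\<lambda>\<omega>. W (s m (Suc i)) \<omega> - W (s m i) \<omega>) \<in> borel_measurable (F (s m (Suc i)))"
      by (intro borel_measurable_diff W_adapted s_nonneg measurable_F_mono[OF s_nonneg s_mono W_adapted]) auto
  qed (rule W_square[OF s_nonneg s_less] W_mean[OF s_nonneg s_less])+
  have "(\<Sum>i<Suc m * \<kappa> m. expectation (\<lambda>\<omega>. (W (s m (Suc i)) \<omega> - W (s m i) \<omega>)\<^sup>2)) = (\<Sum>i<Suc m * \<kappa> m. s m (Suc i) - s m i)"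
    by (intro sum.cong refl W_square(2)[OF s_nonneg s_less])
  then show "(\<Sum>i<Suc m * \<kappa> m. expectation (\<lambda>\<omega>. (W (s m (Suc i)) \<omega> - W (s m i) \<omega>)\<^sup>2)) = t"
    using sum_lessThan_telescope[of "s m" "Suc m * \<kappa> m"] s_last[of m] by (simp add: s_def)
qed

lemma block_bound: "i \<in> {j*\<kappa> m..<j*\<kappa> m+\<kappa> m} \<Longrightarrow> j < Suc m \<Longrightarrow> i < Suc m * \<kappa> m"
  using mult_le_mono1[of "Suc j" "Suc m" "\<kappa> m"] by (simp add: mult_Suc[of j])

lemma blocks_measurable:
  assumes "\<And>i. i < Suc m * \<kappa> m \<Longrightarrow> X m i \<in> borel_measurable M"
  shows "blocks X m \<in> borel_measurable M"
  unfolding blocks_def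
  by (intro borel_measurable_sum borel_measurable_times borel_measurable_divide borel_measurable_add g_M assms borel_measurable_const)
    (rule block_bound, assumption, simp)

lemma blocks_cong: "(\<And>i. i < Suc m * \<kappa> m \<Longrightarrow> X m i \<omega> = Y m i \<omega>) \<Longrightarrow> blocks X m \<omega> = blocks Y m \<omega>"
  unfolding blocks_def
proof (intro sum.cong refl arg_cong2[where f="(*)"])
  fix j i assume "\<And>i. i < Suc m * \<kappa> m \<Longrightarrow> X m i \<omega> = Y m i \<omega>" "j \<in> {..<Suc m}" "i \<in> {j*\<kappa> m..<j*\<kappa> m+\<kappa> m}"
  then show "X m i \<omega> = Y m i \<omega>" using block_bound[of i j m] by auto
qed

lemma norm_blocks_le: "cmod (blocks X m \<omega>) \<le> (\<Sum>i<Suc m * \<kappa> m. cmod (X m i \<omega>))"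
proof -
  have "cmod (blocks X m \<omega>) \<le> (\<Sum>j<Suc m. \<Sum>i=j*\<kappa> m..<j*\<kappa> m+\<kappa> m. cmod (X m i \<omega>))"
    unfolding blocks_def
  proof (rule sum_norm_le)
    fix j
    have "cmod ((g m j \<omega> + g m (Suc j) \<omega>) / 2) \<le> 1"
      using norm_triangle_ineq[of "g m j \<omega>" "g m (Suc j) \<omega>"] by (simp add: norm_divide norm_g)
    then have "cmod ((g m j \<omega> + g m (Suc j) \<omega>) / 2) * cmod (\<Sum>i=j*\<kappa> m..<j*\<kappa> m+\<kappa> m. X m i \<omega>)
        \<le> 1 * (\<Sum>i=j*\<kappa> m..<j*\<kappa> m+\<kappa> m. cmod (X m i \<omega>))"
      by (intro mult_mono norm_sum) auto
    then show "cmod ((g m j \<omega> + g m (Suc j) \<omega>) / 2 * (\<Sum>i=j*\<kappa> m..<j*\<kappa> m+\<kappa> m. X m i \<omega>))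
        \<le> (\<Sum>i=j*\<kappa> m..<j*\<kappa> m+\<kappa> m. cmod (X m i \<omega>))" by (simp add: norm_mult)
  qed
  also have "\<dots> = (\<Sum>i<Suc m * \<kappa> m. cmod (X m i \<omega>))" by (rule sum.nat_group)
  finally show ?thesis .
qed

text \<open>Large values are discarded. The result is measurable and bounded by
  \<open>\<eta>\<close>, and applied to the oscillations of a continuous path it changes nothing
  once the coarse mesh is small.\<close>

definition cut :: "real \<Rightarrow> complex \<Rightarrow> complex" where "cut \<eta> z = (if cmod z \<le> \<eta> then z else 0)"

lemma cut_measurable [measurable]: "cut \<eta> \<in> borel_measurable borel"
  unfolding cut_def by measurable

lemma norm_cut: "0 \<le> \<eta> \<Longrightarrow> cmod (cut \<eta> z) \<le> \<eta>"
  by (simp add: cut_def)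

lemma adapted_cut:
  assumes X: "\<And>r. r \<in> {0..t} \<Longrightarrow> X r \<in> borel_measurable (F r)" and i: "i < Suc m * \<kappa> m"
  shows "(\<lambda>\<omega>. cut \<eta> (X (s m i) \<omega> - X (start m i) \<omega>)) \<in> borel_measurable (F (s m i))"
proof -
  have "s m i \<le> t" using i by (intro s_le) simp
  then have [measurable]: "X (s m i) \<in> borel_measurable (F (s m i))"
      "X (start m i) \<in> borel_measurable (F (s m i))"
    using X[of "s m i"] measurable_F_mono[OF start_nonneg start_le X[of "start m i"]]
      s_nonneg[of m i] start_nonneg[of m i] start_le[of m i] by auto
  show ?thesis by measurable
qed

text \<open>With the weights cut at \<open>\<eta>\<close>, \<open>weighted_blocks\<close> applies
  with \<open>B = t\<close> and \<open>S = a\<^sup>2 * t\<close>, for every refinement. On almost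
  every path the cut is eventually inactive.\<close>

lemma blocks_dW_null:
  fixes X :: "real \<Rightarrow> 'a \<Rightarrow> complex"
  assumes X: "\<And>r. r \<in> {0..t} \<Longrightarrow> X r \<in> borel_measurable (F r)"
    and c: "AE \<omega> in M. continuous_on {0..t} (\<lambda>r. X r \<omega>)"
  shows "prob_null (blocks (\<lambda>m i \<omega>. (X (s m i) \<omega> - X (start m i) \<omega>) * of_real (W (s m (Suc i)) \<omega> - W (s m i) \<omega>)))"
proof (rule prob_null_approx)
  fix m
  have XM: "X (s m i) \<in> borel_measurable M" "X (start m i) \<in> borel_measurable M" if "i < Suc m * \<kappa> m" for i
  proof -
    have "s m i \<le> t" using that by (intro s_le) simp
    then show "X (s m i) \<in> borel_measurable M" "X (start m i) \<in> borel_measurable M"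
      using measurable_F[OF s_nonneg X[of "s m i"]] measurable_F[OF start_nonneg X[of "start m i"]]
        s_nonneg[of m i] start_nonneg[of m i] start_le[of m i] by auto
  qed
  show "blocks (\<lambda>m i \<omega>. (X (s m i) \<omega> - X (start m i) \<omega>) * of_real (W (s m (Suc i)) \<omega> - W (s m i) \<omega>)) m \<in> borel_measurable M"
  proof (rule blocks_measurable)
    fix i assume "i < Suc m * \<kappa> m"
    note [measurable] = XM[OF this] W_M
    show "(\<lambda>\<omega>. (X (s m i) \<omega> - X (start m i) \<omega>) * of_real (W (s m (Suc i)) \<omega> - W (s m i) \<omega>)) \<in> borel_measurable M"
      by measurable
  qed
next
  fix \<epsilon> :: real assume "\<epsilon> > 0"
  define \<eta> where "\<eta> = \<epsilon> / (1 + t + a\<^sup>2 * t)"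
  have pos: "1 + t + a\<^sup>2 * t > 0" using t by (intro add_pos_nonneg) auto
  then have \<eta>: "\<eta> > 0" "\<eta> * (1 + t + a\<^sup>2 * t) = \<epsilon>" using \<open>\<epsilon> > 0\<close> by (simp_all add: \<eta>_def)
  let ?c = "\<lambda>m i \<omega>. cut \<eta> (X (s m i) \<omega> - X (start m i) \<omega>)"
  let ?Z = "blocks (\<lambda>m i \<omega>. ?c m i \<omega> * of_real (W (s m (Suc i)) \<omega> - W (s m i) \<omega>))"
  have "?Z m \<in> borel_measurable M" for m
  proof (rule blocks_measurable)
    fix i assume "i < Suc m * \<kappa> m"
    note [measurable] = measurable_F[OF s_nonneg adapted_cut[OF X this]] W_M
    show "(\<lambda>\<omega>. ?c m i \<omega> * of_real (W (s m (Suc i)) \<omega> - W (s m i) \<omega>)) \<in> borel_measurable M" by measurable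
  qed
  moreover have "AE \<omega> in M. \<forall>\<^sub>F m in sequentially.
      blocks (\<lambda>m i \<omega>. (X (s m i) \<omega> - X (start m i) \<omega>) * of_real (W (s m (Suc i)) \<omega> - W (s m i) \<omega>)) m \<omega> = ?Z m \<omega>"
    using c
  proof eventually_elim
    case (elim \<omega>)
    from osc_start[OF elim \<eta>(1)] show ?case
      by eventually_elim (intro blocks_cong, simp add: cut_def)
  qed
  moreover have "expectation (\<lambda>\<omega>. min 1 (cmod (?Z m \<omega>))) \<le> \<epsilon>" for m
  proof -
    interpret discrete_filtration M "\<lambda>i. F (s m i)" by (rule discrete)
    have "expectation (\<lambda>\<omega>. min 1 (cmod (?Z m \<omega>))) \<le> \<eta> * (1 + t + a\<^sup>2 * t)"
      unfolding blocks_def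
      by (rule weighted_blocks[OF W_square_mdiff(1) eq_refl[OF W_square_mdiff(2)] \<kappa> \<eta>(1) adapted_cut[OF X] _ g_measurable _ g_increments])
        (use \<eta> in \<open>auto simp: norm_cut norm_g\<close>)
    then show ?thesis using \<eta>(2) by simp
  qed
  ultimately show "\<exists>Z S. (\<forall>m. Z m \<in> borel_measurable M) \<and> S \<in> sets M \<and> prob (space M - S) \<le> \<epsilon> \<and>
      (AE \<omega> in M. \<omega> \<in> S \<longrightarrow> (\<forall>\<^sub>F m in sequentially.
        blocks (\<lambda>m i \<omega>. (X (s m i) \<omega> - X (start m i) \<omega>) * of_real (W (s m (Suc i)) \<omega> - W (s m i) \<omega>)) m \<omega> = Z m \<omega>)) \<and>
      (\<forall>\<^sub>F m in sequentially. expectation (\<lambda>\<omega>. min 1 (cmod (Z m \<omega>))) \<le> \<epsilon>)"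
    using \<open>\<epsilon> > 0\<close> by (intro exI[of _ ?Z] exI[of _ "space M"]) auto
qed

lemma W_complex_adapted: "r \<in> {0..t} \<Longrightarrow> (\<lambda>\<omega>. complex_of_real (W r \<omega>)) \<in> borel_measurable (F r)"
  using W_adapted[of r] by auto

lemma W_complex_osc:
  assumes "\<omega> \<in> space M" "\<eta> > 0"
  shows "\<forall>\<^sub>F m in sequentially. \<forall>i<Suc m * \<kappa> m. cmod (of_real (W (s m i) \<omega>) - of_real (W (start m i) \<omega>)) \<le> \<eta>"
proof (rule osc_start[OF _ assms(2)])
  have "continuous_on {0..t} (\<lambda>r. W r \<omega>)" by (rule continuous_on_subset[OF W_continuous[OF assms(1)]]) auto
  then show "continuous_on {0..t} (\<lambda>r. complex_of_real (W r \<omega>))" by (intro continuous_intros)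
qed

text \<open>Pathwise estimate: oscillation of \<open>W\<close> within the coarse intervals times the
  variation of \<open>V\<close> up to \<open>t\<close>.\<close>

lemma blocks_dV_null:
  fixes V :: "real \<Rightarrow> 'a \<Rightarrow> real"
  assumes V: "adapted F V" and bv: "AE \<omega> in M. locally_bounded_variation (\<lambda>r. V r \<omega>)"
  shows "prob_null (blocks (\<lambda>m i \<omega>. (of_real (W (s m i) \<omega>) - of_real (W (start m i) \<omega>)) * of_real (V (s m (Suc i)) \<omega> - V (s m i) \<omega>)))"
proof (rule prob_null_AE)
  let ?X = "\<lambda>m i \<omega>. (complex_of_real (W (s m i) \<omega>) - of_real (W (start m i) \<omega>)) * of_real (V (s m (Suc i)) \<omega> - V (s m i) \<omega>)"
  have VM: "V (s m i) \<in> borel_measurable M" for m i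
    using V s_nonneg[of m i] unfolding adapted_def by (intro measurable_F[OF s_nonneg]) auto
  show "blocks ?X m \<in> borel_measurable M" for m
  proof (rule blocks_measurable)
    fix i
    note [measurable] = W_M VM
    show "?X m i \<in> borel_measurable M" by measurable
  qed
  show "AE \<omega> in M. (\<lambda>m. blocks ?X m \<omega>) \<longlonglongrightarrow> 0"
    using bv AE_space
  proof eventually_elim
    case (elim \<omega>)
    then obtain B where B: "\<And>n p. subdivision t n p \<Longrightarrow> (\<Sum>i<n. \<bar>V (p (Suc i)) \<omega> - V (p i) \<omega>\<bar>) \<le> B"
      using t unfolding locally_bounded_variation_def by (meson less_imp_le)
    have Vs: "(\<Sum>i<Suc m * \<kappa> m. \<bar>V (s m (Suc i)) \<omega> - V (s m i) \<omega>\<bar>) \<le> B" for m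
      by (rule B) (simp add: subdivision_def s_last s_mono)
    have B0: "0 \<le> B" by (rule order_trans[OF _ Vs[of 0]]) (auto intro: sum_nonneg)
    show ?case
    proof (rule tendstoI)
      fix \<epsilon> :: real assume "\<epsilon> > 0"
      define \<eta> where "\<eta> = \<epsilon> / (B + 1)"
      have \<eta>: "\<eta> > 0" "\<eta> * (B + 1) = \<epsilon>" using \<open>\<epsilon> > 0\<close> B0 by (auto simp: \<eta>_def)
      from W_complex_osc[OF elim(2) \<eta>(1)] show "\<forall>\<^sub>F m in sequentially. dist (blocks ?X m \<omega>) 0 < \<epsilon>"
      proof eventually_elim
        case (elim m)
        have "cmod (blocks ?X m \<omega>) \<le> (\<Sum>i<Suc m * \<kappa> m. cmod (?X m i \<omega>))" by (rule norm_blocks_le)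
        also have "\<dots> \<le> (\<Sum>i<Suc m * \<kappa> m. \<eta> * \<bar>V (s m (Suc i)) \<omega> - V (s m i) \<omega>\<bar>)"
          using elim by (intro sum_mono) (auto simp: norm_mult simp del: of_real_diff intro!: mult_right_mono)
        also have "\<dots> \<le> \<eta> * B"
          unfolding sum_distrib_left[symmetric] using Vs[of m] \<eta>(1) by (intro mult_left_mono) auto
        also have "\<dots> < \<eta> * (B + 1)" using \<eta>(1) by simp
        finally show ?case using \<eta>(2) by simp
      qed
    qed
  qed
qed

text \<open>Stop at \<open>\<tau> n\<close> and truncate at \<open>n + 1\<close>. On
  \<open>C n\<close> neither is noticed up to time \<open>t\<close>, and \<open>C n\<close> has
  probability close to 1 for large \<open>n\<close>. For the stopped martingale the bound contains
  its absolute moment at time \<open>t\<close>, the same for all grids.\<close>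

lemma blocks_dL_null:
  fixes L :: "real \<Rightarrow> 'a \<Rightarrow> real"
  assumes L: "continuous_local_martingale M F L"
  shows "prob_null (blocks (\<lambda>m i \<omega>. (of_real (W (s m i) \<omega>) - of_real (W (start m i) \<omega>)) * of_real (L (s m (Suc i)) \<omega> - L (s m i) \<omega>)))"
proof (rule prob_null_approx)
  let ?X = "\<lambda>m i \<omega>. (complex_of_real (W (s m i) \<omega>) - of_real (W (start m i) \<omega>)) * of_real (L (s m (Suc i)) \<omega> - L (s m i) \<omega>)"
  have Lad: "L r \<in> borel_measurable (F r)" if "0 \<le> r" for r
    using L that by (auto simp: continuous_local_martingale_def adapted_def)
  have LM[measurable]: "L (s m i) \<in> borel_measurable M" "L 0 \<in> borel_measurable M" for m i
    using measurable_F[OF _ Lad] s_nonneg by auto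
  show "blocks ?X m \<in> borel_measurable M" for m
  proof (rule blocks_measurable)
    fix i
    note [measurable] = W_M
    show "?X m i \<in> borel_measurable M" by measurable
  qed
  obtain \<tau> :: "nat \<Rightarrow> 'a \<Rightarrow> real" where
    st: "\<And>n. stopping_time (\<lambda>t. F (max 0 t)) (\<tau> n)" and \<tau>0: "\<And>n \<omega>. \<omega> \<in> space M \<Longrightarrow> 0 \<le> \<tau> n \<omega>"
    and lim: "AE \<omega> in M. filterlim (\<lambda>n. \<tau> n \<omega>) at_top sequentially"
    and mart: "\<And>n. martingale M F (\<lambda>t \<omega>. L (min t (\<tau> n \<omega>)) \<omega> - L 0 \<omega>)"
    using L unfolding continuous_local_martingale_def by auto
  have \<tau>M[measurable]: "\<tau> n \<in> borel_measurable M" for n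
  proof (rule measurable_stopping_time[OF st])
    show "sets (F (max 0 r)) \<subseteq> sets M" "space (F (max 0 r)) = space M" for r
      using subalgebra[of "max 0 r"] by (auto simp: subalgebra_def)
  qed
  \<comment> \<open>Only grid points are tested, countably many over all \<open>m\<close>; so the
    event is measurable and serves every grid at once.\<close>
  define C where "C n = {\<omega>\<in>space M. t \<le> \<tau> n \<omega> \<and> (\<forall>m i. i \<le> Suc m * \<kappa> m \<longrightarrow> \<bar>L (s m i) \<omega> - L 0 \<omega>\<bar> \<le> real n + 1)}" for n
  have CM: "C n \<in> sets M" for n unfolding C_def by measurable
  have "AE \<omega> in M. continuous_on {0..} (\<lambda>r. L r \<omega>)"
    using L by (simp add: continuous_local_martingale_def ae_continuous_def)
  with lim AE_space have "AE \<omega> in M. \<forall>\<^sub>F n in sequentially. \<omega> \<in> C n"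
  proof eventually_elim
    case (elim \<omega>)
    have "continuous_on {0..t} (\<lambda>r. L r \<omega> - L 0 \<omega>)"
      using elim(3) by (intro continuous_intros continuous_on_subset[OF elim(3)]) auto
    then have "bounded ((\<lambda>r. L r \<omega> - L 0 \<omega>) ` {0..t})"
      by (intro compact_imp_bounded compact_continuous_image) auto
    then obtain B where "\<forall>y\<in>(\<lambda>r. L r \<omega> - L 0 \<omega>) ` {0..t}. norm y \<le> B"
      unfolding bounded_iff by blast
    then have B: "\<bar>L r \<omega> - L 0 \<omega>\<bar> \<le> B" if "r \<in> {0..t}" for r
      using that by auto
    have "\<forall>\<^sub>F n in sequentially. B \<le> real n"
      using filterlim_real_sequentially unfolding filterlim_at_top by auto
    moreover have "\<forall>\<^sub>F n in sequentially. t \<le> \<tau> n \<omega>"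
      using elim(1) unfolding filterlim_at_top by auto
    ultimately show ?case
    proof eventually_elim
      case (elim n)
      have "\<bar>L (s m i) \<omega> - L 0 \<omega>\<bar> \<le> real n + 1" if "i \<le> Suc m * \<kappa> m" for m i
        using B[of "s m i"] s_nonneg[of m i] s_le[OF that] elim by auto
      then show ?case using elim \<open>\<omega> \<in> space M\<close> by (simp add: C_def)
    qed
  qed
  note C0 = prob_complement_tendsto_0[OF CM this]
  fix \<epsilon> :: real assume "\<epsilon> > 0"
  from order_tendstoD(2)[OF C0 this] obtain n where n: "prob (space M - C n) < \<epsilon>"
    by (auto simp: eventually_sequentially)
  define lam where "lam = real n + 1"
  have lam: "lam > 0" by (simp add: lam_def)
  define x where "x m i \<omega> = L (min (s m i) (\<tau> n \<omega>)) \<omega> - L 0 \<omega>" for m i \<omega>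
  define E where "E = expectation (\<lambda>\<omega>. \<bar>L (min t (\<tau> n \<omega>)) \<omega> - L 0 \<omega>\<bar>)"
  have E0: "0 \<le> E" unfolding E_def by (rule integral_nonneg_AE) auto
  \<comment> \<open>The denominator is the bracket in \<open>martingale_blocks\<close> with
    \<open>S = a\<^sup>2 * t\<close>.\<close>
  define \<eta> where "\<eta> = \<epsilon> / (1 + lam\<^sup>2 + (2 * lam + 1) * E + a\<^sup>2 * t)"
  have pos: "1 + lam\<^sup>2 + (2 * lam + 1) * E + a\<^sup>2 * t > 0"
    using t lam E0 by (intro add_pos_nonneg mult_nonneg_nonneg) auto
  then have \<eta>: "\<eta> > 0" "\<eta> * (1 + lam\<^sup>2 + (2 * lam + 1) * E + a\<^sup>2 * t) = \<epsilon>" using \<open>\<epsilon> > 0\<close> by (simp_all add: \<eta>_def)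
  let ?c = "\<lambda>m i \<omega>. cut \<eta> (of_real (W (s m i) \<omega>) - of_real (W (start m i) \<omega>))"
  \<comment> \<open>The truncation runs along the fine grid of \<open>m\<close>, so each
    \<open>m\<close> has its own substitute increments, all valid on the same event
    \<open>C n\<close>.\<close>
  have "\<forall>m. \<exists>\<Delta>. (\<forall>i<Suc m * \<kappa> m. \<Delta> i \<in> borel_measurable M) \<and>
      (\<forall>i<Suc m * \<kappa> m. \<forall>\<omega>\<in>C n. L (s m (Suc i)) \<omega> - L (s m i) \<omega> = \<Delta> i \<omega>) \<and>
      expectation (\<lambda>\<omega>. min 1 (cmod (\<Sum>j<Suc m. (g m j \<omega> + g m (Suc j) \<omega>) / 2 *
        (\<Sum>i=j*\<kappa> m..<j*\<kappa> m+\<kappa> m. ?c m i \<omega> * of_real (\<Delta> i \<omega>))))) \<le> \<epsilon>"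
  proof
    fix m
    interpret discrete_filtration M "\<lambda>i. F (s m i)" by (rule discrete)
    have xE: "expectation (\<lambda>\<omega>. \<bar>x m (Suc m * \<kappa> m) \<omega>\<bar>) = E"
      unfolding x_def s_last E_def ..
    have xG: "x m i \<in> borel_measurable (F (s m i))" and xi: "integrable M (x m i)" for i
      using mart[of n] s_nonneg[of m i] unfolding martingale_def adapted_def x_def by auto
    have xm: "AE \<omega> in M. real_cond_exp M (F (s m i)) (x m (Suc i)) \<omega> = x m i \<omega>" for i
      using mart[of n] s_nonneg[of m i] s_mono[of i "Suc i" m] unfolding martingale_def x_def by auto
    have x0: "x m 0 \<omega> = 0" if "\<omega> \<in> space M" for \<omega>
      using \<tau>0[OF that] by (simp add: x_def s_def)
    show "\<exists>\<Delta>. (\<forall>i<Suc m * \<kappa> m. \<Delta> i \<in> borel_measurable M) \<and>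
      (\<forall>i<Suc m * \<kappa> m. \<forall>\<omega>\<in>C n. L (s m (Suc i)) \<omega> - L (s m i) \<omega> = \<Delta> i \<omega>) \<and>
      expectation (\<lambda>\<omega>. min 1 (cmod (\<Sum>j<Suc m. (g m j \<omega> + g m (Suc j) \<omega>) / 2 *
        (\<Sum>i=j*\<kappa> m..<j*\<kappa> m+\<kappa> m. ?c m i \<omega> * of_real (\<Delta> i \<omega>))))) \<le> \<epsilon>"
    proof (rule martingale_blocks[where m = "Suc m" and k = "\<kappa> m" and x = "x m" and c = "?c m" and g = "g m" and \<eta> = \<eta>,
          OF xG xi xm x0 lam \<kappa> \<eta>(1) adapted_cut[OF W_complex_adapted] _ g_measurable _ g_increments])
      fix \<Delta> assume D: "\<And>i. i < Suc m * \<kappa> m \<Longrightarrow> \<Delta> i \<in> borel_measurable M"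
        and inc: "\<And>i \<omega>. i < Suc m * \<kappa> m \<Longrightarrow> \<omega> \<in> space M \<Longrightarrow> \<forall>l\<le>Suc m * \<kappa> m. \<bar>x m l \<omega>\<bar> \<le> lam \<Longrightarrow>
          x m (Suc i) \<omega> - x m i \<omega> = \<Delta> i \<omega>"
        and bd: "expectation (\<lambda>\<omega>. min 1 (cmod (\<Sum>j<Suc m. (g m j \<omega> + g m (Suc j) \<omega>) / 2 *
          (\<Sum>i=j*\<kappa> m..<j*\<kappa> m+\<kappa> m. ?c m i \<omega> * of_real (\<Delta> i \<omega>)))))
          \<le> \<eta> * (1 + lam\<^sup>2 + (2 * lam + 1) * expectation (\<lambda>\<omega>. \<bar>x m (Suc m * \<kappa> m) \<omega>\<bar>) + a\<^sup>2 * t)"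
      have "L (s m (Suc i)) \<omega> - L (s m i) \<omega> = \<Delta> i \<omega>" if i: "i < Suc m * \<kappa> m" and \<omega>: "\<omega> \<in> C n" for i \<omega>
      proof -
        have "x m l \<omega> = L (s m l) \<omega> - L 0 \<omega>" if "l \<le> Suc m * \<kappa> m" for l
          using s_le[OF that] \<omega> by (auto simp: x_def C_def min_def)
        then show ?thesis using inc[OF i, of \<omega>] i \<omega> by (auto simp: C_def lam_def)
      qed
      with D bd show ?thesis unfolding xE \<eta>(2) by (intro exI[of _ \<Delta>]) auto
    qed (use \<eta> in \<open>auto simp: norm_cut norm_g\<close>)
  qed
  from choice[OF this] obtain \<Delta> where \<Delta>: "\<And>m i. i < Suc m * \<kappa> m \<Longrightarrow> \<Delta> m i \<in> borel_measurable M"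
    "\<And>m i \<omega>. i < Suc m * \<kappa> m \<Longrightarrow> \<omega> \<in> C n \<Longrightarrow> L (s m (Suc i)) \<omega> - L (s m i) \<omega> = \<Delta> m i \<omega>"
    "\<And>m. expectation (\<lambda>\<omega>. min 1 (cmod (\<Sum>j<Suc m. (g m j \<omega> + g m (Suc j) \<omega>) / 2 *
        (\<Sum>i=j*\<kappa> m..<j*\<kappa> m+\<kappa> m. ?c m i \<omega> * of_real (\<Delta> m i \<omega>))))) \<le> \<epsilon>"
    by blast
  let ?Z = "blocks (\<lambda>m i \<omega>. ?c m i \<omega> * of_real (\<Delta> m i \<omega>))"
  have "?Z m \<in> borel_measurable M" for m
  proof (rule blocks_measurable)
    fix i assume i: "i < Suc m * \<kappa> m"
    note [measurable] = measurable_F[OF s_nonneg adapted_cut[OF W_complex_adapted i]] \<Delta>(1)[OF i]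
    show "(\<lambda>\<omega>. ?c m i \<omega> * of_real (\<Delta> m i \<omega>)) \<in> borel_measurable M" by measurable
  qed
  moreover have "AE \<omega> in M. \<omega> \<in> C n \<longrightarrow> (\<forall>\<^sub>F m in sequentially. blocks ?X m \<omega> = ?Z m \<omega>)"
  proof (intro AE_I2 impI)
    fix \<omega> assume \<omega>: "\<omega> \<in> space M" "\<omega> \<in> C n"
    from W_complex_osc[OF \<omega>(1) \<eta>(1)] show "\<forall>\<^sub>F m in sequentially. blocks ?X m \<omega> = ?Z m \<omega>"
      by eventually_elim (intro blocks_cong, simp add: cut_def \<Delta>(2)[OF _ \<omega>(2)] del: of_real_diff)
  qed
  moreover have "expectation (\<lambda>\<omega>. min 1 (cmod (?Z m \<omega>))) \<le> \<epsilon>" for m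
    unfolding blocks_def by (rule \<Delta>(3))
  ultimately show "\<exists>Z S. (\<forall>m. Z m \<in> borel_measurable M) \<and> S \<in> sets M \<and> prob (space M - S) \<le> \<epsilon> \<and>
      (AE \<omega> in M. \<omega> \<in> S \<longrightarrow> (\<forall>\<^sub>F m in sequentially. blocks ?X m \<omega> = Z m \<omega>)) \<and>
      (\<forall>\<^sub>F m in sequentially. expectation (\<lambda>\<omega>. min 1 (cmod (Z m \<omega>))) \<le> \<epsilon>)"
    using n CM by (intro exI[of _ ?Z] exI[of _ "C n"]) auto
qed

end

lemma stratonovich_sum_measurable:
  assumes p: "\<forall>i<n. p i \<le> p (Suc i)" "p 0 = 0" "p n \<le> t"
    and X: "\<And>r. r \<in> {0..t} \<Longrightarrow> X r \<in> borel_measurable M"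
    and W: "\<And>r. 0 \<le> r \<Longrightarrow> W r \<in> borel_measurable M"
  shows "stratonovich_sum X W n p \<in> borel_measurable M"
  unfolding stratonovich_sum_def
proof (rule borel_measurable_sum)
  fix i assume i: "i \<in> {..<n}"
  have "p 0 \<le> p i" "p i \<le> p (Suc i)" "p (Suc i) \<le> p n"
    using i by (auto intro!: partition_mono[OF p(1)])
  then have "p i \<in> {0..t}" "p (Suc i) \<in> {0..t}" using p by auto
  then have [measurable]: "X (p i) \<in> borel_measurable M" "X (p (Suc i)) \<in> borel_measurable M"
      "W (p i) \<in> borel_measurable M" "W (p (Suc i)) \<in> borel_measurable M"
    using X W by auto
  show "(\<lambda>\<omega>. (X (p i) \<omega> + X (p (Suc i)) \<omega>) / 2 * of_real (W (p (Suc i)) \<omega> - W (p i) \<omega>)) \<in> borel_measurable M"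
    by measurable
qed

lemma (in prob_space) stratonovich_integral_null:
  assumes I: "has_stratonovich_integral M X W t J" and p: "partition_seq 0 t N p"
    and meas: "\<And>m. stratonovich_sum X W (N m) (p m) \<in> borel_measurable M"
  shows "prob_null (\<lambda>m \<omega>. stratonovich_sum X W (N m) (p m) \<omega> - J \<omega>)"
proof (rule prob_null_of_prob)
  note [measurable] = meas
  have [measurable]: "J \<in> borel_measurable M" using I by (simp add: has_stratonovich_integral_def)
  show "(\<lambda>\<omega>. stratonovich_sum X W (N m) (p m) \<omega> - J \<omega>) \<in> borel_measurable M" for m by measurable
  fix \<eta> \<epsilon> :: real assume "\<eta> > 0" "\<epsilon> > 0"
  from I[unfolded has_stratonovich_integral_def, THEN conjunct2, THEN spec, THEN mp, OF this(1), THEN spec, THEN mp, OF this(2)]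
  obtain \<delta> where "\<delta> > 0" and \<delta>: "\<And>n p. subdivision t n p \<Longrightarrow> \<forall>i<n. p (Suc i) - p i < \<delta> \<Longrightarrow>
      \<P>(\<omega> in M. cmod (stratonovich_sum X W n p \<omega> - J \<omega>) > \<eta>) < \<epsilon>"
    by auto
  have sub: "subdivision t (N m) (p m)" for m
    using p by (auto simp: partition_seq_def subdivision_def)
  have "\<forall>\<^sub>F m in sequentially. \<forall>i<N m. p m (Suc i) - p m i < \<delta>"
    using p \<open>\<delta> > 0\<close> by (auto simp: partition_seq_def)
  then show "\<forall>\<^sub>F m in sequentially. \<P>(\<omega> in M. cmod (stratonovich_sum X W (N m) (p m) \<omega> - J \<omega>) > \<eta>) < \<epsilon>"
    by eventually_elim (rule \<delta>[OF sub])
qed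

text \<open>The refinements of one grid of [0, t] restrict to partitions of every initial segment
  ending at a coarse point. Thus the same refinement approximates the integrals up to all coarse
  points.\<close>

lemma partition_seq_grid_initial:
  assumes "0 \<le> t"
  shows "partition_seq 0 (grid 0 t n j) (\<lambda>k. j * Suc k) (\<lambda>k. grid 0 t (n * Suc k))"
  unfolding partition_seq_def
proof (intro conjI allI impI)
  show "grid 0 t (n * Suc k) (j * Suc k) = grid 0 t n j" for k by (rule grid_refine) simp
  fix \<delta> :: real assume "\<delta> > 0"
  have "(\<lambda>k. (t / real n) / real (Suc k)) \<longlonglongrightarrow> 0" by (rule LIMSEQ_Suc[OF lim_const_over_n])
  from order_tendstoD(2)[OF this \<open>\<delta> > 0\<close>]
  show "\<forall>\<^sub>F k in sequentially. \<forall>i<j * Suc k. grid 0 t (n * Suc k) (Suc i) - grid 0 t (n * Suc k) i < \<delta>"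
    by eventually_elim (simp add: grid_Suc del: of_nat_Suc mult_Suc_right)
qed (use assms in \<open>auto intro!: grid_mono\<close>)

context nested_grids
begin

lemma blocks_add: "blocks (\<lambda>m i \<omega>. X m i \<omega> + Y m i \<omega>) m \<omega> = blocks X m \<omega> + blocks Y m \<omega>"
  by (simp add: blocks_def sum.distrib distrib_left)

lemma blocks_cmult: "blocks (\<lambda>m i \<omega>. c * X m i \<omega>) m \<omega> = c * blocks X m \<omega>"
  by (simp add: blocks_def sum_distrib_left mult_ac)

text \<open>\<open>trapezoid_levy_area\<close> on each coarse interval, where \<open>start\<close>
  is constant and equal to the left end, followed by summation with the weights.\<close>

lemma blocks_levy_area:
  fixes X :: "real \<Rightarrow> 'a \<Rightarrow> complex"
  shows "(\<Sum>j<Suc m. (g m j \<omega> + g m (Suc j) \<omega>) / 2 *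
      ((\<Sum>i=j*\<kappa> m..<j*\<kappa> m+\<kappa> m. (X (s m i) \<omega> + X (s m (Suc i)) \<omega>) / 2 * of_real (W (s m (Suc i)) \<omega> - W (s m i) \<omega>))
       - (X (grid 0 t (Suc m) j) \<omega> + X (grid 0 t (Suc m) (Suc j)) \<omega>) / 2 *
           of_real (W (grid 0 t (Suc m) (Suc j)) \<omega> - W (grid 0 t (Suc m) j) \<omega>)))
    = (blocks (\<lambda>m i \<omega>. (X (s m i) \<omega> - X (start m i) \<omega>) * of_real (W (s m (Suc i)) \<omega> - W (s m i) \<omega>)) m \<omega>
     - blocks (\<lambda>m i \<omega>. (of_real (W (s m i) \<omega>) - of_real (W (start m i) \<omega>)) * (X (s m (Suc i)) \<omega> - X (s m i) \<omega>)) m \<omega>) / 2"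
proof -
  have shift: "(\<Sum>i=j*\<kappa> m..<j*\<kappa> m+\<kappa> m. f i) = (\<Sum>l<\<kappa> m. f (j * \<kappa> m + l))" for j and f :: "nat \<Rightarrow> complex"
    by (simp add: sum.atLeastLessThan_shift_0[of f] lessThan_atLeast0)
  have st: "start m (j * \<kappa> m + l) = grid 0 t (Suc m) j" if "l < \<kappa> m" for j l
    using that by (simp add: start_def)
  have e0: "s m (j * \<kappa> m) = grid 0 t (Suc m) j" for j by (rule s_block)
  have e1: "s m (j * \<kappa> m + \<kappa> m) = grid 0 t (Suc m) (Suc j)" for j
    using s_block[of m "Suc j"] by (simp add: mult_Suc add.commute)
  have lev: "(\<Sum>l<\<kappa> m. (X (s m (j * \<kappa> m + l)) \<omega> + X (s m (Suc (j * \<kappa> m + l))) \<omega>) / 2 *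
          of_real (W (s m (Suc (j * \<kappa> m + l))) \<omega> - W (s m (j * \<kappa> m + l)) \<omega>))
       - (X (grid 0 t (Suc m) j) \<omega> + X (grid 0 t (Suc m) (Suc j)) \<omega>) / 2 *
           of_real (W (grid 0 t (Suc m) (Suc j)) \<omega> - W (grid 0 t (Suc m) j) \<omega>)
      = ((\<Sum>l<\<kappa> m. (X (s m (j * \<kappa> m + l)) \<omega> - X (start m (j * \<kappa> m + l)) \<omega>) *
            of_real (W (s m (Suc (j * \<kappa> m + l))) \<omega> - W (s m (j * \<kappa> m + l)) \<omega>))
        - (\<Sum>l<\<kappa> m. (of_real (W (s m (j * \<kappa> m + l)) \<omega>) - of_real (W (start m (j * \<kappa> m + l)) \<omega>)) *
            (X (s m (Suc (j * \<kappa> m + l))) \<omega> - X (s m (j * \<kappa> m + l)) \<omega>))) / 2" for j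
    using trapezoid_levy_area[of "\<lambda>l. X (s m (j * \<kappa> m + l)) \<omega>" "\<lambda>l. of_real (W (s m (j * \<kappa> m + l)) \<omega>)" "\<kappa> m"]
    by (simp add: e0 e1 st cong: sum.cong_simp)
  have gen: "((\<Sum>j<Suc m. c j * p j) - (\<Sum>j<Suc m. c j * q j)) / 2 = (\<Sum>j<Suc m. c j * ((p j - q j) / 2))"
    for c p q :: "nat \<Rightarrow> complex"
    by (simp add: sum_subtractf right_diff_distrib sum_divide_distrib diff_divide_distrib)
  show ?thesis
    unfolding blocks_def gen unfolding shift lev ..
qed

text \<open>Linearity in the integrator: real and imaginary part each split into a local martingale
  and a process of bounded variation.\<close>

lemma blocks_dX_null:
  fixes X :: "real \<Rightarrow> 'a \<Rightarrow> complex"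
  assumes L: "continuous_local_martingale M F L1" "continuous_local_martingale M F L2"
    and A: "adapted F A1" "adapted F A2"
      "AE \<omega> in M. locally_bounded_variation (\<lambda>r. A1 r \<omega>)" "AE \<omega> in M. locally_bounded_variation (\<lambda>r. A2 r \<omega>)"
    and X: "\<And>r. r \<in> {0..t} \<Longrightarrow> X r \<in> borel_measurable M"
    and eq: "AE \<omega> in M. \<forall>r\<in>{0..t}. Re (X r \<omega>) = L1 r \<omega> + A1 r \<omega>" "AE \<omega> in M. \<forall>r\<in>{0..t}. Im (X r \<omega>) = L2 r \<omega> + A2 r \<omega>"
  shows "prob_null (blocks (\<lambda>m i \<omega>. (of_real (W (s m i) \<omega>) - of_real (W (start m i) \<omega>)) * (X (s m (Suc i)) \<omega> - X (s m i) \<omega>)))"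
proof -
  define D where "D Y = (\<lambda>m i \<omega>. (complex_of_real (W (s m i) \<omega>) - of_real (W (start m i) \<omega>)) * of_real (Y (s m (Suc i)) \<omega> - Y (s m i) \<omega>))"
    for Y :: "real \<Rightarrow> 'a \<Rightarrow> real"
  have null: "prob_null (blocks (D L1))" "prob_null (blocks (D L2))" "prob_null (blocks (D A1))" "prob_null (blocks (D A2))"
    unfolding D_def by (rule blocks_dL_null L blocks_dV_null A)+
  have "prob_null (\<lambda>m \<omega>. \<i> * (blocks (D L2) m \<omega> + blocks (D A2) m \<omega>))"
    by (rule prob_null_mono[OF prob_null_add[OF null(2,4)], where C = 1])
      (use prob_null_measurable[OF null(2)] prob_null_measurable[OF null(4)] in \<open>auto simp: norm_mult\<close>)
  note sum = prob_null_add[OF prob_null_add[OF null(1,3)] this]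
  show ?thesis
  proof (rule prob_null_cong_AE[OF sum])
    fix m
    show "blocks (\<lambda>m i \<omega>. (of_real (W (s m i) \<omega>) - of_real (W (start m i) \<omega>)) * (X (s m (Suc i)) \<omega> - X (s m i) \<omega>)) m \<in> borel_measurable M"
    proof (rule blocks_measurable)
      fix i assume i: "i < Suc m * \<kappa> m"
      then have [measurable]: "X (s m i) \<in> borel_measurable M" "X (s m (Suc i)) \<in> borel_measurable M"
        using s_nonneg s_le[of i m] s_le[of "Suc i" m] by (auto intro!: X)
      note [measurable] = W_M
      show "(\<lambda>\<omega>. (of_real (W (s m i) \<omega>) - of_real (W (start m i) \<omega>)) * (X (s m (Suc i)) \<omega> - X (s m i) \<omega>)) \<in> borel_measurable M"
        by measurable
    qed
    show "AE \<omega> in M. blocks (\<lambda>m i \<omega>. (of_real (W (s m i) \<omega>) - of_real (W (start m i) \<omega>)) * (X (s m (Suc i)) \<omega> - X (s m i) \<omega>)) m \<omega>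
        = blocks (D L1) m \<omega> + blocks (D A1) m \<omega> + \<i> * (blocks (D L2) m \<omega> + blocks (D A2) m \<omega>)"
      using eq
    proof eventually_elim
      case (elim \<omega>)
      have "blocks (\<lambda>m i \<omega>. (of_real (W (s m i) \<omega>) - of_real (W (start m i) \<omega>)) * (X (s m (Suc i)) \<omega> - X (s m i) \<omega>)) m \<omega>
          = blocks (\<lambda>m i \<omega>. (D L1 m i \<omega> + D A1 m i \<omega>) + \<i> * (D L2 m i \<omega> + D A2 m i \<omega>)) m \<omega>"
      proof (rule blocks_cong)
        fix i assume "i < Suc m * \<kappa> m"
        then have r: "s m i \<in> {0..t}" "s m (Suc i) \<in> {0..t}"
          using s_nonneg s_le[of i m] s_le[of "Suc i" m] by auto
        have Xr: "X r \<omega> = of_real (L1 r \<omega> + A1 r \<omega>) + \<i> * of_real (L2 r \<omega> + A2 r \<omega>)" if "r \<in> {0..t}" for r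
          using elim that by (auto simp: complex_eq_iff)
        show "(of_real (W (s m i) \<omega>) - of_real (W (start m i) \<omega>)) * (X (s m (Suc i)) \<omega> - X (s m i) \<omega>)
            = (D L1 m i \<omega> + D A1 m i \<omega>) + \<i> * (D L2 m i \<omega> + D A2 m i \<omega>)"
          unfolding Xr[OF r(1)] Xr[OF r(2)] D_def by (simp add: algebra_simps)
      qed
      then show ?case unfolding blocks_add blocks_cmult .
    qed
  qed
qed

end

section \<open>The differential equation satisfied by an arbitrary solution\<close>

context disc_setup
begin

text \<open>The increments of \<open>cnj e * h'\<close> over the coarse grid are expanded by the
  product rule with means. The dW terms of the two factors cancel, since \<open>cnj e\<close>
  rotates by -i a. What remains is \<open>C\<close>, the error of coarse trapezoids in place of
  increments of \<open>J'\<close>; \<open>H\<close>, the cubic error of the exponential; and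
  \<open>R\<close>, a Riemann sum tending to the claimed integral.\<close>

lemma solution_integral_equation:
  assumes sol: "stratonovich_solution M F W b \<sigma> \<xi> T h'" and t: "0 < t" "t \<le> T"
  shows "AE \<omega> in M. cnj (e t \<omega>) * h' t \<omega> = \<xi> \<omega> + integral {0..t} (\<lambda>s. cnj (e s \<omega>) * b (h' s \<omega>))"
proof -
  have hF: "h' r \<in> borel_measurable (F r)" if "r \<in> {0..T}" for r
    using sol that by (auto simp: stratonovich_solution_def)
  have hM: "h' r \<in> borel_measurable M" if "r \<in> {0..T}" for r
    using measurable_F[OF _ hF[OF that]] that by auto
  have cont: "AE \<omega> in M. continuous_on {0..T} (\<lambda>r. h' r \<omega>)"
    using sol by (simp add: stratonovich_solution_def)
  have h0: "AE \<omega> in M. h' 0 \<omega> = \<xi> \<omega>" using sol by (simp add: stratonovich_solution_def)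
  obtain J' where I: "\<And>r. r \<in> {0..T} \<Longrightarrow> has_stratonovich_integral M (\<lambda>s \<omega>. \<sigma> (h' s \<omega>)) W r (J' r)"
    and Jeq: "AE \<omega> in M. \<forall>r\<in>{0..T}. h' r \<omega> = \<xi> \<omega> + integral {0..r} (\<lambda>s. b (h' s \<omega>)) + J' r \<omega>"
    using sol unfolding stratonovich_solution_def by blast
  obtain L1 A1 where L1: "continuous_local_martingale M F L1" "adapted F A1" "AE \<omega> in M. locally_bounded_variation (\<lambda>r. A1 r \<omega>)"
      "AE \<omega> in M. \<forall>r\<ge>0. Re (h' (min r T) \<omega>) = L1 r \<omega> + A1 r \<omega>"
    using sol unfolding stratonovich_solution_def complex_continuous_semimartingale_def continuous_semimartingale_def by blast
  obtain L2 A2 where L2: "continuous_local_martingale M F L2" "adapted F A2" "AE \<omega> in M. locally_bounded_variation (\<lambda>r. A2 r \<omega>)"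
      "AE \<omega> in M. \<forall>r\<ge>0. Im (h' (min r T) \<omega>) = L2 r \<omega> + A2 r \<omega>"
    using sol unfolding stratonovich_solution_def complex_continuous_semimartingale_def continuous_semimartingale_def by blast
  have JM: "J' r \<in> borel_measurable M" if "r \<in> {0..T}" for r
    using I[OF that] by (simp add: has_stratonovich_integral_def)
  have \<tau>: "grid 0 t (Suc m) j \<in> {0..t}" "grid 0 t (Suc m) j \<in> {0..T}" if "j \<le> Suc m" for m j
    using grid_mem[of 0 t j "Suc m"] t that by auto
  have eM: "e r \<in> borel_measurable M" if "0 \<le> r" for r using measurable_F[OF that e_adapted[OF that]] .
  have \<sigma>M: "(\<lambda>\<omega>. \<sigma> (h' r \<omega>)) \<in> borel_measurable M" if "r \<in> {0..T}" for r
    unfolding \<sigma>_def using hM[OF that] by measurable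
  \<comment> \<open>The trapezoidal sum over the first \<open>n\<close> intervals of the grid that
    cuts each coarse interval into \<open>Suc k\<close> parts. Taking \<open>n = j * Suc k\<close>
    reaches the coarse point \<open>j\<close>, and differences give the sum over one coarse
    interval.\<close>
  define \<Sigma> where "\<Sigma> m k n = stratonovich_sum (\<lambda>s \<omega>. \<sigma> (h' s \<omega>)) W n (grid 0 t (Suc m * Suc k))" for m k n
  define gg where "gg m j \<omega> = (cnj (e (grid 0 t (Suc m) j) \<omega>) + cnj (e (grid 0 t (Suc m) (Suc j)) \<omega>)) / 2" for m j \<omega>
  have norm_gg: "cmod (gg m j \<omega>) \<le> 1" for m j \<omega>
    unfolding gg_def using norm_triangle_ineq[of "cnj (e (grid 0 t (Suc m) j) \<omega>)" "cnj (e (grid 0 t (Suc m) (Suc j)) \<omega>)"]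
    by (simp add: norm_divide)
  have ggM: "gg m j \<in> borel_measurable M" for m j
  proof -
    have [measurable]: "e (grid 0 t (Suc m) i) \<in> borel_measurable M" for i
      using eM grid_mono[of 0 t 0 i "Suc m"] t by simp
    show ?thesis unfolding gg_def by measurable
  qed
  \<comment> \<open>The distance between the integral over coarse intervals and its refined sums.
    For fixed \<open>m\<close> there are finitely many of them, so it vanishes in probability as
    \<open>k\<close> grows.\<close>
  define E2 where "E2 m k \<omega> = (\<Sum>j<Suc m. gg m j \<omega> * ((J' (grid 0 t (Suc m) (Suc j)) \<omega> - J' (grid 0 t (Suc m) j) \<omega>)
      - (\<Sigma> m k (Suc j * Suc k) \<omega> - \<Sigma> m k (j * Suc k) \<omega>)))" for m k \<omega>
  have \<Sigma>M: "\<Sigma> m k (j * Suc k) \<in> borel_measurable M" if "j \<le> Suc m" for m k j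
    unfolding \<Sigma>_def
  proof (rule stratonovich_sum_measurable[where t = T])
    show "\<forall>i<j * Suc k. grid 0 t (Suc m * Suc k) i \<le> grid 0 t (Suc m * Suc k) (Suc i)"
      using t by (auto intro!: grid_mono)
    show "grid 0 t (Suc m * Suc k) (j * Suc k) \<le> T"
      using \<tau>(2)[OF that] grid_refine[of "Suc k" 0 t "Suc m" j] by simp
  qed (auto intro: \<sigma>M W_measurable)
  have "prob_null (E2 m)" for m
    unfolding E2_def
  proof (rule prob_null_sum)
    fix j assume "j \<in> {..<Suc m}"
    then have j: "j \<le> Suc m" "Suc j \<le> Suc m" by auto
    have N: "prob_null (\<lambda>k \<omega>. \<Sigma> m k (i * Suc k) \<omega> - J' (grid 0 t (Suc m) i) \<omega>)" if "i \<le> Suc m" for i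
      unfolding \<Sigma>_def
      by (rule stratonovich_integral_null[OF I[OF \<tau>(2)[OF that]] partition_seq_grid_initial])
        (use t \<Sigma>M[OF that, unfolded \<Sigma>_def] in auto)
    note [measurable] = \<Sigma>M[OF j(1)] \<Sigma>M[OF j(2)] JM[OF \<tau>(2)[OF j(1)]] JM[OF \<tau>(2)[OF j(2)]] ggM
    have "prob_null (\<lambda>k \<omega>. - (\<Sigma> m k (j * Suc k) \<omega> - J' (grid 0 t (Suc m) j) \<omega>))"
    proof (rule prob_null_mono[OF N[OF j(1)], where C = 1])
      show "(\<lambda>\<omega>. - (\<Sigma> m k (j * Suc k) \<omega> - J' (grid 0 t (Suc m) j) \<omega>)) \<in> borel_measurable M" for k
        by measurable
    qed (auto simp only: norm_minus_cancel mult_1 intro!: AE_I2)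
    note N2 = prob_null_add[OF N[OF j(2)] this]
    show "prob_null (\<lambda>k \<omega>. gg m j \<omega> * ((J' (grid 0 t (Suc m) (Suc j)) \<omega> - J' (grid 0 t (Suc m) j) \<omega>)
      - (\<Sigma> m k (Suc j * Suc k) \<omega> - \<Sigma> m k (j * Suc k) \<omega>)))"
    proof (rule prob_null_mono[OF N2, where C = 1])
      show "(\<lambda>\<omega>. gg m j \<omega> * ((J' (grid 0 t (Suc m) (Suc j)) \<omega> - J' (grid 0 t (Suc m) j) \<omega>)
        - (\<Sigma> m k (Suc j * Suc k) \<omega> - \<Sigma> m k (j * Suc k) \<omega>))) \<in> borel_measurable M" for k
        by measurable
      show "AE \<omega> in M. cmod (gg m j \<omega> * ((J' (grid 0 t (Suc m) (Suc j)) \<omega> - J' (grid 0 t (Suc m) j) \<omega>)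
        - (\<Sigma> m k (Suc j * Suc k) \<omega> - \<Sigma> m k (j * Suc k) \<omega>)))
        \<le> 1 * cmod (\<Sigma> m k (Suc j * Suc k) \<omega> - J' (grid 0 t (Suc m) (Suc j)) \<omega> + - (\<Sigma> m k (j * Suc k) \<omega> - J' (grid 0 t (Suc m) j) \<omega>))" for k
      proof (rule AE_I2)
        fix \<omega>
        let ?d = "\<Sigma> m k (Suc j * Suc k) \<omega> - J' (grid 0 t (Suc m) (Suc j)) \<omega> + - (\<Sigma> m k (j * Suc k) \<omega> - J' (grid 0 t (Suc m) j) \<omega>)"
        have "gg m j \<omega> * ((J' (grid 0 t (Suc m) (Suc j)) \<omega> - J' (grid 0 t (Suc m) j) \<omega>)
          - (\<Sigma> m k (Suc j * Suc k) \<omega> - \<Sigma> m k (j * Suc k) \<omega>)) = - (gg m j \<omega> * ?d)"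
        proof -
          have "x * ((p - q) - (c - d)) = - (x * (c - p + - (d - q)))" for x p q c d :: complex
            by (simp add: algebra_simps)
          then show ?thesis .
        qed
        then show "cmod (gg m j \<omega> * ((J' (grid 0 t (Suc m) (Suc j)) \<omega> - J' (grid 0 t (Suc m) j) \<omega>)
          - (\<Sigma> m k (Suc j * Suc k) \<omega> - \<Sigma> m k (j * Suc k) \<omega>))) \<le> 1 * cmod ?d"
          using norm_gg[of m j \<omega>] by (simp only: norm_minus_cancel norm_mult) (intro mult_right_mono; simp)
      qed
    qed simp
  qed simp
  \<comment> \<open>The refinement is chosen for each \<open>m\<close> without any rate; the area
    estimates hold for all refinements and so allow this.\<close>
  then obtain \<kappa>0 where E2null: "prob_null (\<lambda>m. E2 m (\<kappa>0 m))"
    by (rule prob_null_diagonal)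
  define \<kappa> where "\<kappa> m = Suc (\<kappa>0 m)" for m
  note tT = t
  interpret nested_grids M F W K a \<xi> t \<kappa>
  proof
    show "t > 0" by (rule t(1))
    show "\<kappa> m > 0" for m by (simp add: \<kappa>_def)
  qed
  note t = tT
  define C where "C m \<omega> = (\<Sum>j<Suc m. gg m j \<omega> * ((J' (grid 0 t (Suc m) (Suc j)) \<omega> - J' (grid 0 t (Suc m) j) \<omega>)
      - \<i> * of_real a * ((h' (grid 0 t (Suc m) j) \<omega> + h' (grid 0 t (Suc m) (Suc j)) \<omega>) / 2) *
           of_real (W (grid 0 t (Suc m) (Suc j)) \<omega> - W (grid 0 t (Suc m) j) \<omega>)))" for m \<omega>
  let ?B1 = "blocks (\<lambda>m i \<omega>. (h' (s m i) \<omega> - h' (start m i) \<omega>) * of_real (W (s m (Suc i)) \<omega> - W (s m i) \<omega>))"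
  let ?B2 = "blocks (\<lambda>m i \<omega>. (of_real (W (s m i) \<omega>) - of_real (W (start m i) \<omega>)) * (h' (s m (Suc i)) \<omega> - h' (s m i) \<omega>))"
  have B1: "prob_null ?B1"
  proof (rule blocks_dW_null)
    show "h' r \<in> borel_measurable (F r)" if "r \<in> {0..t}" for r using that t by (intro hF) auto
    show "AE \<omega> in M. continuous_on {0..t} (\<lambda>r. h' r \<omega>)"
      using cont by eventually_elim (rule continuous_on_subset, use t in auto)
  qed
  have B2: "prob_null ?B2"
  proof (rule blocks_dX_null[OF L1(1) L2(1) L1(2) L2(2) L1(3) L2(3)])
    show "h' r \<in> borel_measurable M" if "r \<in> {0..t}" for r using that t by (intro hM) auto
    show "AE \<omega> in M. \<forall>r\<in>{0..t}. Re (h' r \<omega>) = L1 r \<omega> + A1 r \<omega>"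
      using L1(4)
    proof eventually_elim
      case (elim \<omega>)
      show ?case
      proof
        fix r assume "r \<in> {0..t}"
        then show "Re (h' r \<omega>) = L1 r \<omega> + A1 r \<omega>" using elim[rule_format, of r] t by (simp add: min_def)
      qed
    qed
    show "AE \<omega> in M. \<forall>r\<in>{0..t}. Im (h' r \<omega>) = L2 r \<omega> + A2 r \<omega>"
      using L2(4)
    proof eventually_elim
      case (elim \<omega>)
      show ?case
      proof
        fix r assume "r \<in> {0..t}"
        then show "Im (h' r \<omega>) = L2 r \<omega> + A2 r \<omega>" using elim[rule_format, of r] t by (simp add: min_def)
      qed
    qed
  qed
  \<comment> \<open>Pass from the integral to the refined sum, then from the refined sum to the
    coarse trapezoid; the second step costs exactly the difference of the two areas.\<close>
  have C_eq: "C m \<omega> = E2 m (\<kappa>0 m) \<omega> + \<i> * of_real a / 2 * (?B1 m \<omega> - ?B2 m \<omega>)" for m \<omega>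
  proof -
    let ?T = "\<lambda>i. (h' (s m i) \<omega> + h' (s m (Suc i)) \<omega>) / 2 * of_real (W (s m (Suc i)) \<omega> - W (s m i) \<omega>)"
    have "\<Sigma> m (\<kappa>0 m) (Suc j * Suc (\<kappa>0 m)) \<omega> - \<Sigma> m (\<kappa>0 m) (j * Suc (\<kappa>0 m)) \<omega> = \<i> * of_real a * (\<Sum>i=j*\<kappa> m..<j*\<kappa> m+\<kappa> m. ?T i)" for j
    proof -
      have S: "\<Sigma> m (\<kappa>0 m) n \<omega> = (\<Sum>i<n. \<i> * of_real a * ?T i)" for n
        unfolding \<Sigma>_def stratonovich_sum_def s_def \<kappa>_def \<sigma>_def by (intro sum.cong refl) (simp add: field_simps)
      have "Suc j * Suc (\<kappa>0 m) = j * \<kappa> m + \<kappa> m" "j * Suc (\<kappa>0 m) = j * \<kappa> m" by (simp_all add: \<kappa>_def mult_Suc)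
      moreover have "(\<Sum>i<j * \<kappa> m + \<kappa> m. \<i> * of_real a * ?T i) - (\<Sum>i<j * \<kappa> m. \<i> * of_real a * ?T i)
          = (\<Sum>i=j*\<kappa> m..<j*\<kappa> m+\<kappa> m. \<i> * of_real a * ?T i)"
        unfolding lessThan_atLeast0 by (rule sum_diff_nat_ivl) auto
      ultimately show ?thesis by (simp only: S sum_distrib_left)
    qed
    then have E2_eq: "E2 m (\<kappa>0 m) \<omega> = (\<Sum>j<Suc m. gg m j \<omega> * ((J' (grid 0 t (Suc m) (Suc j)) \<omega> - J' (grid 0 t (Suc m) j) \<omega>)
        - \<i> * of_real a * (\<Sum>i=j*\<kappa> m..<j*\<kappa> m+\<kappa> m. ?T i)))"
      by (simp only: E2_def)
    have gen: "(\<Sum>j<Suc m. c j * (d j - z * x j * w j)) - (\<Sum>j<Suc m. c j * (d j - z * y j))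
        = z * (\<Sum>j<Suc m. c j * (y j - x j * w j))" for c d x y w :: "nat \<Rightarrow> complex" and z
      unfolding sum_subtractf[symmetric] sum_distrib_left by (intro sum.cong refl) (simp add: algebra_simps)
    have "C m \<omega> - E2 m (\<kappa>0 m) \<omega> = \<i> * of_real a * (\<Sum>j<Suc m. (g m j \<omega> + g m (Suc j) \<omega>) / 2 *
        ((\<Sum>i=j*\<kappa> m..<j*\<kappa> m+\<kappa> m. ?T i) - (h' (grid 0 t (Suc m) j) \<omega> + h' (grid 0 t (Suc m) (Suc j)) \<omega>) / 2 *
           of_real (W (grid 0 t (Suc m) (Suc j)) \<omega> - W (grid 0 t (Suc m) j) \<omega>)))"
      unfolding C_def E2_eq gen gg_def g_def ..
    also have "\<dots> = \<i> * of_real a * ((?B1 m \<omega> - ?B2 m \<omega>) / 2)" unfolding blocks_levy_area ..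
    finally have "C m \<omega> - E2 m (\<kappa>0 m) \<omega> = \<i> * of_real a * ((?B1 m \<omega> - ?B2 m \<omega>) / 2)" .
    note 1 = this
    have 2: "x = y + z / 2 * w" if "x - y = z * (w / 2)" for x y z w :: complex
      using that by (simp add: field_simps)
    show ?thesis by (rule 2[OF 1])
  qed
  have C0: "prob_null C"
  proof -
    have "prob_null (\<lambda>m \<omega>. - (?B2 m \<omega>))"
      by (rule prob_null_mono[OF B2, where C = 1]) (use prob_null_measurable[OF B2] in auto)
    note B = prob_null_add[OF B1 this]
    have "prob_null (\<lambda>m \<omega>. \<i> * of_real a / 2 * (?B1 m \<omega> + - ?B2 m \<omega>))"
      by (rule prob_null_mono[OF B, where C = "a / 2"])
        (use prob_null_measurable[OF B] a in \<open>auto simp: norm_mult norm_divide intro!: borel_measurable_times\<close>)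
    from prob_null_add[OF E2null this] show ?thesis
      by (simp add: C_eq[abs_def] fun_eq_iff)
  qed
  \<comment> \<open>Controls \<open>H\<close> on each path, up to a factor depending on the path
    through the supremum of |h'|.\<close>
  define Y where "Y m \<omega> = (\<Sum>j<Suc m. \<bar>W (grid 0 t (Suc m) (Suc j)) \<omega> - W (grid 0 t (Suc m) j) \<omega>\<bar> ^ 3)" for m \<omega>
  have Y0: "0 \<le> Y m \<omega>" for m \<omega> unfolding Y_def by (intro sum_nonneg) simp
  have YM: "Y m \<in> borel_measurable M" for m
  proof -
    have [measurable]: "W (grid 0 t (Suc m) i) \<in> borel_measurable M" for i
      using W_measurable grid_mono[of 0 t 0 i "Suc m"] t by simp
    show ?thesis unfolding Y_def by measurable
  qed
  have Ynull: "prob_null (\<lambda>m \<omega>. of_real (Y m \<omega>))"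
  proof (rule prob_null_cube_sum[OF coarse, where C = 1])
    show "(\<lambda>\<omega>. complex_of_real (Y m \<omega>)) \<in> borel_measurable M" for m using YM[of m] by measurable
    show "cmod (of_real (Y m \<omega>)) \<le> 1 * (\<Sum>i<Suc m. \<bar>W (grid 0 t (Suc m) (Suc i)) \<omega> - W (grid 0 t (Suc m) i) \<omega>\<bar> ^ 3)" for m \<omega>
      using Y0[of m \<omega>] by (simp add: Y_def[symmetric])
  qed simp
  have CM: "C m \<in> borel_measurable M" for m by (rule prob_null_measurable[OF C0])
  have "prob_null (\<lambda>m \<omega>. of_real (cmod (C m \<omega>)))"
  proof (rule prob_null_mono[OF C0, where C = 1])
    show "(\<lambda>\<omega>. complex_of_real (cmod (C m \<omega>))) \<in> borel_measurable M" for m using CM[of m] by measurable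
  qed auto
  \<comment> \<open>Adding the nonnegative quantities \<open>cmod (C m)\<close> and
    \<open>Y m\<close> yields one subsequence along which both tend to 0.\<close>
  from prob_null_subseq[OF prob_null_add[OF this Ynull]] obtain r where r: "strict_mono r"
    and lim: "AE \<omega> in M. (\<lambda>m. complex_of_real (cmod (C (r m) \<omega>)) + of_real (Y (r m) \<omega>)) \<longlonglongrightarrow> 0"
    by blast
  from lim cont h0 Jeq AE_space show ?thesis
  proof eventually_elim
    case (elim \<omega>)
    note \<omega> = elim(5)
    have lim': "(\<lambda>m. cmod (C (r m) \<omega>) + Y (r m) \<omega>) \<longlonglongrightarrow> 0"
      using tendsto_Re[OF elim(1)] by simp
    have Cl: "(\<lambda>m. C (r m) \<omega>) \<longlonglongrightarrow> 0"
      by (rule tendsto_norm_zero_cancel, rule tendsto_sandwich[OF _ _ tendsto_const lim']) (auto simp: Y0)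
    have Yl: "(\<lambda>m. Y (r m) \<omega>) \<longlonglongrightarrow> 0"
      by (rule tendsto_sandwich[OF _ _ tendsto_const lim']) (auto simp: Y0)
    have ch: "continuous_on {0..t} (\<lambda>r. h' r \<omega>)"
      using elim(2) by (rule continuous_on_subset) (use t in auto)
    have cbh: "continuous_on {0..t} (\<lambda>r. b (h' r \<omega>))" by (intro continuous_intros ch)
    have ce: "continuous_on {0..t} (\<lambda>s. cnj (e s \<omega>))" by (intro continuous_intros e_continuous'[OF \<omega>]) simp
    have "bounded ((\<lambda>r. h' r \<omega>) ` {0..t})"
      by (intro compact_imp_bounded compact_continuous_image ch) auto
    then obtain B where B: "\<forall>y\<in>(\<lambda>r. h' r \<omega>) ` {0..t}. norm y \<le> B" unfolding bounded_iff by blast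
    let ?\<tau> = "\<lambda>m. grid 0 t (Suc m)"
    let ?hh = "\<lambda>m j. (h' (?\<tau> m j) \<omega> + h' (?\<tau> m (Suc j)) \<omega>) / 2"
    let ?dW = "\<lambda>m j. W (?\<tau> m (Suc j)) \<omega> - W (?\<tau> m j) \<omega>"
    define H where "H m = (\<Sum>j<Suc m. ?hh m j * cnj (e (?\<tau> m (Suc j)) \<omega> - e (?\<tau> m j) \<omega>
        - \<i> * of_real a * ((e (?\<tau> m j) \<omega> + e (?\<tau> m (Suc j)) \<omega>) / 2) * of_real (?dW m j)))" for m
    define R where "R m = (\<Sum>j<Suc m. gg m j \<omega> * integral {?\<tau> m j..?\<tau> m (Suc j)} (\<lambda>s. b (h' s \<omega>)))" for m
    have Hb: "cmod (H m) \<le> B * a ^ 3 * Y m \<omega>" for m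
      unfolding H_def Y_def sum_distrib_left
    proof (rule sum_norm_le)
      fix j assume "j \<in> {..<Suc m}"
      then have "?\<tau> m j \<in> {0..t}" "?\<tau> m (Suc j) \<in> {0..t}" by (auto intro!: \<tau> simp del: atLeastAtMost_iff)
      then have "cmod (h' (?\<tau> m j) \<omega>) \<le> B" "cmod (h' (?\<tau> m (Suc j)) \<omega>) \<le> B" using B by blast+
      then have "cmod (?hh m j - 0) \<le> B" by (intro norm_midpoint_diff_le) auto
      moreover have "0 \<le> B" using norm_ge_zero \<open>cmod (h' (?\<tau> m j) \<omega>) \<le> B\<close> order_trans by blast
      ultimately have "cmod (?hh m j) * cmod (cnj (e (?\<tau> m (Suc j)) \<omega> - e (?\<tau> m j) \<omega>
          - \<i> * of_real a * ((e (?\<tau> m j) \<omega> + e (?\<tau> m (Suc j)) \<omega>) / 2) * of_real (?dW m j))) \<le> B * (a ^ 3 * \<bar>?dW m j\<bar> ^ 3)"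
        unfolding complex_mod_cnj by (intro mult_mono cis_increment_trapezoid) auto
      then show "cmod (?hh m j * cnj (e (?\<tau> m (Suc j)) \<omega> - e (?\<tau> m j) \<omega>
          - \<i> * of_real a * ((e (?\<tau> m j) \<omega> + e (?\<tau> m (Suc j)) \<omega>) / 2) * of_real (?dW m j))) \<le> B * a ^ 3 * \<bar>?dW m j\<bar> ^ 3"
        by (simp only: norm_mult mult.assoc)
    qed
    have Hl: "(\<lambda>m. H (r m)) \<longlonglongrightarrow> 0"
    proof (rule Lim_null_comparison)
      show "\<forall>\<^sub>F m in sequentially. cmod (H (r m)) \<le> B * a ^ 3 * Y (r m) \<omega>"
        by (intro always_eventually allI Hb)
      show "(\<lambda>m. B * a ^ 3 * Y (r m) \<omega>) \<longlonglongrightarrow> 0"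
        by (rule tendsto_mult_right_zero[OF Yl])
    qed
    have Rl: "R \<longlonglongrightarrow> integral {0..t} (\<lambda>s. cnj (e s \<omega>) * b (h' s \<omega>))"
      unfolding R_def
    proof (rule weighted_riemann_tendsto[OF coarse cbh ce])
      fix \<epsilon> :: real assume "\<epsilon> > 0"
      from partition_seq_osc[OF coarse ce this]
      show "\<forall>\<^sub>F m in sequentially. \<forall>i<Suc m. \<forall>s\<in>{?\<tau> m i..?\<tau> m (Suc i)}. cmod (gg m i \<omega> - cnj (e s \<omega>)) \<le> \<epsilon>"
      proof eventually_elim
        case (elim m)
        show ?case
        proof (intro allI impI ballI)
          fix i s assume i: "i < Suc m" and s: "s \<in> {?\<tau> m i..?\<tau> m (Suc i)}"
          have "?\<tau> m i \<le> ?\<tau> m (Suc i)" using t by (intro grid_mono) auto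
          then have "dist (cnj (e (?\<tau> m i) \<omega>)) (cnj (e s \<omega>)) < \<epsilon>" "dist (cnj (e (?\<tau> m (Suc i)) \<omega>)) (cnj (e s \<omega>)) < \<epsilon>"
            using elim i s by auto
          then show "cmod (gg m i \<omega> - cnj (e s \<omega>)) \<le> \<epsilon>"
            unfolding gg_def by (intro norm_midpoint_diff_le) (auto simp: dist_norm)
        qed
      qed
    qed
    have eq: "cnj (e t \<omega>) * h' t \<omega> - \<xi> \<omega> = C m \<omega> + H m + R m" for m
    proof -
      have "cnj (e t \<omega>) * h' t \<omega> - \<xi> \<omega> = (\<Sum>j<Suc m. cnj (e (?\<tau> m (Suc j)) \<omega>) * h' (?\<tau> m (Suc j)) \<omega> - cnj (e (?\<tau> m j) \<omega>) * h' (?\<tau> m j) \<omega>)"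
        using sum_lessThan_telescope[of "\<lambda>j. cnj (e (?\<tau> m j) \<omega>) * h' (?\<tau> m j) \<omega>" "Suc m"] elim(3) grid_self[of "Suc m" 0 t]
        by (simp add: e_def W_0[OF \<omega>])
      also have "\<dots> = C m \<omega> + H m + R m"
        unfolding C_def H_def R_def sum.distrib[symmetric]
      proof (intro sum.cong refl)
        fix j assume j: "j \<in> {..<Suc m}"
        have le: "0 \<le> ?\<tau> m j" "?\<tau> m j \<le> ?\<tau> m (Suc j)" "?\<tau> m j \<in> {0..T}" "?\<tau> m (Suc j) \<in> {0..T}" "?\<tau> m (Suc j) \<in> {0..t}"
          using \<tau>[of j m] \<tau>[of "Suc j" m] j t by (auto intro!: grid_mono)
        have "(\<lambda>s. b (h' s \<omega>)) integrable_on {0..?\<tau> m (Suc j)}"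
          by (rule integrable_continuous_real, rule continuous_on_subset[OF cbh]) (use le in auto)
        from Henstock_Kurzweil_Integration.integral_combine[OF le(1,2) this]
        have I: "h' (?\<tau> m (Suc j)) \<omega> - h' (?\<tau> m j) \<omega> = integral {?\<tau> m j..?\<tau> m (Suc j)} (\<lambda>s. b (h' s \<omega>))
            + (J' (?\<tau> m (Suc j)) \<omega> - J' (?\<tau> m j) \<omega>)"
          using elim(4)[rule_format, OF le(3)] elim(4)[rule_format, OF le(4)] by (simp add: algebra_simps)
        define I1 where "I1 = integral {?\<tau> m j..?\<tau> m (Suc j)} (\<lambda>s. b (h' s \<omega>))"
        define dJ where "dJ = J' (?\<tau> m (Suc j)) \<omega> - J' (?\<tau> m j) \<omega>"
        define x y where "x = h' (?\<tau> m j) \<omega>" and "y = h' (?\<tau> m (Suc j)) \<omega>"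
        define p q where "p = cnj (e (?\<tau> m j) \<omega>)" and "q = cnj (e (?\<tau> m (Suc j)) \<omega>)"
        define dw where "dw = complex_of_real (?dW m j)"
        have yx: "y = x + I1 + dJ" using I by (simp add: x_def y_def I1_def dJ_def algebra_simps)
        \<comment> \<open>The discrete product rule is exact. The terms
          \<open>\<i> * a * (p + q) / 2 * (x + y) / 2 * dw\<close> are subtracted in the first
          summand and added in the second.\<close>
        have "q * y - p * x = (p + q) / 2 * (dJ - \<i> * of_real a * ((x + y) / 2) * dw)
            + (x + y) / 2 * (q - p + \<i> * of_real a * ((p + q) / 2) * dw) + (p + q) / 2 * I1"
          unfolding yx by (simp add: field_simps)
        moreover have "cnj (e (?\<tau> m (Suc j)) \<omega> - e (?\<tau> m j) \<omega>
            - \<i> * of_real a * ((e (?\<tau> m j) \<omega> + e (?\<tau> m (Suc j)) \<omega>) / 2) * of_real (?dW m j)) = q - p + \<i> * of_real a * ((p + q) / 2) * dw"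
          by (simp add: p_def q_def dw_def)
        ultimately show "cnj (e (?\<tau> m (Suc j)) \<omega>) * h' (?\<tau> m (Suc j)) \<omega> - cnj (e (?\<tau> m j) \<omega>) * h' (?\<tau> m j) \<omega>
          = gg m j \<omega> * ((J' (?\<tau> m (Suc j)) \<omega> - J' (?\<tau> m j) \<omega>) - \<i> * of_real a * ?hh m j * of_real (?dW m j))
          + ?hh m j * cnj (e (?\<tau> m (Suc j)) \<omega> - e (?\<tau> m j) \<omega>
            - \<i> * of_real a * ((e (?\<tau> m j) \<omega> + e (?\<tau> m (Suc j)) \<omega>) / 2) * of_real (?dW m j))
          + gg m j \<omega> * integral {?\<tau> m j..?\<tau> m (Suc j)} (\<lambda>s. b (h' s \<omega>))"
          by (simp only: gg_def x_def[symmetric] y_def[symmetric] p_def[symmetric] q_def[symmetric] dJ_def[symmetric] I1_def[symmetric] dw_def[symmetric])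
      qed
      finally show ?thesis .
    qed
    have "(\<lambda>m. C (r m) \<omega> + H (r m) + R (r m)) \<longlonglongrightarrow> 0 + 0 + integral {0..t} (\<lambda>s. cnj (e s \<omega>) * b (h' s \<omega>))"
      by (intro tendsto_add Cl Hl LIMSEQ_subseq_LIMSEQ[OF Rl r, unfolded o_def])
    then have "cnj (e t \<omega>) * h' t \<omega> - \<xi> \<omega> = integral {0..t} (\<lambda>s. cnj (e s \<omega>) * b (h' s \<omega>))"
      unfolding eq[symmetric] by (simp add: LIMSEQ_const_iff)
    then show ?case by (simp add: algebra_simps)
  qed
qed

text \<open>The rationals approach \<open>t\<close> strictly from the left and stay positive, so
  they remain in the interval even for \<open>t = T\<close> irrational.\<close>

lemma continuous_on_eq_of_rat:
  fixes f g :: "real \<Rightarrow> complex"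
  assumes f: "continuous_on {0..T} f" and g: "continuous_on {0..T} g"
    and eq: "\<And>q. of_rat q \<in> {0<..T} \<Longrightarrow> f (of_rat q) = g (of_rat q)" and t: "t \<in> {0<..T}"
  shows "f t = g t"
proof -
  have "\<exists>q. max 0 (t - inverse (real (Suc n))) < of_rat q \<and> of_rat q < t" for n
    using t of_rat_dense[of "max 0 (t - inverse (real (Suc n)))" t] by auto
  then obtain q where q: "\<And>n. max 0 (t - inverse (real (Suc n))) < of_rat (q n)" "\<And>n. of_rat (q n) < t"
    by metis
  have "(\<lambda>n. t - inverse (real (Suc n))) \<longlonglongrightarrow> t - 0"
    by (intro tendsto_diff tendsto_const LIMSEQ_inverse_real_of_nat)
  then have "(\<lambda>n. t - inverse (real (Suc n))) \<longlonglongrightarrow> t" by simp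
  note below = this
  have lim: "(\<lambda>n. real_of_rat (q n)) \<longlonglongrightarrow> t"
    by (rule tendsto_sandwich[OF _ _ below tendsto_const]) (use q in \<open>auto intro!: always_eventually less_imp_le\<close>)
  have mem: "of_rat (q n) \<in> {0<..T}" for n using q[of n] t by auto
  have "(\<lambda>n. f (of_rat (q n))) \<longlonglongrightarrow> f t" "(\<lambda>n. g (of_rat (q n))) \<longlonglongrightarrow> g t"
    using continuous_on_tendsto_compose[OF f lim] continuous_on_tendsto_compose[OF g lim] mem t
    by (auto intro!: always_eventually less_imp_le)
  moreover have "f (of_rat (q n)) = g (of_rat (q n))" for n by (rule eq[OF mem])
  ultimately show ?thesis using LIMSEQ_unique by simp
qed

text \<open>The integral equation holds almost surely at each fixed time, hence at all rational
  times at once, hence at all times by continuity. Then \<open>cnj e * h'\<close> and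
  \<open>u\<close> solve the same equation on almost every path.\<close>

lemma solution_unique:
  assumes sol: "stratonovich_solution M F W b \<sigma> \<xi> T h'" and T: "T > 0"
  shows "AE \<omega> in M. \<forall>t\<in>{0..T}. h' t \<omega> = h t \<omega>"
proof -
  have "AE \<omega> in M. \<forall>q. of_rat q \<in> {0<..T} \<longrightarrow>
      cnj (e (of_rat q) \<omega>) * h' (of_rat q) \<omega> = \<xi> \<omega> + integral {0..of_rat q} (\<lambda>s. cnj (e s \<omega>) * b (h' s \<omega>))"
    unfolding AE_all_countable
  proof
    fix q
    show "AE \<omega> in M. of_rat q \<in> {0<..T} \<longrightarrow>
      cnj (e (of_rat q) \<omega>) * h' (of_rat q) \<omega> = \<xi> \<omega> + integral {0..of_rat q} (\<lambda>s. cnj (e s \<omega>) * b (h' s \<omega>))"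
    proof (cases "of_rat q \<in> {0<..T}")
      case True
      then have "0 < real_of_rat q" "of_rat q \<le> T" by auto
      from solution_integral_equation[OF sol this] show ?thesis by eventually_elim simp
    next
      case False
      then show ?thesis by (intro AE_I2) blast
    qed
  qed
  moreover have "AE \<omega> in M. continuous_on {0..T} (\<lambda>t. h' t \<omega>)" "AE \<omega> in M. h' 0 \<omega> = \<xi> \<omega>"
    using sol by (auto simp: stratonovich_solution_def)
  ultimately show ?thesis using AE_space
  proof eventually_elim
    case (elim \<omega>)
    note \<omega> = elim(4)
    define v where "v t = cnj (e t \<omega>) * h' t \<omega>" for t
    have ce: "continuous_on {0..T} (\<lambda>s. cnj (e s \<omega>))" by (intro continuous_intros e_continuous'[OF \<omega>]) simp
    have cv: "continuous_on {0..T} v" unfolding v_def by (intro continuous_intros ce elim(2))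
    have ci: "continuous_on {0..T} (\<lambda>t. \<xi> \<omega> + integral {0..t} (\<lambda>s. cnj (e s \<omega>) * b (h' s \<omega>)))"
      by (intro continuous_intros indefinite_integral_continuous_1 integrable_continuous_real ce elim(2))
    have ev: "e t \<omega> * v t = h' t \<omega>" for t unfolding v_def by (rule e_cnj)
    have v_eq: "v t = \<xi> \<omega> + integral {0..t} (\<lambda>s. of_real K * cnj (e s \<omega>) * (1 - (e s \<omega> * v s)\<^sup>2))" if "t \<in> {0..T}" for t
    proof -
      have "v t = \<xi> \<omega> + integral {0..t} (\<lambda>s. cnj (e s \<omega>) * b (h' s \<omega>))"
      proof (cases "t = 0")
        case True
        then show ?thesis using elim(3) by (simp add: v_def e_def W_0[OF \<omega>])
      next
        case False
        then have "t \<in> {0<..T}" using that by auto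
        from continuous_on_eq_of_rat[OF cv ci _ this] elim(1) show ?thesis by (auto simp: v_def)
      qed
      then show ?thesis unfolding ev b_def by (simp add: mult_ac)
    qed
    have u_eq': "u t \<omega> = \<xi> \<omega> + integral {0..t} (\<lambda>s. of_real K * cnj (e s \<omega>) * (1 - (e s \<omega> * u s \<omega>)\<^sup>2))" if "t \<in> {0..T}" for t
      using u_eq[OF \<omega>, of t] that by (simp add: b_def h_def mult_ac)
    show ?case
    proof
      fix t assume t: "t \<in> {0..T}"
      have "v t = u t \<omega>"
        by (rule rot_equation_unique[OF e_continuous[OF \<omega>] norm_e K \<xi>_le cv u_continuous[OF \<omega>] v_eq u_eq' t])
      then show "h' t \<omega> = h t \<omega>" using ev[of t] by (simp add: h_def)
    qed
  qed
qed

end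

text \<open>For each partition the two sums agree almost surely, so the probabilities in the
  definition coincide and the same mesh bound works.\<close>

lemma (in prob_space) stratonovich_integral_cong:
  assumes I: "has_stratonovich_integral M X W t J" and eq: "AE \<omega> in M. \<forall>r\<ge>0. W' r \<omega> = W r \<omega>"
    and X: "\<And>r. r \<in> {0..t} \<Longrightarrow> X r \<in> borel_measurable M"
    and W: "\<And>r. 0 \<le> r \<Longrightarrow> W r \<in> borel_measurable M" and W': "\<And>r. 0 \<le> r \<Longrightarrow> W' r \<in> borel_measurable M"
  shows "has_stratonovich_integral M X W' t J"
proof -
  have J[measurable]: "J \<in> borel_measurable M" using I by (simp add: has_stratonovich_integral_def)
  have "\<P>(\<omega> in M. cmod (stratonovich_sum X W' n p \<omega> - J \<omega>) > \<eta>) = \<P>(\<omega> in M. cmod (stratonovich_sum X W n p \<omega> - J \<omega>) > \<eta>)"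
    if p: "subdivision t n p" for n p \<eta>
  proof -
    have p': "\<forall>i<n. p i \<le> p (Suc i)" "p 0 = 0" "p n \<le> t" using p by (auto simp: subdivision_def)
    note [measurable] = stratonovich_sum_measurable[OF p' X W] stratonovich_sum_measurable[OF p' X W']
    have "AE \<omega> in M. stratonovich_sum X W' n p \<omega> = stratonovich_sum X W n p \<omega>"
      using eq
    proof eventually_elim
      case (elim \<omega>)
      show ?case
        unfolding stratonovich_sum_def
      proof (intro sum.cong refl)
        fix i assume "i \<in> {..<n}"
        then have "0 \<le> p i" "0 \<le> p (Suc i)"
          using partition_mono[OF p'(1), of 0 i] partition_mono[OF p'(1), of 0 "Suc i"] p'(2) by auto
        then show "(X (p i) \<omega> + X (p (Suc i)) \<omega>) / 2 * of_real (W' (p (Suc i)) \<omega> - W' (p i) \<omega>)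
            = (X (p i) \<omega> + X (p (Suc i)) \<omega>) / 2 * of_real (W (p (Suc i)) \<omega> - W (p i) \<omega>)"
          using elim by simp
      qed
    qed
    then show ?thesis by (intro measure_eq_AE) auto
  qed
  then show ?thesis
    using I unfolding has_stratonovich_integral_def by (simp cong: conj_cong imp_cong)
qed

lemma (in usual_filtration) stratonovich_solution_cong:
  assumes sol: "stratonovich_solution M F W b \<sigma> \<xi> T h"
    and eq: "AE \<omega> in M. \<forall>r\<ge>0. W' r \<omega> = W r \<omega>" "AE \<omega> in M. \<xi>' \<omega> = \<xi> \<omega>"
    and W: "\<And>r. 0 \<le> r \<Longrightarrow> W r \<in> borel_measurable M" and W': "\<And>r. 0 \<le> r \<Longrightarrow> W' r \<in> borel_measurable M"
    and \<sigma>: "\<sigma> \<in> borel_measurable borel"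
  shows "stratonovich_solution M F W' b \<sigma> \<xi>' T h"
proof -
  obtain J where I: "\<And>t. t \<in> {0..T} \<Longrightarrow> has_stratonovich_integral M (\<lambda>s \<omega>. \<sigma> (h s \<omega>)) W t (J t)"
    and Jeq: "AE \<omega> in M. \<forall>t\<in>{0..T}. h t \<omega> = \<xi> \<omega> + integral {0..t} (\<lambda>s. b (h s \<omega>)) + J t \<omega>"
    using sol unfolding stratonovich_solution_def by blast
  have hF: "h t \<in> borel_measurable (F t)" if "t \<in> {0..T}" for t
    using sol that by (auto simp: stratonovich_solution_def)
  have X: "(\<lambda>\<omega>. \<sigma> (h r \<omega>)) \<in> borel_measurable M" if "r \<in> {0..T}" for r
    using measurable_compose[OF measurable_F[OF _ hF[OF that]] \<sigma>] that by auto
  have "has_stratonovich_integral M (\<lambda>s \<omega>. \<sigma> (h s \<omega>)) W' t (J t)" if "t \<in> {0..T}" for t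
    by (rule stratonovich_integral_cong[OF I[OF that] eq(1) X W W']) (use that in auto)
  moreover have "AE \<omega> in M. \<forall>t\<in>{0..T}. h t \<omega> = \<xi>' \<omega> + integral {0..t} (\<lambda>s. b (h s \<omega>)) + J t \<omega>"
    using Jeq eq(2) by eventually_elim simp
  moreover have "AE \<omega> in M. h 0 \<omega> = \<xi>' \<omega>"
  proof -
    have "AE \<omega> in M. h 0 \<omega> = \<xi> \<omega>" using sol by (simp add: stratonovich_solution_def)
    then show ?thesis using eq(2) by eventually_elim simp
  qed
  ultimately show ?thesis using sol unfolding stratonovich_solution_def by blast
qed

text \<open>Existence and uniqueness are proved for the modified path and datum and carried back by
  almost sure equality. One \<open>h\<close> serves all horizons because the Picard limit is defined
  for all times.\<close>

theorem proposition6: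
  fixes M :: "'a measure" and F :: "real \<Rightarrow> 'a measure" and W :: "real \<Rightarrow> 'a \<Rightarrow> real"
    and K \<epsilon> :: real and \<xi> :: "'a \<Rightarrow> complex" and b \<sigma> :: "complex \<Rightarrow> complex"
  assumes "usual_filtration M F"
    and "brownian_motion M F W"
    and "K > 0" and "\<epsilon> > 0"
    and "\<xi> \<in> borel_measurable (F 0)"
    and "\<P>(\<omega> in M. cmod (\<xi> \<omega>) \<le> 1) = 1"
  defines "b \<equiv> \<lambda>z. of_real K * (1 - z\<^sup>2)"
    and "\<sigma> \<equiv> \<lambda>z. of_real (sqrt 2) * \<i> * of_real \<epsilon> * z"
  shows "\<exists>h :: real \<Rightarrow> 'a \<Rightarrow> complex.
      (\<forall>T>0. stratonovich_solution M F W b \<sigma> \<xi> T h \<and>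
         (\<forall>h'. stratonovich_solution M F W b \<sigma> \<xi> T h' \<longrightarrow>
            (AE \<omega> in M. \<forall>t\<in>{0..T}. h' t \<omega> = h t \<omega>))) \<and>
      \<P>(\<omega> in M. (SUP t\<in>{0..}. ereal (cmod (h t \<omega>))) \<le> 1) = 1 \<and>
      ((AE \<omega> in M. cmod (\<xi> \<omega>) = 1) \<longrightarrow> (AE \<omega> in M. \<forall>t\<ge>0. cmod (h t \<omega>) = 1)) \<and>
      ((AE \<omega> in M. cmod (\<xi> \<omega>) < 1) \<longrightarrow> (AE \<omega> in M. \<forall>t\<ge>0. cmod (h t \<omega>) < 1))"
proof -
  interpret usual_filtration M F by fact
  obtain V where V: "brownian_filtration M F V" and VW: "AE \<omega> in M. \<forall>t\<ge>0. V t \<omega> = W t \<omega>"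
    by (rule brownian_modification[OF assms(2)])
  interpret V: brownian_filtration M F V by (rule V)
  note [measurable] = assms(5) measurable_F[OF order_refl assms(5)]
  \<comment> \<open>The default 0 lies in the disc, so the bound holds everywhere; the change
    concerns a null set only.\<close>
  define \<zeta> where "\<zeta> \<omega> = (if cmod (\<xi> \<omega>) \<le> 1 then \<xi> \<omega> else 0)" for \<omega>
  have \<zeta>F: "\<zeta> \<in> borel_measurable (F 0)" unfolding \<zeta>_def by measurable
  have "AE \<omega> in M. cmod (\<xi> \<omega>) \<le> 1"
    using assms(6) by (subst (asm) prob_Collect_eq_1) auto
  then have \<zeta>\<xi>: "AE \<omega> in M. \<zeta> \<omega> = \<xi> \<omega>" by eventually_elim (simp add: \<zeta>_def)
  interpret D: disc_setup M F V K "sqrt 2 * \<epsilon>" \<zeta>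
    by unfold_locales (use assms(3,4) \<zeta>F in \<open>auto simp: \<zeta>_def\<close>)
  have b: "b = D.b" unfolding b_def D.b_def[abs_def] ..
  have \<sigma>: "\<sigma> = D.\<sigma>" unfolding \<sigma>_def D.\<sigma>_def[abs_def] by (simp add: mult_ac)
  have \<sigma>M: "\<sigma> \<in> borel_measurable borel" unfolding \<sigma>_def by measurable
  have WM: "W r \<in> borel_measurable M" if "0 \<le> r" for r
    using assms(2) measurable_F[OF that] that by (auto simp: brownian_motion_def adapted_def)
  have WV: "AE \<omega> in M. \<forall>t\<ge>0. W t \<omega> = V t \<omega>" using VW by eventually_elim simp
  have \<xi>\<zeta>: "AE \<omega> in M. \<xi> \<omega> = \<zeta> \<omega>" using \<zeta>\<xi> by eventually_elim simp
  show ?thesis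
  proof (intro exI[of _ D.h] conjI allI impI)
    fix T :: real assume T: "T > 0"
    show "stratonovich_solution M F W b \<sigma> \<xi> T D.h"
      by (rule stratonovich_solution_cong[OF _ WV \<xi>\<zeta> V.W_measurable WM \<sigma>M])
        (use D.h_solution[OF T] in \<open>simp_all add: b \<sigma>\<close>)
    fix h' assume "stratonovich_solution M F W b \<sigma> \<xi> T h'"
    from stratonovich_solution_cong[OF this VW \<zeta>\<xi> WM V.W_measurable \<sigma>M]
    have "stratonovich_solution M F V D.b D.\<sigma> \<zeta> T h'" by (simp add: b \<sigma>)
    from D.solution_unique[OF this T] show "AE \<omega> in M. \<forall>t\<in>{0..T}. h' t \<omega> = D.h t \<omega>" .
  next
    \<comment> \<open>The bound holds at every sample point, so the event is the whole space and the
      uncountable supremum raises no question of measurability.\<close>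
    have "(SUP t\<in>{0..}. ereal (cmod (D.h t \<omega>))) \<le> 1" if "\<omega> \<in> space M" for \<omega>
      by (rule SUP_least) (use D.norm_h(1)[OF that] in \<open>auto simp: one_ereal_def\<close>)
    then have "{\<omega> \<in> space M. (SUP t\<in>{0..}. ereal (cmod (D.h t \<omega>))) \<le> 1} = space M" by auto
    then show "\<P>(\<omega> in M. (SUP t\<in>{0..}. ereal (cmod (D.h t \<omega>))) \<le> 1) = 1" by (simp add: prob_space)
  next
    assume "AE \<omega> in M. cmod (\<xi> \<omega>) = 1"
    with \<xi>\<zeta> AE_space show "AE \<omega> in M. \<forall>t\<ge>0. cmod (D.h t \<omega>) = 1"
      by eventually_elim (auto intro!: D.norm_h(2))
  next
    assume "AE \<omega> in M. cmod (\<xi> \<omega>) < 1"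
    with \<xi>\<zeta> AE_space show "AE \<omega> in M. \<forall>t\<ge>0. cmod (D.h t \<omega>) < 1"
      by eventually_elim (auto intro!: D.norm_h(3))
  qed
qed

end
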